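(* Let $p$ be a prime and let $G$ be a finitely generated, self-replicating $p$-group or pro-$p$ group that has the congruence subgroup property. Then $G$ has subgroup growth of type $n^{\log n}$. More precisely, suppose $G$ contains a principal congruence subgroup $N$ such that $N\cong G^{(k)}$, $|G/N|=p^{\ell}$, and $N\leq \Phi_p(G)$. Put $\delta=\max_H d_p(H)$, where $H$ runs over all subgroups of the finite group $G/N$. Then (1) $\displaystyle \frac{(k-1)\,d_p(G)}{\ell}\leq \alpha(G)\leq (k-1)\,d_p(G)+\delta$; (2) $\displaystyle \alpha(G)=\lim_{m\to\infty}\frac{d_{p,G}(m)}{m}=\sup_{m\geq 0}\frac{d_{p,G}(m)}{m+\frac{\ell}{k-1}}$.
   Context: Throughout $p$ is a fixed prime and $\log=\log_p$. A $p$-group is a (possibly infinite) group in which every element has order a power of $p$. For topological (pro-$p$) groups, subgroups are closed and generators are topological generators. $s_n(G)$ is the number of subgroups of $G$ of index at most $n$. $\Phi_p(G)=[G,G]G^p$, where $G^p$ is the (closed) subgroup generated by $p$-th powers, and $d_p(G)=\dim_{\mathbb{F}_p}(G/\Phi_p(G))$. $d_{p,G}(m)$ is the maximum of $d_p(U)$ as $U$ ranges over all subgroups of $G$ of index $p^m$. $\alpha(G)=\lim_{m\to\infty} d_{p,G}(m)/m$ (part of the assertion is that this limit exists). For $f:\mathbb{N}\to\mathbb{R}$, $G$ has subgroup growth of type $f(n)$ if there exist $a,b>0$ such that $s_n(G)\leq f(n)^a$ for all $n$ and $f(n)^b\leq s_n(G)$ for infinitely many $n$. $G^{(k)}$ denotes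 the direct product of $k$ copies of $G$. $G$ is self-replicating if there exist an integer $r\geq 2$ and a proper normal subgroup $G_1\leq G$ of finite index with $G_1\cong G^{(r)}$. Iterating this (replacing each factor $G$ of $G_{n-1}\cong G^{(r^{n-1})}$ by $G_1$) one obtains the $n$-th principal congruence subgroup $G_n\cong G_{n-1}^{(r)}\cong G^{(r^n)}$ of $G$. A subgroup $U$ of $G$ is a congruence subgroup if it contains a principal congruence subgroup. A group has the congruence subgroup property if it contains a self-replicating normal subgroup of finite index, every finite index subgroup of which is a congruence subgroup (of that self-replicating subgroup); for the self-replicating group $G$ considered here this means that every finite index subgroup of $G$ is a congruence subgroup. *)

theory Defs
  imports
    "HOL-Analysis.Analysis"
    "HOL-Algebra.Product_Groups"
    "HOL-Algebra.Generated_Groups"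
    "HOL-Number_Theory.Residues"
    "Jordan_Normal_Form.Missing_VectorSpace"
begin

text \<open>
  A topological group is a pair \<open>(G, T)\<close> of a group \<open>G\<close> and a topology \<open>T\<close> on its carrier.
  Abstract groups are treated as topological groups carrying the discrete topology; then
  every subgroup is closed, and the closures taken below have no effect.
\<close>

definition topological_group :: "('a, 'b) monoid_scheme \<Rightarrow> 'a topology \<Rightarrow> bool" where
  "topological_group G T \<longleftrightarrow>
     group G \<and> topspace T = carrier G \<and>
     continuous_map (prod_topology T T) T (\<lambda>(x, y). x \<otimes>\<^bsub>G\<^esub> y) \<and>
     continuous_map T T (\<lambda>x. inv\<^bsub>G\<^esub> x)"

definition profinite_group :: "('a, 'b) monoid_scheme \<Rightarrow> 'a topology \<Rightarrow> bool" where
  "profinite_group G T \<longleftrightarrow>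
     topological_group G T \<and> compact_space T \<and> Hausdorff_space T \<and>
     (\<forall>W. openin T W \<and> \<one>\<^bsub>G\<^esub> \<in> W \<longrightarrow> (\<exists>H. subgroup H G \<and> openin T H \<and> H \<subseteq> W))"

definition pro_p_group :: "nat \<Rightarrow> ('a, 'b) monoid_scheme \<Rightarrow> 'a topology \<Rightarrow> bool" where
  "pro_p_group p G T \<longleftrightarrow>
     profinite_group G T \<and>
     (\<forall>H. H \<lhd> G \<and> openin T H \<longrightarrow> (\<exists>i. card (rcosets\<^bsub>G\<^esub> H) = p ^ i))"

text \<open>\<^const>\<open>group.ord\<close> is \<open>0\<close> on elements of infinite order, so these are excluded below.\<close>

definition p_group :: "nat \<Rightarrow> ('a, 'b) monoid_scheme \<Rightarrow> bool" where
  "p_group p G \<longleftrightarrow> group G \<and> (\<forall>x\<in>carrier G. \<exists>i. group.ord G x = p ^ i)"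

definition top_finitely_generated :: "('a, 'b) monoid_scheme \<Rightarrow> 'a topology \<Rightarrow> bool" where
  "top_finitely_generated G T \<longleftrightarrow>
     (\<exists>S. finite S \<and> S \<subseteq> carrier G \<and> T closure_of (generate G S) = carrier G)"

definition closed_subgroup :: "'a set \<Rightarrow> ('a, 'b) monoid_scheme \<Rightarrow> 'a topology \<Rightarrow> bool" where
  "closed_subgroup H G T \<longleftrightarrow> subgroup H G \<and> closedin T H"

definition top_group_iso ::
  "('a, 'b) monoid_scheme \<Rightarrow> 'a topology \<Rightarrow> ('c, 'd) monoid_scheme \<Rightarrow> 'c topology \<Rightarrow> ('a \<Rightarrow> 'c) set"
where
  "top_group_iso G T H S = {f. f \<in> iso G H \<and> homeomorphic_map T S f}"

abbreviation power_group :: "('a, 'b) monoid_scheme \<Rightarrow> nat \<Rightarrow> (nat \<Rightarrow> 'a) monoid" where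
  "power_group G k \<equiv> product_group {..<k} (\<lambda>_. G)"

abbreviation power_top :: "'a topology \<Rightarrow> nat \<Rightarrow> (nat \<Rightarrow> 'a) topology" where
  "power_top T k \<equiv> product_topology (\<lambda>_. T) {..<k}"

text \<open>The isomorphisms from the subgroup \<open>H\<close> of \<open>G\<close> onto the direct power of \<open>k\<close> copies of \<open>G\<close>.\<close>

definition isos_to_power ::
  "('a, 'b) monoid_scheme \<Rightarrow> 'a topology \<Rightarrow> 'a set \<Rightarrow> nat \<Rightarrow> ('a \<Rightarrow> nat \<Rightarrow> 'a) set"
where
  "isos_to_power G T H k =
     top_group_iso (G\<lparr>carrier := H\<rparr>) (subtopology T H) (power_group G k) (power_top T k)"

text \<open>
  The data \<open>r\<close>, \<open>G\<^sub>1\<close> and \<open>\<phi>\<close> witness that \<open>G\<close> is self-replicating. They are kept explicit since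
  the principal congruence subgroups are defined in terms of them.
\<close>

definition self_replicating_by ::
  "('a, 'b) monoid_scheme \<Rightarrow> 'a topology \<Rightarrow> nat \<Rightarrow> 'a set \<Rightarrow> ('a \<Rightarrow> nat \<Rightarrow> 'a) \<Rightarrow> bool"
where
  "self_replicating_by G T r G\<^sub>1 \<phi> \<longleftrightarrow>
     2 \<le> r \<and> G\<^sub>1 \<lhd> G \<and> closedin T G\<^sub>1 \<and> G\<^sub>1 \<noteq> carrier G \<and> finite (rcosets\<^bsub>G\<^esub> G\<^sub>1) \<and>
     \<phi> \<in> isos_to_power G T G\<^sub>1 r"

text \<open>
  Iterating \<open>\<phi>\<close> identifies the \<open>n\<close>-th principal congruence subgroup with a power of \<open>G\<close> whose
  factors are indexed by the words \<open>w\<close> of length \<open>n\<close> over \<open>{..<r}\<close>: the \<open>w\<close>-coordinate of \<open>x\<close> is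
  \<open>\<phi> (\<dots> (\<phi> (\<phi> x w\<^sub>1) w\<^sub>2) \<dots>) w\<^sub>n = foldl \<phi> x w\<close>. The next principal congruence subgroup is
  obtained by replacing each of these factors \<open>G\<close> by \<open>G\<^sub>1\<close>.
\<close>

primrec principal_congruence_subgroup ::
  "('a, 'b) monoid_scheme \<Rightarrow> nat \<Rightarrow> 'a set \<Rightarrow> ('a \<Rightarrow> nat \<Rightarrow> 'a) \<Rightarrow> nat \<Rightarrow> 'a set"
where
  "principal_congruence_subgroup G r G\<^sub>1 \<phi> 0 = carrier G"
| "principal_congruence_subgroup G r G\<^sub>1 \<phi> (Suc n) =
     {x \<in> principal_congruence_subgroup G r G\<^sub>1 \<phi> n.
        \<forall>w. length w = n \<and> set w \<subseteq> {..<r} \<longrightarrow> foldl \<phi> x w \<in> G\<^sub>1}"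

definition congruence_subgroup_property ::
  "('a, 'b) monoid_scheme \<Rightarrow> 'a topology \<Rightarrow> nat \<Rightarrow> 'a set \<Rightarrow> ('a \<Rightarrow> nat \<Rightarrow> 'a) \<Rightarrow> bool"
where
  "congruence_subgroup_property G T r G\<^sub>1 \<phi> \<longleftrightarrow>
     (\<forall>U. closed_subgroup U G T \<and> finite (rcosets\<^bsub>G\<^esub> U) \<longrightarrow>
        (\<exists>n. principal_congruence_subgroup G r G\<^sub>1 \<phi> n \<subseteq> U))"

definition subgroups_index_le ::
  "('a, 'b) monoid_scheme \<Rightarrow> 'a topology \<Rightarrow> nat \<Rightarrow> 'a set set"
where
  "subgroups_index_le G T n =
     {U. closed_subgroup U G T \<and> finite (rcosets\<^bsub>G\<^esub> U) \<and> card (rcosets\<^bsub>G\<^esub> U) \<le> n}"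

text \<open>Finiteness is demanded because \<^const>\<open>card\<close> vanishes on infinite sets.\<close>

definition has_subgroup_growth_type ::
  "('a, 'b) monoid_scheme \<Rightarrow> 'a topology \<Rightarrow> (nat \<Rightarrow> real) \<Rightarrow> bool"
where
  "has_subgroup_growth_type G T f \<longleftrightarrow>
     (\<forall>n. finite (subgroups_index_le G T n)) \<and>
     (\<exists>a>0. \<forall>n\<ge>1. real (card (subgroups_index_le G T n)) \<le> f n powr a) \<and>
     (\<exists>b>0. \<exists>\<^sub>\<infinity>n. f n powr b \<le> real (card (subgroups_index_le G T n)))"

text \<open>
  The product of the closed commutator subgroup and the closed subgroup generated by the \<open>p\<close>-th
  powers.
\<close>

definition frattini_p :: "nat \<Rightarrow> ('a, 'b) monoid_scheme \<Rightarrow> 'a topology \<Rightarrow> 'a set" where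
  "frattini_p p G T =
     (T closure_of derived G (carrier G)) <#>\<^bsub>G\<^esub>
     (T closure_of generate G ((\<lambda>x. x [^]\<^bsub>G\<^esub> p) ` carrier G))"

text \<open>
  The quotient by \<^const>\<open>frattini_p\<close> as a vector space over the field \<open>residue_ring p\<close> with \<open>p\<close>
  elements. Addition is the group operation and scalars act by powers; the fields \<open>mult\<close> and \<open>one\<close>
  of the record play no role in a vector space.
\<close>

definition frattini_quotient_space ::
  "nat \<Rightarrow> ('a, 'b) monoid_scheme \<Rightarrow> 'a topology \<Rightarrow> (int, 'a set) module"
where
  "frattini_quotient_space p G T =
     (let Q = G Mod frattini_p p G T
      in \<lparr>carrier = carrier Q, monoid.mult = monoid.mult Q, one = \<one>\<^bsub>Q\<^esub>, ring.zero = \<one>\<^bsub>Q\<^esub>, add = monoid.mult Q,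
          smult = (\<lambda>c x. x [^]\<^bsub>Q\<^esub> c)\<rparr>)"

definition d_p :: "nat \<Rightarrow> ('a, 'b) monoid_scheme \<Rightarrow> 'a topology \<Rightarrow> nat" where
  "d_p p G T = vectorspace.dim (residue_ring (int p)) (frattini_quotient_space p G T)"

definition d_p_sub :: "nat \<Rightarrow> ('a, 'b) monoid_scheme \<Rightarrow> 'a topology \<Rightarrow> 'a set \<Rightarrow> nat" where
  "d_p_sub p G T U = d_p p (G\<lparr>carrier := U\<rparr>) (subtopology T U)"

definition d_p_max :: "nat \<Rightarrow> ('a, 'b) monoid_scheme \<Rightarrow> 'a topology \<Rightarrow> nat \<Rightarrow> nat" where
  "d_p_max p G T m =
     Max (d_p_sub p G T ` {U. closed_subgroup U G T \<and> card (rcosets\<^bsub>G\<^esub> U) = p ^ m})"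

text \<open>Meaningful only if the sequence converges.\<close>

definition rank_growth :: "nat \<Rightarrow> ('a, 'b) monoid_scheme \<Rightarrow> 'a topology \<Rightarrow> real" where
  "rank_growth p G T = lim (\<lambda>m. real (d_p_max p G T m) / real m)"

text \<open>\<open>Q\<close> is a finite group, with the discrete topology.\<close>

definition max_subgroup_rank :: "nat \<Rightarrow> ('a, 'b) monoid_scheme \<Rightarrow> nat" where
  "max_subgroup_rank p Q = Max (d_p_sub p Q (discrete_topology (carrier Q)) ` {H. subgroup H Q})"

end

theory Submission
  imports Defs "HOL-Algebra.Sylow" "HOL-Algebra.Zassenhaus"
begin

text \<open>
  Call a continuous homomorphism from a group \<open>U\<close> to \<open>\<int>/p\<close> a character of \<open>U\<close>. The characters of \<open>U\<close> are the
  linear forms on \<open>U/\<Phi>\<^sub>p(U)\<close>, so there are \<open>p\<^bsup>d(U)\<^esup>\<close> of them, where \<open>d(U)\<close> is the rank \<open>d\<^sub>p(U)\<close>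
  (\<open>card_chars_eq_power_d_p\<close>). Ranks are estimated by counting characters, which behave well under extensions
  (\<open>card_chars_le_restrict\<close>) and direct products (\<open>prod_card_chars_le\<close>). Write \<open>f(m)\<close> for the maximal rank of a
  subgroup of index \<open>p\<^sup>m\<close>, and let \<open>N \<cong> G\<^sup>k\<close> be a principal congruence subgroup of index \<open>p\<^sup>l\<close>.

  Upper bound for the ranks. A subgroup \<open>W\<close> of \<open>N \<cong> G\<^sup>k\<close> has a filtration whose factors are subgroups \<open>V\<^sub>i\<close> of \<open>G\<close>
  with \<open>\<Prod>|G : V\<^sub>i| = |N : W|\<close> (\<open>power_filtration\<close>). Apply this to \<open>W = U \<inter> N\<close> for a subgroup \<open>U\<close> of index \<open>p\<^sup>m\<close>
  with \<open>m > 0\<close>. If \<open>N \<le> \<Phi>\<^sub>p(G)\<close>, then \<open>N\<close> and \<open>U\<close> lie in a common subgroup of index \<open>p\<close>, whence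
  \<open>|N : U \<inter> N| \<le> p\<^sup>m\<^sup>-\<^sup>1\<close>. The characters of \<open>U\<close> that vanish on \<open>U \<inter> N\<close> live on the subgroup \<open>UN/N\<close> of \<open>G/N\<close>, so
  they contribute at most \<open>\<delta>\<close> to the rank. Hence \<open>f(m) \<le> \<delta> + \<Sum>f(m\<^sub>i)\<close> for suitable \<open>m\<^sub>1, \<dots>, m\<^sub>k\<close> of sum at most
  \<open>m - 1\<close>, and induction gives \<open>f(m) \<le> ((k - 1) d(G) + \<delta>) m + d(G)\<close> (\<open>card_chars_level_le\<close>).

  Lower bound. If \<open>U\<^sub>i\<close> has index \<open>p\<close> to the power \<open>m\<^sub>i\<close> and maximal rank, then \<open>\<Prod>U\<^sub>i \<le> N\<close> shows that
  \<open>f(l + \<Sum>m\<^sub>i) \<ge> \<Sum>f(m\<^sub>i)\<close> (\<open>d_p_max_superadditive\<close>). This is superadditivity in the shifted variable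
  \<open>m + l/(k - 1)\<close>, so a variant of Fekete's lemma shows that the limit exists and equals the supremum
  (\<open>superadditive_limit\<close>).

  Subgroup growth. In a \<open>p\<close>-group or pro-\<open>p\<close> group every subgroup of index \<open>p\<^sup>m\<^sup>+\<^sup>1\<close> is the kernel of a character of a
  subgroup of index \<open>p\<^sup>m\<close>, so there are at most \<open>p\<close> to the power \<open>f(0) + \<dots> + f(m - 1)\<close> subgroups of index \<open>p\<^sup>m\<close>,
  and the exponent is \<open>O(m\<^sup>2)\<close> by the linear upper bound. The congruence subgroup property enters here: it
  provides a principal congruence subgroup on which all characters of \<open>G\<close> vanish. Conversely the \<open>n\<close>-th principal congruence
  subgroup has index \<open>p\<close> to a power linear in \<open>D = r\<^sup>n\<close> and maps onto \<open>\<F>\<^sub>p\<^sup>D\<close>, which has at least \<open>p\<close> to the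
  power \<open>D\<^sup>2/8\<close> subspaces of codimension about \<open>D/2\<close> (\<open>card_subgroups_ge\<close>).
\<close>

section \<open>Indices of subgroups\<close>

lemma restrict_eq_iff: "restrict f A = restrict g A \<longleftrightarrow> (\<forall>x\<in>A. f x = g x)"
proof
  assume eq: "restrict f A = restrict g A"
  show "\<forall>x\<in>A. f x = g x"
  proof
    fix x assume "x \<in> A" then show "f x = g x" using fun_cong[OF eq, of x] by simp
  qed
next
  assume "\<forall>x\<in>A. f x = g x" then show "restrict f A = restrict g A" by (simp cong: restrict_cong)
qed

lemma card_image_eq_if_same_fibres:
  assumes "\<And>x y. x \<in> K \<Longrightarrow> y \<in> K \<Longrightarrow> g x = g y \<longleftrightarrow> h x = h y"
  shows "card (g ` K) = card (h ` K)"
proof -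
  have "bij_betw (\<lambda>c. h (inv_into K g c)) (g ` K) (h ` K)"
  proof (rule bij_betwI')
    fix c d assume "c \<in> g ` K" "d \<in> g ` K"
    then show "h (inv_into K g c) = h (inv_into K g d) \<longleftrightarrow> c = d"
      by (metis assms f_inv_into_f inv_into_into)
  next
    fix c assume "c \<in> g ` K" then show "h (inv_into K g c) \<in> h ` K"
      by (simp add: inv_into_into)
  next
    fix e assume "e \<in> h ` K"
    then obtain x where x: "x \<in> K" "e = h x" by auto
    have "g (inv_into K g (g x)) = g x" by (simp add: f_inv_into_f x)
    then have "h (inv_into K g (g x)) = h x" by (simp add: assms inv_into_into x)
    then show "\<exists>c\<in>g ` K. e = h (inv_into K g c)" using x by (intro bexI[of _ "g x"]) auto
  qed
  then show ?thesis by (rule bij_betw_same_card)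
qed

text \<open>
  The image of \<open>g\<close> falls into pieces of size \<open>c\<close>, one for each value of \<open>q\<close>. Infinite images conform, since their
  \<^const>\<open>card\<close> is \<open>0\<close>: if \<open>g ` L\<close> is infinite, then the number of pieces or each single piece is infinite.
\<close>

lemma card_image_eq_mult_fibres:
  assumes coarser: "\<And>x y. x \<in> L \<Longrightarrow> y \<in> L \<Longrightarrow> g x = g y \<Longrightarrow> q x = q y"
    and fibre: "\<And>y. y \<in> L \<Longrightarrow> card (g ` {x\<in>L. q x = q y}) = c"
  shows "card (g ` L) = card (q ` L) * c"
proof (cases "L = {}")
  case False
  define F where "F e = g ` {x\<in>L. q x = e}" for e
  have UN: "g ` L = (\<Union>e\<in>q ` L. F e)" by (auto simp: F_def)
  have ne: "F e \<noteq> {}" if "e \<in> q ` L" for e using that by (auto simp: F_def)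
  have disj: "F e \<inter> F e' = {}" if "e \<noteq> e'" for e e'
  proof (rule ccontr)
    assume "F e \<inter> F e' \<noteq> {}"
    then obtain x y where "x \<in> L" "y \<in> L" "q x = e" "q y = e'" "g x = g y" by (auto simp: F_def)
    then show False using that coarser by blast
  qed
  have cF: "card (F e) = c" if "e \<in> q ` L" for e using that fibre by (auto simp: F_def)
  show ?thesis
  proof (cases "finite (g ` L)")
    case True
    have "finite (q ` L)"
    proof -
      have "inj_on F (q ` L)" using ne disj by (metis inf.idem inj_onI)
      moreover have "F ` (q ` L) \<subseteq> Pow (g ` L)" by (auto simp: F_def)
      ultimately show ?thesis using True by (meson finite_Pow_iff finite_imageD finite_subset)
    qed
    moreover have "finite (F e)" for e using True by (rule rev_finite_subset) (auto simp: F_def)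
    ultimately have "card (g ` L) = (\<Sum>e\<in>q ` L. card (F e))"
      unfolding UN by (intro card_UN_disjoint) (use disj in auto)
    then show ?thesis using cF by simp
  next
    case inf: False
    have "infinite (q ` L) \<or> c = 0"
    proof (rule ccontr)
      assume a: "\<not> ?thesis"
      then have "finite (F e)" if "e \<in> q ` L" for e using cF[OF that] card.infinite by fastforce
      then have "finite (\<Union>e\<in>q ` L. F e)" using a by blast
      then show False using inf UN by simp
    qed
    then show ?thesis using inf by auto
  qed
qed simp

text \<open>
  The number of right cosets of \<open>H\<close> that meet \<open>K\<close>, which is the index of \<open>H\<close> in \<open>K\<close> when \<open>H \<subseteq> K\<close>.
  It is \<open>0\<close> if that number is infinite.
\<close>

definition index :: "('a, 'b) monoid_scheme \<Rightarrow> 'a set \<Rightarrow> 'a set \<Rightarrow> nat" where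
  "index G K H = card ((\<lambda>x. H #>\<^bsub>G\<^esub> x) ` K)"

lemma rcosets_eq_image: "rcosets\<^bsub>G\<^esub> H = (\<lambda>x. H #>\<^bsub>G\<^esub> x) ` carrier G"
  by (auto simp: RCOSETS_def)

lemma card_rcosets: "card (rcosets\<^bsub>G\<^esub> H) = index G (carrier G) H"
  by (simp add: index_def rcosets_eq_image)

context group begin

lemma rcoset_eq_iff:
  assumes "subgroup H G" "x \<in> carrier G" "y \<in> carrier G"
  shows "H #> x = H #> y \<longleftrightarrow> x \<otimes> inv y \<in> H"
proof
  assume "H #> x = H #> y"
  then have "x \<in> H #> y" using assms rcos_self by blast
  then show "x \<otimes> inv y \<in> H" using assms by (simp add: subgroup.rcos_module is_group)
next
  assume "x \<otimes> inv y \<in> H"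
  then have "x \<in> H #> y" using assms by (simp add: subgroup.rcos_module is_group)
  then show "H #> x = H #> y" using assms repr_independence by auto
qed

text \<open>
  Indices are computed by counting the values of any function on \<open>K\<close> that separates exactly the cosets of \<open>H\<close>.
\<close>

lemma index_eq_card_image:
  assumes "subgroup H G" "K \<subseteq> carrier G"
    and "\<And>x y. x \<in> K \<Longrightarrow> y \<in> K \<Longrightarrow> g x = g y \<longleftrightarrow> x \<otimes> inv y \<in> H"
  shows "index G K H = card (g ` K)"
  unfolding index_def
  by (rule card_image_eq_if_same_fibres) (use assms in \<open>auto simp: rcoset_eq_iff subset_iff\<close>)

lemma index_pos_iff:
  assumes "K \<noteq> {}"
  shows "0 < index G K H \<longleftrightarrow> finite ((\<lambda>x. H #> x) ` K)"
  using assms by (auto simp: index_def card_gt_0_iff)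

lemma index_pos_subset:
  assumes "0 < index G L H" "K \<subseteq> L" "K \<noteq> {}"
  shows "0 < index G K H" "index G K H \<le> index G L H"
proof -
  have fin: "finite ((\<lambda>x. H #> x) ` L)" using assms by (metis index_pos_iff subset_empty)
  have "(\<lambda>x. H #> x) ` K \<subseteq> (\<lambda>x. H #> x) ` L" using assms by auto
  then show "0 < index G K H" "index G K H \<le> index G L H"
    using fin assms by (auto simp: index_pos_iff index_def finite_subset card_mono card_gt_0_iff)
qed

lemma subgroup_ne: "subgroup H G \<Longrightarrow> H \<noteq> {}"
  using subgroup.one_closed by auto

lemma normal_if_commutators:
  assumes K: "subgroup K G"
    and comm: "\<And>a b. a \<in> carrier G \<Longrightarrow> b \<in> carrier G \<Longrightarrow> a \<otimes> b \<otimes> inv a \<otimes> inv b \<in> K"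
  shows "K \<lhd> G"
proof (subst normal_inv_iff, intro conjI ballI K)
  fix a h assume a: "a \<in> carrier G" and h: "h \<in> K"
  then have hG: "h \<in> carrier G" using subgroup.subset[OF K] by blast
  have "a \<otimes> h \<otimes> inv a = (a \<otimes> h \<otimes> inv a \<otimes> inv h) \<otimes> h" using a hG by (simp add: m_assoc)
  also have "\<dots> \<in> K" using K comm[OF a hG] h by (rule subgroup.m_closed)
  finally show "a \<otimes> h \<otimes> inv a \<in> K" .
qed

lemma normal_in_subgroup:
  assumes V: "subgroup V G" and M: "subgroup M G" "M \<subseteq> V"
    and conj: "\<And>v u. v \<in> V \<Longrightarrow> u \<in> M \<Longrightarrow> v \<otimes> u \<otimes> inv v \<in> M"
  shows "M \<lhd> G\<lparr>carrier := V\<rparr>"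
proof (subst group.normal_inv_iff[OF subgroup_imp_group[OF V]], intro conjI ballI)
  show "subgroup M (G\<lparr>carrier := V\<rparr>)" using M V by (simp add: subgroup_incl)
  fix x h assume "x \<in> carrier (G\<lparr>carrier := V\<rparr>)" "h \<in> M"
  then show "x \<otimes>\<^bsub>G\<lparr>carrier := V\<rparr>\<^esub> h \<otimes>\<^bsub>G\<lparr>carrier := V\<rparr>\<^esub> inv\<^bsub>G\<lparr>carrier := V\<rparr>\<^esub> x \<in> M"
    using V conj by (simp add: m_inv_consistent)
qed

lemma index_inter:
  assumes "subgroup H G" "subgroup K G"
  shows "index G K (K \<inter> H) = index G K H"
proof -
  have "K \<subseteq> carrier G" using assms(2) by (simp add: subgroup.subset)
  show ?thesis unfolding index_def[of G K H]
  proof (rule index_eq_card_image)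
    show "subgroup (K \<inter> H) G" using assms by (simp add: subgroups_Inter_pair)
    fix x y assume "x \<in> K" "y \<in> K"
    then show "H #> x = H #> y \<longleftrightarrow> x \<otimes> inv y \<in> K \<inter> H"
      using assms \<open>K \<subseteq> carrier G\<close>
      by (auto simp: rcoset_eq_iff subset_iff subgroup.m_closed subgroup.m_inv_closed)
  qed fact
qed

lemma index_mult:
  assumes H: "subgroup H G" and K: "subgroup K G" and L: "subgroup L G"
    and "H \<subseteq> K" "K \<subseteq> L"
  shows "index G L H = index G L K * index G K H"
  unfolding index_def[of G L]
proof (rule card_image_eq_mult_fibres)
  have LG: "L \<subseteq> carrier G" and KG: "K \<subseteq> carrier G"
    using L K by (auto simp: subgroup.subset)
  fix x y assume xy: "x \<in> L" "y \<in> L" "H #> x = H #> y"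
  then show "K #> x = K #> y" using assms LG by (auto simp: rcoset_eq_iff subset_iff)
next
  have LG: "L \<subseteq> carrier G" and KG: "K \<subseteq> carrier G"
    using L K by (auto simp: subgroup.subset)
  fix y assume y: "y \<in> L"
  have "{x \<in> L. K #> x = K #> y} = (\<lambda>z. z \<otimes> y) ` K"
  proof (intro equalityI subsetI)
    fix x assume "x \<in> {x \<in> L. K #> x = K #> y}"
    then have x: "x \<in> L" "K #> x = K #> y" by auto
    then have "x \<otimes> inv y \<in> K" using y LG K by (auto simp: rcoset_eq_iff subset_iff)
    moreover have "x = (x \<otimes> inv y) \<otimes> y" using x y LG by (simp add: subset_iff m_assoc)
    ultimately show "x \<in> (\<lambda>z. z \<otimes> y) ` K" by blast
  next
    fix x assume "x \<in> (\<lambda>z. z \<otimes> y) ` K"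
    then obtain z where z: "z \<in> K" and x: "x = z \<otimes> y" by auto
    then have "z \<otimes> y \<in> L" using y assms by (auto simp: subgroup.m_closed subset_iff)
    moreover have "z \<otimes> y \<otimes> inv y = z" using z y LG KG by (simp add: subset_iff m_assoc)
    then have "K #> (z \<otimes> y) = K #> y"
      using z y LG KG K by (subst rcoset_eq_iff) (auto simp: subset_iff)
    ultimately show "x \<in> {x \<in> L. K #> x = K #> y}" using x by blast
  qed
  then have "(\<lambda>x. H #> x) ` {x \<in> L. K #> x = K #> y} = (\<lambda>z. H #> (z \<otimes> y)) ` K"
    by (simp add: image_image)
  moreover have "index G K H = card ((\<lambda>z. H #> (z \<otimes> y)) ` K)"
  proof (rule index_eq_card_image[OF H KG])
    fix z w assume zw: "z \<in> K" "w \<in> K"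
    have "z \<otimes> y \<otimes> inv (w \<otimes> y) = z \<otimes> inv w"
    proof -
      have "z \<in> carrier G" "w \<in> carrier G" "y \<in> carrier G" using zw y LG KG by auto
      then have "z \<otimes> y \<otimes> inv (w \<otimes> y) = z \<otimes> (y \<otimes> inv y) \<otimes> inv w"
        by (simp only: inv_mult_group m_assoc inv_closed m_closed)
      then show ?thesis by (simp add: \<open>z \<in> carrier G\<close> \<open>y \<in> carrier G\<close>)
    qed
    then show "H #> (z \<otimes> y) = H #> (w \<otimes> y) \<longleftrightarrow> z \<otimes> inv w \<in> H"
      using zw y LG KG H by (auto simp: rcoset_eq_iff subset_iff)
  qed
  ultimately show "card ((\<lambda>x. H #> x) ` {x \<in> L. K #> x = K #> y}) = index G K H"
    by simp
qed

lemma index_self: "subgroup H G \<Longrightarrow> index G H H = 1"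
proof -
  assume H: "subgroup H G"
  have "(\<lambda>x. H #> x) ` H = {H}"
    using H by (auto simp: coset_join3 subgroup.rcos_const is_group image_iff intro: subgroup.one_closed)
  then show ?thesis by (simp add: index_def)
qed

lemma index_eq_1_iff:
  assumes "subgroup H G" "subgroup K G" "H \<subseteq> K"
  shows "index G K H = 1 \<longleftrightarrow> H = K"
proof
  assume "index G K H = 1"
  then have card: "card ((\<lambda>x. H #> x) ` K) = 1" by (simp add: index_def)
  then obtain C where C: "(\<lambda>x. H #> x) ` K = {C}" by (auto simp: card_1_singleton_iff)
  have KG: "K \<subseteq> carrier G" using assms by (simp add: subgroup.subset)
  have "x \<in> H" if "x \<in> K" for x
  proof -
    have "H #> x = C" "H #> \<one> = C" using C that subgroup.one_closed[OF assms(2)] by blast+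
    then have "x \<otimes> inv \<one> \<in> H" using that KG assms(1) rcoset_eq_iff[of H x \<one>] by auto
    then show ?thesis using that KG by (simp add: subset_iff)
  qed
  then show "H = K" using assms by auto
qed (use assms index_self in auto)

lemma index_inter_eq_mult:
  assumes H: "subgroup H G" and K: "subgroup K G"
  shows "index G (carrier G) (H \<inter> K) = index G (carrier G) H * index G H K"
proof -
  have "subgroup (H \<inter> K) G" using assms by (simp add: subgroups_Inter_pair)
  then have "index G (carrier G) (H \<inter> K) = index G (carrier G) H * index G H (H \<inter> K)"
    using H subgroup.subset[OF H] by (intro index_mult) (auto simp: subgroup_self)
  then show ?thesis using index_inter[OF K H] by simp
qed

lemma index_inter_pos:
  assumes "subgroup H G" "subgroup K G" "0 < index G (carrier G) H" "0 < index G (carrier G) K"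
  shows "0 < index G (carrier G) (H \<inter> K)"
  using assms index_pos_subset[of "carrier G" K H] subgroup_ne[of H]
  by (simp add: index_inter_eq_mult subgroup.subset)

lemma index_mono_pos:
  assumes "subgroup H G" "subgroup K G" "H \<subseteq> K" "0 < index G (carrier G) H"
  shows "0 < index G (carrier G) K" "0 < index G K H"
  using index_mult[OF assms(1,2) subgroup_self assms(3) subgroup.subset[OF assms(2)]] assms(4) by auto

text \<open>
  The cosets of \<open>H\<close> that \<open>f\<close> maps into \<open>f(H)f(y)\<close> are the cosets \<open>Hzy\<close> with \<open>z \<in> K0\<close>, and they correspond to the
  cosets of \<open>H \<inter> K0\<close> in \<open>K0\<close>.
\<close>

lemma index_hom_image:
  assumes hom: "f \<in> hom (G\<lparr>carrier := K\<rparr>) G'" and G': "group G'"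
    and K: "subgroup K G" and H: "subgroup H G" and HK: "H \<subseteq> K"
    and K0: "K0 = {x\<in>K. f x = \<one>\<^bsub>G'\<^esub>}"
  shows "index G K H = index G' (f ` K) (f ` H) * index G K0 (H \<inter> K0)"
proof -
  interpret G': group G' by fact
  have KG: "K \<subseteq> carrier G" and HG: "H \<subseteq> carrier G" using K H by (auto simp: subgroup.subset)
  have grpK: "group (G\<lparr>carrier := K\<rparr>)" using K by (simp add: subgroup_imp_group)
  interpret h: group_hom "G\<lparr>carrier := K\<rparr>" G' f
    using hom grpK by (simp add: group_hom_def group_hom_axioms_def G')
  have invK: "m_inv (G\<lparr>carrier := K\<rparr>) x = inv x" if "x \<in> K" for x
    using that K m_inv_consistent by auto
  have fm: "f (x \<otimes> y) = f x \<otimes>\<^bsub>G'\<^esub> f y" if "x \<in> K" "y \<in> K" for x y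
    using h.hom_mult[of x y] that by simp
  have fi: "f (inv x) = inv\<^bsub>G'\<^esub> f x" if "x \<in> K" for x
    using h.hom_inv[of x] that invK by simp
  have fc: "f x \<in> carrier G'" if "x \<in> K" for x using h.hom_closed[of x] that by simp
  have inK: "inv x \<in> K" if "x \<in> K" for x using that K by (simp add: subgroup.m_inv_closed)
  have mK: "x \<otimes> y \<in> K" if "x \<in> K" "y \<in> K" for x y using that K by (simp add: subgroup.m_closed)
  have cK: "x \<in> carrier G" if "x \<in> K" for x using that KG by auto
  have "subgroup H (G\<lparr>carrier := K\<rparr>)" using H K HK by (simp add: subgroup_incl)
  then have fH: "subgroup (f ` H) G'" by (rule h.subgroup_img_is_subgroup)
  have sK0: "subgroup K0 G"
    unfolding K0
  proof (rule subgroupI)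
    show "{x \<in> K. f x = \<one>\<^bsub>G'\<^esub>} \<noteq> {}"
      using h.hom_one subgroup.one_closed[OF K] by auto
    show "{x \<in> K. f x = \<one>\<^bsub>G'\<^esub>} \<subseteq> carrier G" using cK by blast
  next
    fix a assume "a \<in> {x \<in> K. f x = \<one>\<^bsub>G'\<^esub>}"
    then show "inv a \<in> {x \<in> K. f x = \<one>\<^bsub>G'\<^esub>}" using inK fi by simp
  next
    fix a b assume "a \<in> {x \<in> K. f x = \<one>\<^bsub>G'\<^esub>}" "b \<in> {x \<in> K. f x = \<one>\<^bsub>G'\<^esub>}"
    then show "a \<otimes> b \<in> {x \<in> K. f x = \<one>\<^bsub>G'\<^esub>}" using mK fm by simp
  qed
  define q where "q x = f ` H #>\<^bsub>G'\<^esub> f x" for x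
  have q: "q x = q y \<longleftrightarrow> (\<exists>h\<in>H. f x = f (h \<otimes> y))" if "x \<in> K" "y \<in> K" for x y
  proof -
    have "q x = q y \<longleftrightarrow> f x \<otimes>\<^bsub>G'\<^esub> inv\<^bsub>G'\<^esub> f y \<in> f ` H"
      unfolding q_def using fH fc that by (simp add: G'.rcoset_eq_iff)
    also have "\<dots> \<longleftrightarrow> (\<exists>h\<in>H. f x \<otimes>\<^bsub>G'\<^esub> inv\<^bsub>G'\<^esub> f y = f h)" by auto
    also have "\<dots> \<longleftrightarrow> (\<exists>h\<in>H. f x = f (h \<otimes> y))"
      using that HK fc by (intro bex_cong refl) (auto simp: fm subset_iff G'.m_assoc G'.inv_solve_right')
    finally show ?thesis .
  qed
  have "card ((\<lambda>x. H #> x) ` K) = card (q ` K) * index G K0 (H \<inter> K0)"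
  proof (rule card_image_eq_mult_fibres)
    fix x y assume xy: "x \<in> K" "y \<in> K" "H #> x = H #> y"
    then have "x \<otimes> inv y \<in> H" using H by (simp add: rcoset_eq_iff cK)
    then show "q x = q y" using xy by (subst q) (auto intro!: bexI[of _ "x \<otimes> inv y"] simp: m_assoc cK)
  next
    fix y assume y: "y \<in> K"
    have "(\<lambda>x. H #> x) ` {x \<in> K. q x = q y} = (\<lambda>z. H #> (z \<otimes> y)) ` K0"
    proof (intro equalityI subsetI)
      fix C assume "C \<in> (\<lambda>x. H #> x) ` {x \<in> K. q x = q y}"
      then obtain x where x: "x \<in> K" "q x = q y" and C: "C = H #> x" by auto
      then obtain h where h: "h \<in> H" "f x = f (h \<otimes> y)" using q y by auto
      have hK: "h \<in> K" using h HK by auto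
      define z where "z = inv h \<otimes> x \<otimes> inv y"
      have "f z = inv\<^bsub>G'\<^esub> f h \<otimes>\<^bsub>G'\<^esub> (f h \<otimes>\<^bsub>G'\<^esub> f y) \<otimes>\<^bsub>G'\<^esub> inv\<^bsub>G'\<^esub> f y"
        using x y hK h(2) by (simp add: z_def fm fi inK mK)
      also have "\<dots> = (inv\<^bsub>G'\<^esub> f h \<otimes>\<^bsub>G'\<^esub> f h) \<otimes>\<^bsub>G'\<^esub> (f y \<otimes>\<^bsub>G'\<^esub> inv\<^bsub>G'\<^esub> f y)"
        using hK y fc by (simp only: G'.m_assoc G'.m_closed G'.inv_closed)
      also have "\<dots> = \<one>\<^bsub>G'\<^esub>" using hK y fc by simp
      finally have "z \<in> K0" using x y hK by (simp add: z_def K0 mK inK)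
      moreover have "H #> x = H #> (z \<otimes> y)"
      proof -
        have "z \<otimes> y = inv h \<otimes> x" using x y hK by (simp add: z_def m_assoc cK)
        moreover have "H #> (inv h \<otimes> x) = H #> x"
          using h hK x H by (subst rcoset_eq_iff) (auto simp: cK m_assoc subgroup.m_inv_closed)
        ultimately show ?thesis by simp
      qed
      ultimately show "C \<in> (\<lambda>z. H #> (z \<otimes> y)) ` K0" using C by blast
    next
      fix C assume "C \<in> (\<lambda>z. H #> (z \<otimes> y)) ` K0"
      then obtain z where z: "z \<in> K0" and C: "C = H #> (z \<otimes> y)" by auto
      then have "z \<in> K" "f z = \<one>\<^bsub>G'\<^esub>" by (auto simp: K0)
      have "f (z \<otimes> y) = f z \<otimes>\<^bsub>G'\<^esub> f y" using \<open>z \<in> K\<close> y by (rule fm)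
      also have "\<dots> = f y" using \<open>f z = \<one>\<^bsub>G'\<^esub>\<close> fc[OF y] by simp
      finally have "q (z \<otimes> y) = q y" by (simp add: q_def)
      then show "C \<in> (\<lambda>x. H #> x) ` {x \<in> K. q x = q y}"
        using \<open>z \<in> K\<close> y C mK by blast
    qed
    also have "card ((\<lambda>z. H #> (z \<otimes> y)) ` K0) = index G K0 (H \<inter> K0)"
    proof (rule index_eq_card_image[symmetric])
      show "subgroup (H \<inter> K0) G" using H sK0 by (simp add: subgroups_Inter_pair)
      show "K0 \<subseteq> carrier G" using sK0 by (simp add: subgroup.subset)
      fix z w assume zw: "z \<in> K0" "w \<in> K0"
      then have zwc: "z \<in> carrier G" "w \<in> carrier G" "y \<in> carrier G"
        using y by (auto simp: K0 cK)
      have "z \<otimes> y \<otimes> inv (w \<otimes> y) = z \<otimes> (y \<otimes> inv y) \<otimes> inv w"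
        using zwc by (simp only: inv_mult_group m_assoc inv_closed m_closed)
      then have "z \<otimes> y \<otimes> inv (w \<otimes> y) = z \<otimes> inv w" using zwc by simp
      moreover have "z \<otimes> inv w \<in> K0"
        using zw sK0 by (simp add: subgroup.m_closed subgroup.m_inv_closed)
      ultimately show "H #> (z \<otimes> y) = H #> (w \<otimes> y) \<longleftrightarrow> z \<otimes> inv w \<in> H \<inter> K0"
        using zwc H by (simp add: rcoset_eq_iff)
    qed
    finally show "card ((\<lambda>x. H #> x) ` {x \<in> K. q x = q y}) = index G K0 (H \<inter> K0)" .
  qed
  also have "q ` K = (\<lambda>x. f ` H #>\<^bsub>G'\<^esub> x) ` f ` K" by (auto simp: q_def)
  finally show ?thesis by (simp add: index_def)
qed

end

section \<open>Closed subgroups of finite index in discrete and profinite groups\<close>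

lemma eq_prime_power_if_unique_prime_divisor:
  fixes n :: nat
  assumes "prime p" "0 < n" "\<And>q. prime q \<Longrightarrow> q dvd n \<Longrightarrow> q = p"
  shows "\<exists>i. n = p ^ i"
  using assms(2,3)
proof (induction n rule: less_induct)
  case (less n)
  show ?case
  proof (cases "n = 1")
    case True
    then show ?thesis by (metis power_0)
  next
    case False
    then obtain q where q: "prime q" "q dvd n" using prime_factor_nat by blast
    with less.prems have "p dvd n" by blast
    then obtain k where k: "n = p * k" by (auto elim: dvdE)
    have "0 < k" "k < n" using k less.prems prime_gt_1_nat[OF assms(1)] by auto
    moreover have "r = p" if "prime r" "r dvd k" for r using less.prems that k by simp
    ultimately obtain i where "k = p ^ i" using less.IH by blast
    then have "n = p ^ Suc i" using k by simp
    then show ?thesis by blast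
  qed
qed

text \<open>
  Discrete groups and profinite groups are treated together. The proofs rest on two features that they share:
  continuous homomorphisms map closed sets to closed sets, and closed subgroups are intersections of open ones.
\<close>

locale discrete_or_profinite = group G for G (structure) +
  fixes T :: "'a topology"
  assumes top_group: "topological_group G T"
    and discrete_or_profinite: "T = discrete_topology (carrier G) \<or> profinite_group G T"
begin

text \<open>The closed subgroups of finite index; these are exactly the open ones in the profinite case.\<close>

definition fin_sub :: "'a set \<Rightarrow> bool" where
  "fin_sub U \<longleftrightarrow> subgroup U G \<and> closedin T U \<and> 0 < index G (carrier G) U"

lemma fin_subD: "fin_sub U \<Longrightarrow> subgroup U G" "fin_sub U \<Longrightarrow> closedin T U"
  "fin_sub U \<Longrightarrow> 0 < index G (carrier G) U"
  by (auto simp: fin_sub_def)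

lemma fin_sub_subset: "fin_sub U \<Longrightarrow> U \<subseteq> carrier G"
  by (simp add: fin_sub_def subgroup.subset)

lemma topspace: "topspace T = carrier G"
  using top_group by (simp add: topological_group_def)

lemma closedin_subset_carrier: "closedin T C \<Longrightarrow> C \<subseteq> carrier G"
  using closedin_subset topspace by blast

lemma continuous_mult:
  assumes "continuous_map X T f" "continuous_map X T g"
  shows "continuous_map X T (\<lambda>x. f x \<otimes> g x)"
proof -
  have "continuous_map X (prod_topology T T) (\<lambda>x. (f x, g x))"
    using assms by (simp add: continuous_map_pairedI)
  then have "continuous_map X T ((\<lambda>(x, y). x \<otimes> y) \<circ> (\<lambda>x. (f x, g x)))"
    using top_group by (auto simp: topological_group_def intro: continuous_map_compose)
  then show ?thesis by (simp add: o_def)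
qed

lemma continuous_inv: "continuous_map T T (\<lambda>x. inv x)"
  using top_group by (simp add: topological_group_def)

lemma continuous_const: "a \<in> carrier G \<Longrightarrow> continuous_map X T (\<lambda>x. a)"
  by (simp add: topspace)

lemma continuous_id: "continuous_map T T (\<lambda>x. x)"
  by simp

lemma closedin_preimage:
  assumes "continuous_map T T f" "closedin T C"
  shows "closedin T {x \<in> carrier G. f x \<in> C}"
  using closedin_continuous_map_preimage[OF assms] by (simp add: topspace)

lemma closedin_rcoset:
  assumes "closedin T C" "a \<in> carrier G"
  shows "closedin T (C #> a)"
proof -
  have C: "C \<subseteq> carrier G" using assms closedin_subset_carrier by auto
  have "C #> a = {x \<in> carrier G. x \<otimes> inv a \<in> C}"
  proof (intro equalityI subsetI)
    fix x assume "x \<in> C #> a"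
    then obtain c where "c \<in> C" "x = c \<otimes> a" by (auto simp: r_coset_def)
    then show "x \<in> {x \<in> carrier G. x \<otimes> inv a \<in> C}" using C assms by (auto simp: m_assoc subset_iff)
  next
    fix x assume x: "x \<in> {x \<in> carrier G. x \<otimes> inv a \<in> C}"
    then have "x = (x \<otimes> inv a) \<otimes> a" using assms by (simp add: m_assoc)
    then show "x \<in> C #> a" using x by (auto simp: r_coset_def)
  qed
  moreover have "continuous_map T T (\<lambda>x. x \<otimes> inv a)"
    using assms by (intro continuous_mult continuous_id continuous_const) auto
  ultimately show ?thesis using closedin_preimage assms by simp
qed

text \<open>
  \<open>K\<close> is a finite union of translates of \<open>H\<close>.
\<close>

lemma closed_supergroup:
  assumes "subgroup H G" "closedin T H" "subgroup K G" "H \<subseteq> K" "0 < index G K H"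
  shows "closedin T K"
proof -
  have KG: "K \<subseteq> carrier G" using assms subgroup.subset by auto
  have "K = \<Union> ((\<lambda>x. H #> x) ` K)"
  proof (intro equalityI subsetI)
    fix x assume "x \<in> K" then show "x \<in> \<Union> ((\<lambda>x. H #> x) ` K)"
      using rcos_self[OF _ assms(1)] KG by blast
  next
    fix x assume "x \<in> \<Union> ((\<lambda>x. H #> x) ` K)"
    then show "x \<in> K" using assms by (auto simp: r_coset_def subgroup.m_closed subset_iff)
  qed
  moreover have "finite ((\<lambda>x. H #> x) ` K)"
    using assms(5) subgroup_ne[OF assms(3)] by (simp add: index_pos_iff)
  then have "closedin T (\<Union> ((\<lambda>x. H #> x) ` K))"
    using assms(2) KG by (intro closedin_Union) (auto simp: closedin_rcoset)
  ultimately show ?thesis by simp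
qed

lemma fin_sub_supergroup:
  assumes "fin_sub H" "subgroup K G" "H \<subseteq> K"
  shows "fin_sub K"
  using assms index_mono_pos[of H K] closed_supergroup[of H K] by (simp add: fin_sub_def)

lemma fin_sub_inter: "fin_sub H \<Longrightarrow> fin_sub K \<Longrightarrow> fin_sub (H \<inter> K)"
  by (simp add: fin_sub_def subgroups_Inter_pair closedin_Int index_inter_pos)

lemma fin_sub_carrier: "fin_sub (carrier G)"
  using index_self[OF subgroup_self] closedin_topspace[of T] by (simp add: fin_sub_def subgroup_self topspace)

lemma closedin_preimage_sub:
  assumes "continuous_map (subtopology T N) T' f" "closedin T N" "closedin T' C"
  shows "closedin T {x \<in> N. f x \<in> C}"
proof -
  have "closedin (subtopology T N) {x \<in> topspace (subtopology T N). f x \<in> C}"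
    using assms by (intro closedin_continuous_map_preimage)
  also have "topspace (subtopology T N) = N"
    using closedin_subset[OF assms(2)] by auto
  finally show ?thesis using closedin_closed_subtopology[OF assms(2)] by simp
qed

lemma closedin_image:
  assumes f: "continuous_map (subtopology T N) T f" and W: "closedin T W" "W \<subseteq> N"
  shows "closedin T (f ` W)"
  using discrete_or_profinite
proof
  assume "T = discrete_topology (carrier G)"
  moreover have "f ` W \<subseteq> carrier G"
    using continuous_map_image_subset_topspace[OF f] W closedin_subset[OF W(1)] topspace by auto
  ultimately show ?thesis by simp
next
  assume P: "profinite_group G T"
  then have "compactin T W" using W closedin_compact_space by (auto simp: profinite_group_def)
  then have "compactin (subtopology T N) W" using W by (simp add: compactin_subtopology)
  then have "compactin T (f ` W)" using f by (rule image_compactin)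
  then show ?thesis using P compactin_imp_closedin by (auto simp: profinite_group_def)
qed

text \<open>The normal core: the elements acting trivially on the cosets of \<open>U\<close>.\<close>

lemma fin_sub_core:
  assumes U: "fin_sub U"
  obtains K where "fin_sub K" "K \<lhd> G" "K \<subseteq> U"
proof
  define K where "K = {k \<in> carrier G. \<forall>x\<in>carrier G. x \<otimes> k \<otimes> inv x \<in> U}"
  note sU = fin_subD(1)[OF U]
  have UG: "U \<subseteq> carrier G" using U by (rule fin_sub_subset)
  have conj_mult: "x \<otimes> (k \<otimes> l) \<otimes> inv x = (x \<otimes> k \<otimes> inv x) \<otimes> (x \<otimes> l \<otimes> inv x)"
    if "x \<in> carrier G" "k \<in> carrier G" "l \<in> carrier G" for x k l
  proof -
    have "(x \<otimes> k \<otimes> inv x) \<otimes> (x \<otimes> l \<otimes> inv x) = x \<otimes> k \<otimes> (inv x \<otimes> x) \<otimes> l \<otimes> inv x"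
      using that by (simp only: m_assoc m_closed inv_closed)
    then show ?thesis using that by (simp add: m_assoc)
  qed
  have conj_inv: "x \<otimes> inv k \<otimes> inv x = inv (x \<otimes> k \<otimes> inv x)"
    if "x \<in> carrier G" "k \<in> carrier G" for x k
    using that by (simp add: inv_mult_group m_assoc)
  have sK: "subgroup K G"
  proof (rule subgroupI)
    show "K \<noteq> {}" using subgroup.one_closed[OF sU] by (auto simp: K_def intro!: exI[of _ \<one>])
    show "K \<subseteq> carrier G" by (auto simp: K_def)
    fix a assume "a \<in> K" then show "inv a \<in> K"
      using conj_inv sU by (auto simp: K_def subgroup.m_inv_closed)
  next
    fix a b assume "a \<in> K" "b \<in> K" then show "a \<otimes> b \<in> K"
      using conj_mult sU by (auto simp: K_def subgroup.m_closed)
  qed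
  show KU: "K \<subseteq> U"
  proof
    fix k assume "k \<in> K"
    then have "k \<in> carrier G" "\<one> \<otimes> k \<otimes> inv \<one> \<in> U" unfolding K_def using one_closed by blast+
    then show "k \<in> U" by simp
  qed
  show "K \<lhd> G"
  proof (subst normal_inv_iff, intro conjI ballI sK)
    fix x h assume x: "x \<in> carrier G" and h: "h \<in> K"
    then have hc: "h \<in> carrier G" by (simp add: K_def)
    have "y \<otimes> (x \<otimes> h \<otimes> inv x) \<otimes> inv y \<in> U" if y: "y \<in> carrier G" for y
    proof -
      have "y \<otimes> (x \<otimes> h \<otimes> inv x) \<otimes> inv y = (y \<otimes> x) \<otimes> h \<otimes> inv (y \<otimes> x)"
        using x y hc by (simp add: inv_mult_group m_assoc)
      also have "\<dots> \<in> U" using h x y by (simp add: K_def)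
      finally show ?thesis .
    qed
    then show "x \<otimes> h \<otimes> inv x \<in> K" using x hc by (simp add: K_def)
  qed
  have "closedin T K"
  proof -
    have "K = (\<Inter>x\<in>carrier G. {k \<in> carrier G. x \<otimes> k \<otimes> inv x \<in> U})"
      using one_closed by (auto simp: K_def)
    moreover have "closedin T {k \<in> carrier G. x \<otimes> k \<otimes> inv x \<in> U}" if "x \<in> carrier G" for x
      using that fin_subD(2)[OF U]
      by (intro closedin_preimage continuous_mult continuous_id continuous_const) auto
    ultimately show ?thesis using one_closed by (auto intro!: closedin_Inter)
  qed
  moreover have "0 < index G (carrier G) K"
  proof -
    let ?X = "(\<lambda>x. U #> x) ` carrier G"
    \<comment> \<open>\<open>g k\<close> is the permutation of the finite set of cosets that \<open>k\<close> induces.\<close>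
    define g where "g k = (\<lambda>C\<in>?X. C #> k)" for k
    have fin: "finite ?X" using fin_subD(3)[OF U] by (simp add: index_pos_iff subgroup_ne[OF subgroup_self])
    have "index G (carrier G) K = card (g ` carrier G)"
    proof (rule index_eq_card_image[OF sK subset_refl])
      fix k l assume kl: "k \<in> carrier G" "l \<in> carrier G"
      have "g k = g l \<longleftrightarrow> (\<forall>x\<in>carrier G. (U #> x) #> k = (U #> x) #> l)"
        by (auto simp: g_def restrict_def fun_eq_iff)
      also have "\<dots> \<longleftrightarrow> (\<forall>x\<in>carrier G. x \<otimes> (k \<otimes> inv l) \<otimes> inv x \<in> U)"
      proof (intro ball_cong refl)
        fix x assume x: "x \<in> carrier G"
        have "(U #> x) #> k = (U #> x) #> l \<longleftrightarrow> (x \<otimes> k) \<otimes> inv (x \<otimes> l) \<in> U"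
          using x kl UG sU by (simp add: coset_mult_assoc rcoset_eq_iff)
        also have "(x \<otimes> k) \<otimes> inv (x \<otimes> l) = x \<otimes> (k \<otimes> inv l) \<otimes> inv x"
          using x kl by (simp add: inv_mult_group m_assoc)
        finally show "(U #> x) #> k = (U #> x) #> l \<longleftrightarrow> x \<otimes> (k \<otimes> inv l) \<otimes> inv x \<in> U" .
      qed
      finally show "g k = g l \<longleftrightarrow> k \<otimes> inv l \<in> K" using kl by (simp add: K_def)
    qed
    moreover have "g k \<in> PiE ?X (\<lambda>_. ?X)" if "k \<in> carrier G" for k
      unfolding g_def using UG that by (intro restrict_PiE_iff[THEN iffD2] ballI) (auto simp: coset_mult_assoc)
    then have "finite (g ` carrier G)"
      by (intro finite_subset[of "g ` carrier G", OF _ finite_PiE[of ?X "\<lambda>_. ?X"]] fin) auto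
    moreover have "g ` carrier G \<noteq> {}" using one_closed by blast
    ultimately show ?thesis by (simp add: card_gt_0_iff)
  qed
  ultimately show "fin_sub K" using sK by (simp add: fin_sub_def)
qed

lemma pow_in_fin_sub:
  assumes "fin_sub U" "x \<in> carrier G"
  obtains n where "0 < n" "x [^] (n::nat) \<in> U"
proof -
  let ?f = "\<lambda>n::nat. U #> (x [^] n)"
  have "finite ((\<lambda>x. U #> x) ` carrier G)"
    using fin_subD(3)[OF assms(1)] by (simp add: index_pos_iff subgroup_ne[OF subgroup_self])
  moreover have "range ?f \<subseteq> (\<lambda>x. U #> x) ` carrier G" using assms by auto
  ultimately have "\<not> inj ?f" using finite_subset finite_imageD infinite_UNIV_nat by blast
  then obtain i j where "i < j" "?f i = ?f j"
    by (metis (no_types, lifting) injI linorder_neqE_nat)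
  then have "x [^] j \<otimes> inv (x [^] i) \<in> U"
    using assms rcoset_eq_iff[OF fin_subD(1)[OF assms(1)], of "x [^] j" "x [^] i"] by simp
  moreover have "x [^] j = x [^] (j - i) \<otimes> x [^] i"
    using \<open>i < j\<close> assms by (simp add: nat_pow_mult)
  ultimately have "x [^] (j - i) \<in> U" using assms by (simp add: m_assoc)
  then show ?thesis using that \<open>i < j\<close> by (metis zero_less_diff)
qed

end

locale discrete_or_profinite_mod = discrete_or_profinite +
  fixes p :: nat
  assumes prime: "prime p"

context discrete_or_profinite_mod begin

lemma p_gt_1: "1 < p" and p_pos: "0 < p"
  using prime_gt_1_nat[OF prime] by auto

end

text \<open>
  The hypothesis that discrete \<open>p\<close>-groups and pro-\<open>p\<close> groups have in common.
\<close>

locale p_power_index = discrete_or_profinite_mod +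
  assumes index_normal_power: "K \<lhd> G \<Longrightarrow> fin_sub K \<Longrightarrow> \<exists>i. index G (carrier G) K = p ^ i"
begin

text \<open>
  The index of \<open>U\<close> divides that of its normal core.
\<close>

lemma index_power:
  assumes "fin_sub U"
  obtains m where "index G (carrier G) U = p ^ m"
proof -
  obtain K where K: "fin_sub K" "K \<lhd> G" "K \<subseteq> U" using fin_sub_core[OF assms] .
  obtain i where "index G (carrier G) K = p ^ i" using index_normal_power K by blast
  moreover have "index G (carrier G) K = index G (carrier G) U * index G U K"
    using K assms by (intro index_mult) (auto simp: fin_subD subgroup_self fin_sub_subset)
  ultimately have "index G (carrier G) U dvd p ^ i" by (metis dvd_triv_left)
  then show ?thesis using prime that by (auto simp: divides_primepow_nat)
qed

lemma index_between_power:
  assumes "fin_sub U" "fin_sub V" "U \<subseteq> V"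
  obtains m where "index G V U = p ^ m"
proof -
  obtain i where "index G (carrier G) U = p ^ i" using index_power[OF assms(1)] .
  moreover have "index G (carrier G) U = index G (carrier G) V * index G V U"
    using assms by (intro index_mult) (auto simp: fin_subD subgroup_self fin_sub_subset)
  ultimately have "index G V U dvd p ^ i" by (metis dvd_triv_right)
  then show ?thesis using prime that by (auto simp: divides_primepow_nat)
qed

text \<open>
  Normalizers grow: \<open>U\<close> permutes its \<open>p\<^sup>m\<close> cosets with orbits of \<open>p\<close>-power size and fixes the coset \<open>U\<close>,
  so it fixes at least \<open>p\<close> of them; these make up the normalizer of \<open>U\<close>.
\<close>

lemma fin_sub_normal_step:
  assumes U: "fin_sub U" and "U \<noteq> carrier G"
  obtains V where "fin_sub V" "U \<subseteq> V" "index G V U = p"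
    "\<And>v u. v \<in> V \<Longrightarrow> u \<in> U \<Longrightarrow> v \<otimes> u \<otimes> inv v \<in> U"
proof -
  note sU = fin_subD(1)[OF U]
  have UG: "U \<subseteq> carrier G" using U by (rule fin_sub_subset)
  have uG: "u \<in> carrier G" if "u \<in> U" for u using that UG by auto
  define X where "X = (\<lambda>x. U #> x) ` carrier G"
  have finX: "finite X"
    using fin_subD(3)[OF U] by (simp add: X_def index_pos_iff subgroup_ne[OF subgroup_self])
  have act: "(U #> x) #> u = U #> (x \<otimes> u)" if "x \<in> carrier G" "u \<in> carrier G" for x u
    using that UG by (simp add: coset_mult_assoc)
  have actX: "(C #> u) #> v = C #> (u \<otimes> v)" "C #> \<one> = C" "C #> u \<in> X"
    if "C \<in> X" "u \<in> U" "v \<in> U" for C u v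
    using that UG by (auto simp: X_def act uG m_assoc)
  \<comment> \<open>\<open>F\<close> consists of the fixed cosets, and \<open>r\<close> relates the cosets in the same nontrivial orbit.\<close>
  define F where "F = {C \<in> X. \<forall>u\<in>U. C #> u = C}"
  define r where "r = {(C, D). C \<in> X - F \<and> D \<in> X - F \<and> (\<exists>u\<in>U. D = C #> u)}"
  have closedF: "C #> u \<in> X - F" if "C \<in> X - F" "u \<in> U" for C u
  proof -
    have CX: "C \<in> X" using that by simp
    have "C #> u \<notin> F"
    proof
      assume F: "C #> u \<in> F"
      have iu: "inv u \<in> U" using that sU by (simp add: subgroup.m_inv_closed)
      have "(C #> u) #> inv u = C"
        using actX(1)[OF CX that(2) iu] actX(2)[OF CX that(2) iu] uG[OF that(2)] by simp
      moreover have "(C #> u) #> inv u = C #> u" using F iu by (simp add: F_def)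
      ultimately show False using F that by simp
    qed
    then show ?thesis using actX(3)[OF CX that(2) that(2)] by simp
  qed
  have eq: "equiv (X - F) r"
  proof (rule equivI)
    show "r \<subseteq> (X - F) \<times> (X - F)" by (auto simp: r_def)
    show "refl_on (X - F) r"
    proof (rule refl_onI)
      fix C assume C: "C \<in> X - F"
      have "C = C #> \<one>" using C actX(2)[of C \<one> \<one>] subgroup.one_closed[OF sU] by simp
      then show "(C, C) \<in> r" using C subgroup.one_closed[OF sU] by (auto simp: r_def)
    qed
    show "sym r"
    proof (rule symI)
      fix C D assume "(C, D) \<in> r"
      then obtain u where u: "C \<in> X - F" "D \<in> X - F" "u \<in> U" "D = C #> u" by (auto simp: r_def)
      have iu: "inv u \<in> U" using u sU by (simp add: subgroup.m_inv_closed)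
      have "D #> inv u = C"
        using u iu actX(1)[of C u "inv u"] actX(2)[of C u u] uG by simp
      then show "(D, C) \<in> r" using u iu by (auto simp: r_def)
    qed
    show "trans r"
    proof (rule transI)
      fix C D E assume "(C, D) \<in> r" "(D, E) \<in> r"
      then obtain u v where u: "C \<in> X - F" "E \<in> X - F" "u \<in> U" "v \<in> U" "D = C #> u" "E = D #> v"
        by (auto simp: r_def)
      then have "E = C #> (u \<otimes> v)" using actX(1) by simp
      then show "(C, E) \<in> r" using u sU by (auto simp: r_def subgroup.m_closed)
    qed
  qed
  have dvd_orbit: "p dvd card O1" if O1: "O1 \<in> (X - F) // r" for O1
  proof -
    obtain C where C: "C \<in> X - F" "O1 = r `` {C}" using O1 by (auto elim: quotientE)
    then obtain x where x: "x \<in> carrier G" "C = U #> x" by (auto simp: X_def)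
    have O1_eq: "O1 = (\<lambda>u. U #> (x \<otimes> u)) ` U"
    proof -
      have "O1 = (\<lambda>u. C #> u) ` U" using C closedF by (auto simp: r_def)
      then show ?thesis using x by (simp add: act uG cong: image_cong)
    qed
    \<comment> \<open>the stabilizer of the coset \<open>Ux\<close> in \<open>U\<close>\<close>
    define S where "S = {u \<in> U. x \<otimes> u \<otimes> inv x \<in> U}"
    have sS: "subgroup S G"
    proof (rule subgroupI)
      show "S \<noteq> {}" using x subgroup.one_closed[OF sU] by (auto simp: S_def intro!: exI[of _ \<one>])
      show "S \<subseteq> carrier G" using UG by (auto simp: S_def)
      fix a assume a: "a \<in> S"
      have "x \<otimes> inv a \<otimes> inv x = inv (x \<otimes> a \<otimes> inv x)"
        using x a by (simp add: S_def uG inv_mult_group m_assoc)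
      then show "inv a \<in> S" using a sU by (simp add: S_def subgroup.m_inv_closed)
    next
      fix a b assume ab: "a \<in> S" "b \<in> S"
      have "(x \<otimes> a \<otimes> inv x) \<otimes> (x \<otimes> b \<otimes> inv x) = x \<otimes> a \<otimes> (inv x \<otimes> x) \<otimes> b \<otimes> inv x"
        using ab x by (simp only: S_def m_assoc m_closed inv_closed uG mem_Collect_eq)
      then have "x \<otimes> (a \<otimes> b) \<otimes> inv x = (x \<otimes> a \<otimes> inv x) \<otimes> (x \<otimes> b \<otimes> inv x)"
        using ab x by (simp add: S_def uG m_assoc)
      then show "a \<otimes> b \<in> S" using ab sU by (simp add: S_def subgroup.m_closed)
    qed
    have card_O1: "index G U S = card O1" unfolding O1_eq
    proof (rule index_eq_card_image[OF sS UG])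
      fix u v assume uv: "u \<in> U" "v \<in> U"
      have "U #> (x \<otimes> u) = U #> (x \<otimes> v) \<longleftrightarrow> x \<otimes> (u \<otimes> inv v) \<otimes> inv x \<in> U"
        using uv x sU by (simp add: rcoset_eq_iff uG inv_mult_group m_assoc)
      then show "U #> (x \<otimes> u) = U #> (x \<otimes> v) \<longleftrightarrow> u \<otimes> inv v \<in> S"
        using uv sU by (simp add: S_def subgroup.m_closed subgroup.m_inv_closed)
    qed
    have "O1 \<subseteq> X" using C by (auto simp: r_def)
    then have finO1: "finite O1" using finX finite_subset by blast
    have CO1: "C \<in> O1" using equiv_class_self[OF eq C(1)] C(2) by simp
    have pos: "0 < index G U S" using finO1 CO1 card_O1 by (auto simp: card_gt_0_iff)
    have "closedin T S"
    proof -
      have "S = U \<inter> {u \<in> carrier G. x \<otimes> u \<otimes> inv x \<in> U}" using UG by (auto simp: S_def)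
      moreover have "closedin T {u \<in> carrier G. x \<otimes> u \<otimes> inv x \<in> U}"
        using x fin_subD(2)[OF U]
        by (intro closedin_preimage continuous_mult continuous_id continuous_const) auto
      ultimately show ?thesis using fin_subD(2)[OF U] by auto
    qed
    moreover have "index G (carrier G) S = index G (carrier G) U * index G U S"
      using sS sU UG by (intro index_mult) (auto simp: subgroup_self S_def)
    ultimately have "fin_sub S" using sS pos fin_subD(3)[OF U] by (simp add: fin_sub_def)
    then obtain i where i: "index G U S = p ^ i" using index_between_power[OF _ U, of S] by (auto simp: S_def)
    have "i \<noteq> 0"
    proof
      assume "i = 0"
      then have "card O1 = 1" using i card_O1 by simp
      then have "O1 = {C}" using CO1 by (auto simp: card_1_singleton_iff)
      have "C #> u = C" if "u \<in> U" for u
      proof -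
        have "C #> u \<in> O1" using C that closedF by (auto simp: r_def)
        then show ?thesis using \<open>O1 = {C}\<close> by simp
      qed
      then have "C \<in> F" using C by (simp add: F_def)
      then show False using C by simp
    qed
    then show ?thesis using i card_O1 by (metis dvd_power not_gr_zero)
  qed
  have "p dvd card (X - F)"
    using finX eq dvd_orbit by (intro equiv_imp_dvd_card[of "X - F" r p]) auto
  moreover obtain m where m: "card X = p ^ m"
    using index_power[OF U] by (auto simp: X_def index_def)
  moreover have "m \<noteq> 0"
  proof
    assume "m = 0"
    then have "index G (carrier G) U = 1" using m by (simp add: X_def index_def)
    then show False using index_eq_1_iff[OF sU subgroup_self UG] assms(2) by simp
  qed
  moreover have "card X = card F + card (X - F)"
  proof -
    have "F \<subseteq> X" by (auto simp: F_def)
    then show ?thesis using finX by (simp add: card_Diff_subset finite_subset card_mono)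
  qed
  ultimately have pF: "p dvd card F"
    by (metis dvd_add_left_iff dvd_power not_gr_zero)
  \<comment> \<open>The normalizer of \<open>U\<close>. Only \<open>xUx\<^sup>-\<^sup>1 \<subseteq> U\<close> is demanded; closure under inverses follows since some power of \<open>x\<close>
     lies in \<open>U\<close>.\<close>
  define N where "N = {x \<in> carrier G. \<forall>u\<in>U. x \<otimes> u \<otimes> inv x \<in> U}"
  have Nfix: "x \<in> N \<longleftrightarrow> U #> x \<in> F" if x: "x \<in> carrier G" for x
  proof -
    have "(U #> x) #> u = U #> x \<longleftrightarrow> x \<otimes> u \<otimes> inv x \<in> U" if "u \<in> U" for u
      using x that sU by (simp add: act uG rcoset_eq_iff)
    then show ?thesis using x by (auto simp: N_def F_def X_def)
  qed
  have NG: "N \<subseteq> carrier G" by (auto simp: N_def)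
  have conj_mult: "(x \<otimes> y) \<otimes> u \<otimes> inv (x \<otimes> y) = x \<otimes> (y \<otimes> u \<otimes> inv y) \<otimes> inv x"
    if "x \<in> carrier G" "y \<in> carrier G" "u \<in> carrier G" for x y u
    using that by (simp add: inv_mult_group m_assoc)
  have Nmult: "x \<otimes> y \<in> N" if "x \<in> N" "y \<in> N" for x y
    using that by (auto simp: N_def conj_mult uG)
  have UN: "U \<subseteq> N" using sU by (auto simp: N_def uG subgroup.m_closed subgroup.m_inv_closed)
  have Npow: "x [^] (n::nat) \<in> N" if "x \<in> N" for x n
    using that by (induction n) (use Nmult UN subgroup.one_closed[OF sU] in auto)
  have sN: "subgroup N G"
  proof (rule subgroupI)
    show "N \<noteq> {}" using UN subgroup_ne[OF sU] by auto
    fix x assume x: "x \<in> N"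
    then have xG: "x \<in> carrier G" using NG by auto
    obtain n where n: "0 < n" "x [^] (n::nat) \<in> U" using pow_in_fin_sub[OF U xG] .
    have "x [^] n = x \<otimes> x [^] (n - 1)" using n xG by (metis Suc_diff_1 nat_pow_Suc2)
    then have "inv x = x [^] (n - 1) \<otimes> inv (x [^] n)"
      using xG by (simp add: inv_mult_group m_assoc[symmetric])
    then show "inv x \<in> N" using n x Npow Nmult UN sU by (simp add: subgroup.m_inv_closed subset_iff)
  qed (use Nmult NG in auto)
  have nU: "U \<lhd> G\<lparr>carrier := N\<rparr>" using sN sU UN by (rule normal_in_subgroup) (simp add: N_def)
  interpret nU: normal U "G\<lparr>carrier := N\<rparr>" by (rule nU)
  let ?Q = "G\<lparr>carrier := N\<rparr> Mod U"
  have carQ: "carrier ?Q = F"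
  proof -
    have "carrier ?Q = (\<lambda>x. U #> x) ` N" by (simp add: carrier_FactGroup)
    also have "\<dots> = F"
    proof (intro equalityI subsetI)
      fix C assume "C \<in> (\<lambda>x. U #> x) ` N" then show "C \<in> F" using Nfix NG by auto
    next
      fix C assume "C \<in> F"
      then obtain x where "x \<in> carrier G" "C = U #> x" by (auto simp: F_def X_def)
      then show "C \<in> (\<lambda>x. U #> x) ` N" using \<open>C \<in> F\<close> Nfix by auto
    qed
    finally show ?thesis .
  qed
  have finF: "finite F" using finX by (simp add: F_def)
  \<comment> \<open>a subgroup of order \<open>p\<close> of the quotient of the normalizer by \<open>U\<close>\<close>
  obtain k where "order ?Q = p ^ 1 * k" using pF carQ by (auto simp: order_def elim: dvdE)
  then obtain A where A: "subgroup A ?Q" "card A = p"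
    using sylow_thm[OF prime nU.factorgroup_is_group, of 1 k] carQ finF by auto
  define V where "V = \<Union>A"
  have V_char: "V = {x \<in> N. U #> x \<in> A}"
    using nU.factgroup_subgroup_union_char[OF A(1)] by (simp add: V_def)
  have VN: "V \<subseteq> N" using V_char by auto
  have sV: "subgroup V G"
    using nU.factgroup_subgroup_union_subgroup[OF A(1)] incl_subgroup[OF sN] by (simp add: V_def)
  have UV: "U \<subseteq> V"
  proof
    fix u assume u: "u \<in> U"
    have "U \<in> A" using subgroup.one_closed[OF A(1)] by simp
    moreover have "U #> u = U" using coset_join2[OF uG[OF u] sU u] .
    ultimately show "u \<in> V" using u UN by (auto simp: V_char)
  qed
  have "(\<lambda>x. U #> x) ` V = A"
  proof (intro equalityI subsetI)
    fix C assume C: "C \<in> A"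
    then have "C \<in> (\<lambda>x. U #> x) ` N"
      using subgroup.subset[OF A(1)] by (auto simp: carrier_FactGroup)
    then show "C \<in> (\<lambda>x. U #> x) ` V" using C by (auto simp: V_char)
  qed (auto simp: V_char)
  then have iVU: "index G V U = p" using A by (simp add: index_def)
  then have "fin_sub V" using fin_sub_supergroup[OF U sV UV] by simp
  then show ?thesis using UV iVU VN by (intro that[of V]) (auto simp: N_def)
qed

text \<open>
  Ascend from \<open>U\<close> in normal steps of index \<open>p\<close>.
\<close>

lemma fin_sub_of_smaller_index:
  assumes "fin_sub U" "index G (carrier G) U = p ^ m" "j \<le> m"
  shows "\<exists>V. fin_sub V \<and> U \<subseteq> V \<and> index G (carrier G) V = p ^ j"
  using assms
proof (induction "m - j" arbitrary: U m)
  case 0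
  then have "m = j" by simp
  then show ?case using 0 by blast
next
  case (Suc k)
  have ne: "U \<noteq> carrier G"
  proof
    assume "U = carrier G"
    then have "p ^ m = 1" using index_self[OF subgroup_self] Suc.prems by simp
    then show False using p_gt_1 Suc.hyps by simp
  qed
  obtain V where V: "fin_sub V" "U \<subseteq> V" "index G V U = p"
    using fin_sub_normal_step[OF Suc.prems(1) ne] by blast
  have "index G (carrier G) U = index G (carrier G) V * index G V U"
    using V Suc.prems by (intro index_mult) (auto simp: fin_subD subgroup_self fin_sub_subset)
  moreover have "p ^ m = p ^ (m - 1) * p"
    using Suc.hyps(2) power_minus_mult[of m p] by simp
  ultimately have "index G (carrier G) V * p = p ^ (m - 1) * p" using V(3) Suc.prems(2) by metis
  then have "index G (carrier G) V = p ^ (m - 1)" using p_pos by simp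
  moreover have "k = (m - 1) - j" "j \<le> m - 1" using Suc.hyps(2) by linarith+
  ultimately have "\<exists>W. fin_sub W \<and> V \<subseteq> W \<and> index G (carrier G) W = p ^ j"
    using Suc.hyps(1)[of "m - 1" V] V(1) by blast
  then show ?case using V(2) by blast
qed

end

text \<open>
  A closed subgroup of finite index is open, as its complement is a finite union of closed cosets.
\<close>

lemma p_power_index_if_pro_p:
  fixes G (structure)
  assumes "prime p" "pro_p_group p G T"
  shows "p_power_index G T p"
proof -
  have prof: "profinite_group G T" using assms by (simp add: pro_p_group_def)
  then have tg: "topological_group G T" by (simp add: profinite_group_def)
  then interpret group G by (simp add: topological_group_def)
  interpret discrete_or_profinite G T
    by unfold_locales (use prof tg in auto)
  show ?thesis
  proof unfold_locales
    fix K assume K: "K \<lhd> G" "fin_sub K"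
    have "carrier G - K = \<Union> ((\<lambda>x. K #> x) ` (carrier G - K))"
    proof (intro equalityI subsetI)
      fix x assume "x \<in> carrier G - K"
      then show "x \<in> \<Union> ((\<lambda>x. K #> x) ` (carrier G - K))"
        using rcos_self fin_subD(1)[OF K(2)] by blast
    next
      fix x assume "x \<in> \<Union> ((\<lambda>x. K #> x) ` (carrier G - K))"
      then obtain y k where yk: "y \<in> carrier G" "y \<notin> K" "k \<in> K" "x = k \<otimes> y"
        by (auto simp: r_coset_def)
      have "x \<notin> K"
      proof
        assume "x \<in> K"
        then have "inv k \<otimes> x \<in> K" using yk K by (simp add: fin_sub_def subgroup.m_closed subgroup.m_inv_closed)
        then show False using yk fin_sub_subset[OF K(2)] by (simp add: subset_iff m_assoc[symmetric])
      qed
      then show "x \<in> carrier G - K" using yk fin_sub_subset[OF K(2)] by auto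
    qed
    moreover have "finite ((\<lambda>x. K #> x) ` (carrier G - K))"
      using fin_subD(3)[OF K(2)]
      by (auto simp: index_pos_iff subgroup_ne[OF subgroup_self] intro: rev_finite_subset)
    then have "closedin T (\<Union> ((\<lambda>x. K #> x) ` (carrier G - K)))"
      using fin_subD(2)[OF K(2)] by (intro closedin_Union) (auto simp: closedin_rcoset)
    ultimately have "closedin T (carrier G - K)" by simp
    then have "openin T K" using fin_sub_subset[OF K(2)] by (simp add: openin_closedin topspace)
    then show "\<exists>i. index G (carrier G) K = p ^ i"
      using assms K by (auto simp: pro_p_group_def card_rcosets)
  qed fact
qed

lemma topological_group_discrete:
  assumes "group G" shows "topological_group G (discrete_topology (carrier G))"
proof -
  interpret group G by fact
  show ?thesis
    by (auto simp: topological_group_def assms prod_topology_discrete_topology[symmetric])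
qed

text \<open>
  A prime divisor \<open>q\<close> of the order of a finite quotient is the order of one of its elements, hence equals \<open>p\<close>.
\<close>

lemma p_power_index_if_p_group:
  fixes G (structure)
  assumes "prime p" "p_group p G"
  shows "p_power_index G (discrete_topology (carrier G)) p"
proof -
  interpret group G using assms by (simp add: p_group_def)
  interpret discrete_or_profinite G "discrete_topology (carrier G)"
    by unfold_locales (simp_all add: topological_group_discrete)
  show ?thesis
  proof unfold_locales
    fix K assume K: "K \<lhd> G" "fin_sub K"
    interpret K: normal K G by (rule K)
    have carQ: "carrier (G Mod K) = (\<lambda>x. K #> x) ` carrier G" by (simp add: carrier_FactGroup)
    have finQ: "finite (carrier (G Mod K))"
      using fin_subD(3)[OF K(2)] carQ by (simp add: index_pos_iff subgroup_ne[OF subgroup_self])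
    have cardQ: "index G (carrier G) K = order (G Mod K)" using carQ by (simp add: index_def order_def)
    show "\<exists>i. index G (carrier G) K = p ^ i"
    proof (rule eq_prime_power_if_unique_prime_divisor[OF assms(1)])
      show "0 < index G (carrier G) K" using fin_subD(3)[OF K(2)] .
      fix q assume q: "prime q" "q dvd index G (carrier G) K"
      then obtain k where "order (G Mod K) = q ^ 1 * k" using cardQ by (auto elim: dvdE)
      then obtain A where A: "subgroup A (G Mod K)" "card A = q"
        using sylow_thm[OF q(1) K.factorgroup_is_group, of 1 k] finQ by auto
      interpret Q: group "G Mod K" by (rule K.factorgroup_is_group)
      interpret A: group "(G Mod K)\<lparr>carrier := A\<rparr>" using A(1) by (rule Q.subgroup_imp_group)
      have "A \<noteq> {\<one>\<^bsub>G Mod K\<^esub>}" using A(2) q(1) by auto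
      then obtain C where C: "C \<in> A" "C \<noteq> \<one>\<^bsub>G Mod K\<^esub>" using subgroup.one_closed[OF A(1)] by auto
      then obtain x where x: "x \<in> carrier G" "C = K #> x"
        using subgroup.subset[OF A(1)] carQ by auto
      obtain i where i: "ord x = p ^ i" using assms(2) x by (auto simp: p_group_def)
      have "C [^]\<^bsub>G Mod K\<^esub> (p ^ i) = K #> (x [^] (p ^ i))"
        using x K.FactGroup_pow[of x "p ^ i"] by simp
      also have "\<dots> = \<one>\<^bsub>G Mod K\<^esub>" using i x pow_ord_eq_1[of x] K.subset by simp
      finally have 1: "C [^]\<^bsub>G Mod K\<^esub> (p ^ i) = \<one>\<^bsub>G Mod K\<^esub>" .
      have "C [^]\<^bsub>(G Mod K)\<lparr>carrier := A\<rparr>\<^esub> q = \<one>\<^bsub>G Mod K\<^esub>"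
        using A.pow_order_eq_1[of C] C A(2) by (simp add: order_def)
      then have 2: "C [^]\<^bsub>G Mod K\<^esub> q = \<one>\<^bsub>G Mod K\<^esub>"
        using Q.nat_pow_consistent[of C q A] by simp
      have CQ: "C \<in> carrier (G Mod K)" using C subgroup.subset[OF A(1)] by auto
      have "Q.ord C dvd p ^ i" "Q.ord C dvd q" using Q.pow_eq_id[OF CQ] 1 2 by blast+
      moreover have "Q.ord C \<noteq> 1" using C(2) CQ Q.ord_eq_1 by blast
      ultimately have "Q.ord C = q" using q(1) by (auto simp: prime_nat_iff)
      then have "q dvd p" using \<open>Q.ord C dvd p ^ i\<close> q(1) by (metis prime_dvd_power)
      then show "q = p" using q(1) assms(1) by (simp add: primes_dvd_imp_eq)
    qed
  qed fact
qed

section \<open>Characters of order \<open>p\<close>\<close>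

text \<open>
  The continuous homomorphisms from \<open>U\<close> to \<open>\<int>/p\<close>. The kernel has finite index, so that it is enough
  to demand that it be closed.
\<close>

definition characters :: "nat \<Rightarrow> ('a, 'b) monoid_scheme \<Rightarrow> 'a topology \<Rightarrow> 'a set \<Rightarrow> ('a \<Rightarrow> int) set" where
  "characters p G T U =
     {\<theta> \<in> U \<rightarrow>\<^sub>E {0..<int p}.
        (\<forall>x\<in>U. \<forall>y\<in>U. \<theta> (x \<otimes>\<^bsub>G\<^esub> y) = (\<theta> x + \<theta> y) mod int p) \<and> closedin T {x\<in>U. \<theta> x = 0}}"

text \<open>
  The discrete logarithm to the base \<open>x\<close>.
\<close>

lemma (in group) cyclic_of_order_p_hom_to_residues:
  assumes "prime p" "x \<in> carrier G" "ord x = p"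
    and gen: "\<And>y. y \<in> carrier G \<Longrightarrow> \<exists>k::int. y = x [^] k"
  obtains \<psi> where "\<And>y. y \<in> carrier G \<Longrightarrow> \<psi> y \<in> {0..<int p}"
    "\<And>y z. y \<in> carrier G \<Longrightarrow> z \<in> carrier G \<Longrightarrow> \<psi> (y \<otimes> z) = (\<psi> y + \<psi> z) mod int p"
    "\<And>y. y \<in> carrier G \<Longrightarrow> \<psi> y = 0 \<longleftrightarrow> y = \<one>" "\<psi> x = 1"
proof
  have p: "1 < int p" using assms(1) prime_gt_1_nat by auto
  have pow_eq: "x [^] k = x [^] l \<longleftrightarrow> k mod int p = l mod int p" for k l :: int
  proof -
    have "x [^] k = x [^] l \<longleftrightarrow> x [^] (k - l) = \<one>"
      using assms(2) by (metis int_pow_diff int_pow_closed inv_solve_right' l_one one_closed)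
    also have "\<dots> \<longleftrightarrow> int p dvd k - l" using int_pow_eq_id[OF assms(2)] assms(3) by simp
    finally show ?thesis by (simp add: mod_eq_dvd_iff)
  qed
  define \<psi> where "\<psi> y = (SOME k::int. y = x [^] k) mod int p" for y
  have \<psi>: "x [^] \<psi> y = y" if "y \<in> carrier G" for y
  proof -
    have "y = x [^] (SOME k::int. y = x [^] k)" using gen[OF that] by (rule someI_ex)
    moreover have "x [^] \<psi> y = x [^] (SOME k::int. y = x [^] k)" by (subst pow_eq) (simp add: \<psi>_def)
    ultimately show ?thesis by simp
  qed
  show ran: "\<psi> y \<in> {0..<int p}" if "y \<in> carrier G" for y using p by (simp add: \<psi>_def)
  have \<psi>_eq: "\<psi> (x [^] k) = k mod int p" for k
  proof -
    have "x [^] \<psi> (x [^] k) = x [^] k" using \<psi> assms(2) by simp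
    then have "\<psi> (x [^] k) mod int p = k mod int p" by (simp add: pow_eq)
    then show ?thesis by (simp add: \<psi>_def)
  qed
  show "\<psi> (y \<otimes> z) = (\<psi> y + \<psi> z) mod int p" if "y \<in> carrier G" "z \<in> carrier G" for y z
  proof -
    have "y \<otimes> z = x [^] (\<psi> y + \<psi> z)" using \<psi> that assms(2) by (simp add: int_pow_mult)
    then show ?thesis by (simp add: \<psi>_eq)
  qed
  show "\<psi> y = 0 \<longleftrightarrow> y = \<one>" if "y \<in> carrier G" for y
  proof
    assume "\<psi> y = 0" then show "y = \<one>" using \<psi>[OF that] by simp
  next
    assume "y = \<one>" then show "\<psi> y = 0" using \<psi>_eq[of 0] by simp
  qed
  show "\<psi> x = 1" using \<psi>_eq[of 1] assms(2) p by simp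
qed

lemma (in group) ord_eq_prime_if_pow_eq_one:
  assumes "prime p" "x \<in> carrier G" "x [^] p = \<one>" "x \<noteq> \<one>"
  shows "ord x = p"
proof -
  have "ord x dvd p" using pow_eq_id[OF assms(2)] assms(3) by blast
  moreover have "ord x \<noteq> 1" using ord_eq_1[OF assms(2)] assms(4) by blast
  ultimately show ?thesis using assms(1) by (auto simp: prime_nat_iff)
qed

lemma (in group) rcoset_self_iff:
  assumes "subgroup M G" "v \<in> carrier G"
  shows "M #> v = M \<longleftrightarrow> v \<in> M"
  using coset_join1[OF _ assms(2,1)] coset_join2[OF assms(2,1)] by blast

lemma (in group) subgroup_nat_pow: "subgroup V G \<Longrightarrow> x \<in> V \<Longrightarrow> x [^] (n::nat) \<in> V"
  by (induction n) (auto simp: subgroup.one_closed subgroup.m_closed)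

context discrete_or_profinite_mod begin

abbreviation chars :: "'a set \<Rightarrow> ('a \<Rightarrow> int) set" where
  "chars U \<equiv> characters p G T U"

context
  fixes U assumes U: "subgroup U G" "closedin T U"
begin

lemma char_sub_mem: "x \<in> U \<Longrightarrow> x \<in> carrier G"
  using subgroup.subset[OF U(1)] by auto

lemma char_range: "\<theta> \<in> chars U \<Longrightarrow> x \<in> U \<Longrightarrow> 0 \<le> \<theta> x \<and> \<theta> x < int p"
  by (force simp: characters_def)

lemma char_mod: "\<theta> \<in> chars U \<Longrightarrow> x \<in> U \<Longrightarrow> \<theta> x mod int p = \<theta> x"
  using char_range by (simp add: mod_pos_pos_trivial)

lemma char_mult: "\<theta> \<in> chars U \<Longrightarrow> x \<in> U \<Longrightarrow> y \<in> U \<Longrightarrow> \<theta> (x \<otimes> y) = (\<theta> x + \<theta> y) mod int p"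
  by (simp add: characters_def)

lemma char_ext: "\<theta> \<in> chars U \<Longrightarrow> \<psi> \<in> chars U \<Longrightarrow> (\<And>x. x \<in> U \<Longrightarrow> \<theta> x = \<psi> x) \<Longrightarrow> \<theta> = \<psi>"
  by (auto simp: characters_def intro: PiE_ext)

lemma char_one: assumes "\<theta> \<in> chars U" shows "\<theta> \<one> = 0"
proof -
  have 1: "\<one> \<in> U" using U subgroup.one_closed by auto
  then have "\<theta> \<one> mod int p = (\<theta> \<one> + \<theta> \<one>) mod int p"
    using char_mult[OF assms 1 1] char_mod[OF assms 1] by simp
  then have "int p dvd \<theta> \<one>" by (simp add: mod_eq_dvd_iff)
  then show ?thesis using char_mod[OF assms 1] by (simp add: dvd_eq_mod_eq_0)
qed

lemma char_eq_iff:
  assumes "\<theta> \<in> chars U" "x \<in> U" "y \<in> U"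
  shows "\<theta> x = \<theta> y \<longleftrightarrow> \<theta> (x \<otimes> inv y) = 0"
proof -
  have iy: "x \<otimes> inv y \<in> U" using assms U by (simp add: subgroup.m_closed subgroup.m_inv_closed)
  have "x = (x \<otimes> inv y) \<otimes> y" using assms by (simp add: char_sub_mem m_assoc)
  then have x: "\<theta> x = (\<theta> (x \<otimes> inv y) + \<theta> y) mod int p"
    using char_mult[OF assms(1) iy assms(3)] by simp
  show ?thesis
  proof
    assume "\<theta> x = \<theta> y"
    then have "\<theta> y mod int p = (\<theta> (x \<otimes> inv y) + \<theta> y) mod int p"
      using x char_mod[OF assms(1,3)] by simp
    then have "int p dvd \<theta> (x \<otimes> inv y)" by (simp add: mod_eq_dvd_iff)
    then show "\<theta> (x \<otimes> inv y) = 0" using char_mod[OF assms(1) iy] by (simp add: dvd_eq_mod_eq_0)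
  next
    assume "\<theta> (x \<otimes> inv y) = 0"
    then show "\<theta> x = \<theta> y" using x char_mod[OF assms(1,3)] by simp
  qed
qed

lemma char_pow:
  assumes "\<theta> \<in> chars U" "x \<in> U"
  shows "x [^] (n::nat) \<in> U \<and> \<theta> (x [^] n) = (int n * \<theta> x) mod int p"
proof (induction n)
  case 0
  then show ?case using U char_one[OF assms(1)] by (simp add: subgroup.one_closed)
next
  case (Suc n)
  have "\<theta> (x [^] Suc n) = (\<theta> (x [^] n) + \<theta> x) mod int p"
    using char_mult[OF assms(1) _ assms(2), of "x [^] n"] Suc by simp
  also have "\<dots> = (int n * \<theta> x + \<theta> x) mod int p" using Suc by (simp add: mod_add_left_eq)
  finally show ?case using Suc assms U by (simp add: subgroup.m_closed algebra_simps)
qed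

lemma char_kernel:
  assumes "\<theta> \<in> chars U"
  shows "subgroup {x\<in>U. \<theta> x = 0} G" "closedin T {x\<in>U. \<theta> x = 0}"
    "index G U {x\<in>U. \<theta> x = 0} = card (\<theta> ` U)" "0 < index G U {x\<in>U. \<theta> x = 0}"
proof -
  show cl: "closedin T {x\<in>U. \<theta> x = 0}" using assms by (simp add: characters_def)
  show sub: "subgroup {x\<in>U. \<theta> x = 0} G"
  proof (rule subgroupI)
    show "{x\<in>U. \<theta> x = 0} \<noteq> {}" using char_one[OF assms] U subgroup.one_closed by auto
    show "{x\<in>U. \<theta> x = 0} \<subseteq> carrier G" using char_sub_mem by auto
    fix a assume a: "a \<in> {x\<in>U. \<theta> x = 0}"
    have 1: "\<one> \<in> U" using U subgroup.one_closed by auto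
    have "\<theta> (\<one> \<otimes> inv a) = 0" using char_eq_iff[OF assms 1, of a] a char_one[OF assms] by simp
    then show "inv a \<in> {x\<in>U. \<theta> x = 0}" using a U by (simp add: subgroup.m_inv_closed char_sub_mem)
  next
    fix a b assume "a \<in> {x\<in>U. \<theta> x = 0}" "b \<in> {x\<in>U. \<theta> x = 0}"
    then show "a \<otimes> b \<in> {x\<in>U. \<theta> x = 0}" using char_mult[OF assms] U by (simp add: subgroup.m_closed)
  qed
  show card: "index G U {x\<in>U. \<theta> x = 0} = card (\<theta> ` U)"
  proof (rule index_eq_card_image[OF sub])
    show "U \<subseteq> carrier G" using U subgroup.subset by auto
    fix x y assume "x \<in> U" "y \<in> U"
    then show "\<theta> x = \<theta> y \<longleftrightarrow> x \<otimes> inv y \<in> {x\<in>U. \<theta> x = 0}"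
      using char_eq_iff[OF assms] U by (simp add: subgroup.m_closed subgroup.m_inv_closed)
  qed
  have "\<theta> ` U \<subseteq> {0..<int p}" using char_range[OF assms] by auto
  then have "finite (\<theta> ` U)" by (rule finite_subset) simp
  then show "0 < index G U {x\<in>U. \<theta> x = 0}"
    using card U subgroup_ne by (simp add: card_gt_0_iff)
qed

text \<open>The kernel is closed by \<open>closed_supergroup\<close>, being a subgroup that contains \<open>L\<close>.\<close>

lemma charI:
  assumes ran: "\<And>x. x \<in> U \<Longrightarrow> \<theta> x mod int p = \<theta> x"
    and ext: "\<theta> \<in> extensional U"
    and mult: "\<And>x y. x \<in> U \<Longrightarrow> y \<in> U \<Longrightarrow> \<theta> (x \<otimes> y) = (\<theta> x + \<theta> y) mod int p"
    and L: "subgroup L G" "closedin T L" "L \<subseteq> U" "0 < index G U L" "\<And>x. x \<in> L \<Longrightarrow> \<theta> x = 0"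
  shows "\<theta> \<in> chars U"
proof -
  have r: "0 \<le> \<theta> x \<and> \<theta> x < int p" if "x \<in> U" for x
    using ran[OF that] pos_mod_sign[of "int p" "\<theta> x"] pos_mod_bound[of "int p" "\<theta> x"] p_pos by simp
  have 1: "\<one> \<in> U" using U subgroup.one_closed by auto
  have one: "\<theta> \<one> = 0" using L subgroup.one_closed by auto
  have sub: "subgroup {x\<in>U. \<theta> x = 0} G"
  proof (rule subgroupI)
    show "{x\<in>U. \<theta> x = 0} \<noteq> {}" using one 1 by auto
    show "{x\<in>U. \<theta> x = 0} \<subseteq> carrier G" using char_sub_mem by auto
    fix a assume a: "a \<in> {x\<in>U. \<theta> x = 0}"
    then have ia: "inv a \<in> U" using U by (simp add: subgroup.m_inv_closed)
    have "\<theta> (a \<otimes> inv a) = \<theta> (inv a) mod int p" using mult[of a "inv a"] a ia by simp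
    then have "\<theta> (inv a) = 0" using ran[OF ia] a one by (simp add: char_sub_mem)
    then show "inv a \<in> {x\<in>U. \<theta> x = 0}" using ia by simp
  next
    fix a b assume "a \<in> {x\<in>U. \<theta> x = 0}" "b \<in> {x\<in>U. \<theta> x = 0}"
    then show "a \<otimes> b \<in> {x\<in>U. \<theta> x = 0}" using mult[of a b] U by (simp add: subgroup.m_closed)
  qed
  have "L \<subseteq> {x\<in>U. \<theta> x = 0}" using L by auto
  moreover have "index G U L = index G U {x\<in>U. \<theta> x = 0} * index G {x\<in>U. \<theta> x = 0} L"
    using calculation by (intro index_mult L(1) sub U(1)) auto
  ultimately have "closedin T {x\<in>U. \<theta> x = 0}"
    using L(4) by (intro closed_supergroup[OF L(1,2) sub]) auto
  then show ?thesis using r ext mult by (auto simp: characters_def PiE_iff)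
qed

lemma char_zero: "(\<lambda>x\<in>U. 0) \<in> chars U"
  using U index_self[OF U(1)] by (intro charI[of _ U]) (auto simp: subgroup.m_closed)

lemma char_add_mult:
  assumes "\<theta> \<in> chars U" "\<psi> \<in> chars U"
  shows "(\<lambda>x\<in>U. (\<theta> x + c * \<psi> x) mod int p) \<in> chars U"
proof -
  let ?A = "{x\<in>U. \<theta> x = 0}" and ?B = "{x\<in>U. \<psi> x = 0}"
  note A = char_kernel[OF assms(1)] and B = char_kernel[OF assms(2)]
  have "index G U (?A \<inter> ?B) = card ((\<lambda>x. (\<theta> x, \<psi> x)) ` U)"
  proof (rule index_eq_card_image)
    show "subgroup (?A \<inter> ?B) G" using A B by (simp add: subgroups_Inter_pair)
    show "U \<subseteq> carrier G" using U subgroup.subset by auto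
    fix x y assume "x \<in> U" "y \<in> U"
    then show "(\<theta> x, \<psi> x) = (\<theta> y, \<psi> y) \<longleftrightarrow> x \<otimes> inv y \<in> ?A \<inter> ?B"
      using char_eq_iff[OF assms(1)] char_eq_iff[OF assms(2)] U
      by (simp add: subgroup.m_closed subgroup.m_inv_closed)
  qed
  moreover have "(\<lambda>x. (\<theta> x, \<psi> x)) ` U \<subseteq> {0..<int p} \<times> {0..<int p}"
    using char_range[OF assms(1)] char_range[OF assms(2)] by auto
  then have "finite ((\<lambda>x. (\<theta> x, \<psi> x)) ` U)" by (rule finite_subset) simp
  ultimately have pos: "0 < index G U (?A \<inter> ?B)" using U subgroup_ne by (simp add: card_gt_0_iff)
  have mod_lin: "(a mod int p + c * (b mod int p)) mod int p = (a + c * b) mod int p" for a b c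
  proof -
    have "(a mod int p + c * (b mod int p)) mod int p
        = (a mod int p mod int p + c * (b mod int p) mod int p) mod int p" by (simp only: mod_add_eq)
    also have "\<dots> = (a mod int p + c * b mod int p) mod int p" by (simp only: mod_mult_right_eq mod_mod_trivial)
    finally show ?thesis by (simp only: mod_add_eq)
  qed
  show ?thesis
  proof (rule charI[of _ "?A \<inter> ?B"])
    fix x y assume xy: "x \<in> U" "y \<in> U"
    then have "x \<otimes> y \<in> U" using U by (simp add: subgroup.m_closed)
    moreover have "(\<theta> (x \<otimes> y) + c * \<psi> (x \<otimes> y)) mod int p
        = ((\<theta> x + c * \<psi> x) mod int p + (\<theta> y + c * \<psi> y) mod int p) mod int p"
    proof -
      have "(\<theta> (x \<otimes> y) + c * \<psi> (x \<otimes> y)) mod int p = (\<theta> x + \<theta> y + c * (\<psi> x + \<psi> y)) mod int p"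
        using xy mod_lin[of "\<theta> x + \<theta> y" c "\<psi> x + \<psi> y"]
        by (simp only: char_mult[OF assms(1)] char_mult[OF assms(2)])
      also have "\<theta> x + \<theta> y + c * (\<psi> x + \<psi> y) = (\<theta> x + c * \<psi> x) + (\<theta> y + c * \<psi> y)"
        by (simp add: algebra_simps)
      finally show ?thesis by (simp add: mod_simps)
    qed
    ultimately show "(\<lambda>x\<in>U. (\<theta> x + c * \<psi> x) mod int p) (x \<otimes> y)
      = ((\<lambda>x\<in>U. (\<theta> x + c * \<psi> x) mod int p) x + (\<lambda>x\<in>U. (\<theta> x + c * \<psi> x) mod int p) y) mod int p"
      using xy by simp
  qed (use A B pos in \<open>auto simp: subgroups_Inter_pair\<close>)
qed

lemma char_lincomb:
  assumes "finite S" "\<And>s. s \<in> S \<Longrightarrow> \<psi> s \<in> chars U"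
  shows "(\<lambda>x\<in>U. (\<Sum>s\<in>S. c s * \<psi> s x) mod int p) \<in> chars U"
  using assms
proof (induction S rule: finite_induct)
  case empty
  then show ?case using char_zero by (simp add: restrict_def)
next
  case (insert s S)
  have "(\<lambda>x\<in>U. ((\<lambda>x\<in>U. (\<Sum>s\<in>S. c s * \<psi> s x) mod int p) x + c s * \<psi> s x) mod int p) \<in> chars U"
    using insert by (intro char_add_mult) auto
  also have "(\<lambda>x\<in>U. ((\<lambda>x\<in>U. (\<Sum>s\<in>S. c s * \<psi> s x) mod int p) x + c s * \<psi> s x) mod int p)
    = (\<lambda>x\<in>U. (\<Sum>s\<in>insert s S. c s * \<psi> s x) mod int p)"
    using insert by (auto simp: restrict_def fun_eq_iff mod_simps add.commute)
  finally show ?case .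
qed

lemma char_restrict:
  assumes "\<theta> \<in> chars U" "subgroup W G" "closedin T W" "W \<subseteq> U"
  shows "restrict \<theta> W \<in> chars W"
proof -
  have "{x \<in> W. restrict \<theta> W x = 0} = W \<inter> {x\<in>U. \<theta> x = 0}" using assms by auto
  then have "closedin T {x \<in> W. restrict \<theta> W x = 0}" using char_kernel(2)[OF assms(1)] assms by auto
  then show ?thesis
    using assms char_range[OF assms(1)] char_mult[OF assms(1)]
    by (auto simp: characters_def PiE_iff subgroup.m_closed subset_iff)
qed

text \<open>Left exactness of \<open>Hom(-, \<int>/p)\<close> bounds the number of characters of an extension.\<close>

lemma card_chars_le_restrict:
  assumes W: "subgroup W G" "closedin T W" "W \<subseteq> U"
    and finW: "finite (chars W)" and finZ: "finite {\<theta> \<in> chars U. \<forall>x\<in>W. \<theta> x = 0}"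
  shows "finite (chars U)"
    "card (chars U) \<le> card {\<theta> \<in> chars U. \<forall>x\<in>W. \<theta> x = 0} * card (chars W)"
proof -
  let ?Z = "{\<theta> \<in> chars U. \<forall>x\<in>W. \<theta> x = 0}"
  define F where "F \<rho> = {\<theta> \<in> chars U. restrict \<theta> W = \<rho>}" for \<rho>
  have F: "finite (F \<rho>) \<and> card (F \<rho>) \<le> card ?Z" for \<rho>
  proof (cases "F \<rho> = {}")
    case False
    then obtain \<theta>0 where c0: "\<theta>0 \<in> F \<rho>" by auto
    define d where "d \<theta> = (\<lambda>x\<in>U. (\<theta> x + (- 1) * \<theta>0 x) mod int p)" for \<theta>
    have "inj_on d (F \<rho>)"
    proof (rule inj_onI)
      fix \<theta> \<psi> assume h: "\<theta> \<in> F \<rho>" "\<psi> \<in> F \<rho>" "d \<theta> = d \<psi>"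
      show "\<theta> = \<psi>"
      proof (rule char_ext)
        fix x assume x: "x \<in> U"
        have "(\<theta> x + (- 1) * \<theta>0 x) mod int p = (\<psi> x + (- 1) * \<theta>0 x) mod int p"
          using fun_cong[OF h(3), of x] x by (simp add: d_def)
        then have "\<theta> x mod int p = \<psi> x mod int p" by (simp add: mod_eq_dvd_iff)
        then show "\<theta> x = \<psi> x" using h x by (simp add: F_def char_mod)
      qed (use h in \<open>auto simp: F_def\<close>)
    qed
    moreover have "d ` F \<rho> \<subseteq> ?Z"
    proof safe
      fix \<theta> assume h: "\<theta> \<in> F \<rho>"
      show "d \<theta> \<in> chars U" using h c0 unfolding d_def F_def by (intro char_add_mult) auto
      fix x assume x: "x \<in> W"
      have "restrict \<theta> W x = restrict \<theta>0 W x" using h c0 by (simp add: F_def)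
      then show "d \<theta> x = 0" using x W by (auto simp: d_def)
    qed
    ultimately show ?thesis using finZ card_inj_on_le inj_on_finite by blast
  qed simp
  have UN: "chars U = (\<Union>\<rho>\<in>chars W. F \<rho>)"
    using char_restrict[OF _ W] by (auto simp: F_def)
  then show "finite (chars U)" using finW F by simp
  have "card (chars U) \<le> (\<Sum>\<rho>\<in>chars W. card (F \<rho>))"
    unfolding UN using finW by (rule card_UN_le)
  also have "\<dots> \<le> (\<Sum>\<rho>\<in>chars W. card ?Z)" using F by (intro sum_mono) auto
  finally show "card (chars U) \<le> card ?Z * card (chars W)" by (simp add: mult.commute)
qed

text \<open>The homomorphism that \<open>\<theta>\<close> induces on the image of \<open>f\<close> has the closed kernel \<open>f (ker \<theta>)\<close>.\<close>

lemma vanishing_subset_pullback: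
  assumes fmult: "\<And>x y. x \<in> U \<Longrightarrow> y \<in> U \<Longrightarrow> f (x \<otimes> y) = f x \<otimes>\<^bsub>Q\<^esub> f y"
    and closed: "\<And>C. closedin T C \<Longrightarrow> C \<subseteq> U \<Longrightarrow> closedin S (f ` C)"
    and \<theta>: "\<theta> \<in> chars U"
    and fker: "\<And>x y. x \<in> U \<Longrightarrow> y \<in> U \<Longrightarrow> f x = f y \<Longrightarrow> \<theta> x = \<theta> y"
  shows "\<exists>\<psi>\<in>characters p Q S (f ` U). \<theta> = (\<lambda>x\<in>U. \<psi> (f x))"
proof
  define \<psi> where "\<psi> = (\<lambda>y\<in>f ` U. \<theta> (inv_into U f y))"
  have \<psi>: "\<psi> (f x) = \<theta> x" if "x \<in> U" for x
    using that fker[of "inv_into U f (f x)" x] by (simp add: \<psi>_def inv_into_into f_inv_into_f)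
  have "{y \<in> f ` U. \<psi> y = 0} = f ` {x\<in>U. \<theta> x = 0}" using \<psi> by auto
  then have "closedin S {y \<in> f ` U. \<psi> y = 0}" using closed char_kernel(2)[OF \<theta>] by auto
  moreover have "\<psi> \<in> f ` U \<rightarrow>\<^sub>E {0..<int p}"
  proof (rule PiE_I)
    fix y assume "y \<in> f ` U"
    then obtain x where x: "x \<in> U" "y = f x" by blast
    then show "\<psi> y \<in> {0..<int p}" using \<psi>[OF x(1)] char_range[OF \<theta> x(1)] by simp
  qed (simp add: \<psi>_def)
  moreover have "\<psi> (f x \<otimes>\<^bsub>Q\<^esub> f y) = (\<psi> (f x) + \<psi> (f y)) mod int p" if "x \<in> U" "y \<in> U" for x y
    using that \<psi> U char_mult[OF \<theta>] by (simp add: fmult[symmetric] subgroup.m_closed)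
  ultimately show "\<psi> \<in> characters p Q S (f ` U)" unfolding characters_def by blast
  have "\<theta> \<in> extensional U" using \<theta> by (simp add: characters_def PiE_iff)
  then show "\<theta> = (\<lambda>x\<in>U. \<psi> (f x))"
    by (rule extensionalityI) (simp_all add: \<psi>)
qed

lemma pullback_char:
  assumes fmult: "\<And>x y. x \<in> U \<Longrightarrow> y \<in> U \<Longrightarrow> f (x \<otimes> y) = f x \<otimes> f y"
    and cont: "continuous_map (subtopology T N) T f" "closedin T N" "U \<subseteq> N"
    and V: "f ` U \<subseteq> V" and \<psi>: "\<psi> \<in> chars V"
  shows "(\<lambda>x\<in>U. \<psi> (f x)) \<in> chars U"
proof -
  have "closedin T {x\<in>V. \<psi> x = 0}" using \<psi> by (simp add: characters_def)
  then have "closedin T {x\<in>N. f x \<in> {x\<in>V. \<psi> x = 0}}"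
    by (rule closedin_preimage_sub[OF cont(1,2)])
  then have "closedin T (U \<inter> {x\<in>N. f x \<in> {x\<in>V. \<psi> x = 0}})"
    using U(2) by (rule closedin_Int[rotated])
  also have "U \<inter> {x\<in>N. f x \<in> {x\<in>V. \<psi> x = 0}} = {x\<in>U. (\<lambda>x\<in>U. \<psi> (f x)) x = 0}"
    using V cont(3) by auto
  finally have cl: "closedin T {x\<in>U. (\<lambda>x\<in>U. \<psi> (f x)) x = 0}" .
  have fV: "f x \<in> V" if "x \<in> U" for x using V that by auto
  have ran: "(\<lambda>x\<in>U. \<psi> (f x)) \<in> U \<rightarrow>\<^sub>E {0..<int p}"
    using \<psi> fV by (auto simp: characters_def)
  have "(\<lambda>x\<in>U. \<psi> (f x)) (x \<otimes> y) = ((\<lambda>x\<in>U. \<psi> (f x)) x + (\<lambda>x\<in>U. \<psi> (f x)) y) mod int p"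
    if "x \<in> U" "y \<in> U" for x y
    using that fV \<psi> U(1) by (simp add: characters_def subgroup.m_closed fmult)
  then show ?thesis using cl ran unfolding characters_def by blast
qed

end

text \<open>
  Compose the projection to \<open>V/M\<close> with the discrete logarithm of this cyclic group of order \<open>p\<close>.
\<close>

lemma char_of_cyclic_quotient:
  assumes V: "subgroup V G" "closedin T V" and M: "closedin T M" "M \<lhd> G\<lparr>carrier := V\<rparr>"
    and x: "x \<in> V" "x \<notin> M" "x [^] p \<in> M"
    and gen: "\<And>y. y \<in> V \<Longrightarrow> \<exists>k::int. M #> y = (M #> x) [^]\<^bsub>G\<lparr>carrier := V\<rparr> Mod M\<^esub> k"
  shows "\<exists>\<theta>\<in>chars V. \<theta> x = 1 \<and> {v\<in>V. \<theta> v = 0} = M"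
proof -
  interpret M: normal M "G\<lparr>carrier := V\<rparr>" by (rule M(2))
  let ?Q = "G\<lparr>carrier := V\<rparr> Mod M"
  interpret Q: group ?Q by (rule M.factorgroup_is_group)
  have VG: "V \<subseteq> carrier G" using V subgroup.subset by auto
  have MV: "M \<subseteq> V" using M.subset by simp
  have sM: "subgroup M G" using M.is_subgroup incl_subgroup[OF V(1)] by simp
  have carQ: "carrier ?Q = (\<lambda>x. M #> x) ` V" by (simp add: carrier_FactGroup)
  have in_M: "M #> v = M \<longleftrightarrow> v \<in> M" if "v \<in> V" for v
    using that VG rcoset_self_iff[OF sM] by blast
  have oneQ: "\<one>\<^bsub>?Q\<^esub> = M" by simp
  have powx: "(M #> x) [^]\<^bsub>?Q\<^esub> p = M #> (x [^] p)"
    using M.FactGroup_pow[of x p] x by (simp add: nat_pow_consistent[symmetric])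
  have xp: "x [^] p \<in> V" using x(3) MV by blast
  have xQ: "M #> x \<in> carrier ?Q" using carQ x(1) by blast
  have "(M #> x) [^]\<^bsub>?Q\<^esub> p = \<one>\<^bsub>?Q\<^esub>" using in_M[OF xp] x(3) unfolding powx oneQ by blast
  moreover have "M #> x \<noteq> \<one>\<^bsub>?Q\<^esub>" using in_M[OF x(1)] x(2) unfolding oneQ by blast
  ultimately have ord: "Q.ord (M #> x) = p" by (rule Q.ord_eq_prime_if_pow_eq_one[OF prime xQ])
  have "\<exists>k::int. y = (M #> x) [^]\<^bsub>?Q\<^esub> k" if "y \<in> carrier ?Q" for y
    using that gen unfolding carQ by blast
  then obtain \<psi> where \<psi>: "\<And>y. y \<in> carrier ?Q \<Longrightarrow> \<psi> y \<in> {0..<int p}"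
    "\<And>y z. y \<in> carrier ?Q \<Longrightarrow> z \<in> carrier ?Q \<Longrightarrow> \<psi> (y \<otimes>\<^bsub>?Q\<^esub> z) = (\<psi> y + \<psi> z) mod int p"
    "\<And>y. y \<in> carrier ?Q \<Longrightarrow> \<psi> y = 0 \<longleftrightarrow> y = \<one>\<^bsub>?Q\<^esub>" "\<psi> (M #> x) = 1"
    using Q.cyclic_of_order_p_hom_to_residues[OF prime xQ ord] by blast
  define \<theta> where "\<theta> = (\<lambda>v\<in>V. \<psi> (M #> v))"
  have "\<theta> v = 0 \<longleftrightarrow> v \<in> M" if "v \<in> V" for v
    using that \<psi>(3)[of "M #> v"] in_M[OF that] unfolding carQ oneQ by (simp add: \<theta>_def)
  then have ker: "{v\<in>V. \<theta> v = 0} = M" using MV by blast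
  have "\<theta> (v \<otimes> w) = (\<theta> v + \<theta> w) mod int p" if "v \<in> V" "w \<in> V" for v w
  proof -
    have "M #> (v \<otimes> w) = (M #> v) \<otimes>\<^bsub>?Q\<^esub> (M #> w)" using M.rcos_sum[of v w] that by simp
    moreover have "v \<otimes> w \<in> V" using that V by (simp add: subgroup.m_closed)
    ultimately show ?thesis using that \<psi>(2)[of "M #> v" "M #> w"] carQ by (simp add: \<theta>_def)
  qed
  moreover have "\<theta> \<in> V \<rightarrow>\<^sub>E {0..<int p}" using \<psi>(1) carQ by (auto simp: \<theta>_def)
  ultimately have "\<theta> \<in> chars V" using M(1) ker by (simp add: characters_def)
  moreover have "\<theta> x = 1" using \<psi>(4) x(1) by (simp add: \<theta>_def)
  ultimately show ?thesis using ker by blast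
qed

text \<open>
  A group of prime order is cyclic.
\<close>

lemma index_p_is_kernel:
  assumes V: "subgroup V G" "closedin T V" and M: "subgroup M G" "closedin T M" "M \<subseteq> V" "index G V M = p"
    and conj: "\<And>v u. v \<in> V \<Longrightarrow> u \<in> M \<Longrightarrow> v \<otimes> u \<otimes> inv v \<in> M"
  shows "\<exists>\<theta>\<in>chars V. {v\<in>V. \<theta> v = 0} = M"
proof -
  have VG: "V \<subseteq> carrier G" using V subgroup.subset by auto
  have nM: "M \<lhd> G\<lparr>carrier := V\<rparr>" using V(1) M(1,3) conj by (rule normal_in_subgroup)
  interpret M: normal M "G\<lparr>carrier := V\<rparr>" by (rule nM)
  let ?Q = "G\<lparr>carrier := V\<rparr> Mod M"
  interpret Q: group ?Q by (rule M.factorgroup_is_group)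
  have carQ: "carrier ?Q = (\<lambda>x. M #> x) ` V" by (simp add: carrier_FactGroup)
  have ordQ: "order ?Q = p" using M(4) carQ by (simp add: order_def index_def)
  have finQ: "finite (carrier ?Q)" using ordQ p_pos by (metis card.infinite less_numeral_extra(3) order_def)
  have "M \<noteq> V" using M(4) index_self[OF M(1)] p_gt_1 by auto
  then obtain x where x: "x \<in> V" "x \<notin> M" using M(3) by auto
  have in_M: "M #> v = M \<longleftrightarrow> v \<in> M" if "v \<in> V" for v
    using that VG rcoset_self_iff[OF M(1)] by blast
  have xQ: "M #> x \<in> carrier ?Q" using carQ x by auto
  have "(M #> x) [^]\<^bsub>?Q\<^esub> p = \<one>\<^bsub>?Q\<^esub>" using Q.pow_order_eq_1[OF xQ] ordQ by simp
  moreover have "(M #> x) [^]\<^bsub>?Q\<^esub> p = M #> (x [^] p)"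
    using M.FactGroup_pow[of x p] x by (simp add: nat_pow_consistent[symmetric])
  moreover have xpV: "x [^] p \<in> V" using subgroup_nat_pow[OF V(1) x(1)] .
  ultimately have xp: "x [^] p \<in> M" using in_M[OF xpV] by simp
  have "M #> x \<noteq> \<one>\<^bsub>?Q\<^esub>" using in_M[OF x(1)] x(2) by simp
  then have ord: "Q.ord (M #> x) = p"
    using Q.ord_eq_prime_if_pow_eq_one[OF prime xQ] \<open>(M #> x) [^]\<^bsub>?Q\<^esub> p = \<one>\<^bsub>?Q\<^esub>\<close> by blast
  have "card (generate ?Q {M #> x}) = card (carrier ?Q)"
    using Q.generate_pow_card[OF xQ] ord ordQ by (simp add: order_def)
  then have "generate ?Q {M #> x} = carrier ?Q"
    using finQ Q.generate_incl[of "{M #> x}"] xQ by (intro card_subset_eq) auto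
  then have "\<exists>k::int. M #> y = (M #> x) [^]\<^bsub>?Q\<^esub> k" if "y \<in> V" for y
    using that unfolding carQ Q.generate_pow[OF xQ] by blast
  then show ?thesis using char_of_cyclic_quotient[OF V M(2) nM x xp] by blast
qed

text \<open>
  Enlarge \<open>H\<close> to a subgroup \<open>M\<close> that is maximal among those that contain a suitable open subgroup and
  avoid \<open>x\<close>. Every nontrivial subgroup of the elementary abelian group \<open>G/M\<close> then contains \<open>x\<close>,
  so that \<open>G/M\<close> is cyclic of order \<open>p\<close>.
\<close>

lemma char_separating:
  assumes H: "subgroup H G" "closedin T H" and x: "x \<in> carrier G" "x \<notin> H"
    and comm: "\<And>a b. a \<in> carrier G \<Longrightarrow> b \<in> carrier G \<Longrightarrow> a \<otimes> b \<otimes> inv a \<otimes> inv b \<in> H"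
    and pow: "\<And>a. a \<in> carrier G \<Longrightarrow> a [^] p \<in> H"
  shows "\<exists>\<theta>\<in>chars (carrier G). \<theta> x = 1 \<and> (\<forall>h\<in>H. \<theta> h = 0)"
proof -
  have HG: "H \<subseteq> carrier G" using H subgroup.subset by auto
  have normal_above: "K \<lhd> G" if "subgroup K G" "H \<subseteq> K" for K
    using that(1) by (rule normal_if_commutators) (rule subsetD[OF that(2) comm])
  \<comment> \<open>Subgroups above a fixed open subgroup are open and thus closed, so the limit of a chain of them stays closed. In the
     profinite case \<open>H0 = HL\<close>, where the open subgroup \<open>L\<close> is so small that \<open>xL\<close> misses \<open>H\<close>.\<close>
  have "\<exists>H0. subgroup H0 G \<and> H \<subseteq> H0 \<and> x \<notin> H0 \<and> (\<forall>K. subgroup K G \<longrightarrow> H0 \<subseteq> K \<longrightarrow> closedin T K)"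
    using discrete_or_profinite
  proof
    assume T: "T = discrete_topology (carrier G)"
    have "closedin T K" if "subgroup K G" for K using T subgroup.subset[OF that] by simp
    then show ?thesis using H(1) x(2) by blast
  next
    assume prof: "profinite_group G T"
    let ?W = "{g \<in> carrier G. x \<otimes> g \<notin> H}"
    have "closedin T {g \<in> carrier G. x \<otimes> g \<in> H}"
      using x by (intro closedin_preimage continuous_mult continuous_id continuous_const H(2)) auto
    then have "openin T (topspace T - {g \<in> carrier G. x \<otimes> g \<in> H})"
      by (rule openin_diff[OF openin_topspace])
    also have "topspace T - {g \<in> carrier G. x \<otimes> g \<in> H} = ?W" by (auto simp: topspace)
    finally have "openin T ?W" .
    moreover have "\<one> \<in> ?W" using x by simp
    moreover have "\<forall>W. openin T W \<and> \<one> \<in> W \<longrightarrow> (\<exists>L. subgroup L G \<and> openin T L \<and> L \<subseteq> W)"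
      using prof unfolding profinite_group_def by (elim conjE)
    ultimately have "\<exists>L. subgroup L G \<and> openin T L \<and> L \<subseteq> ?W" by (elim allE[of _ ?W]) (rule mp, assumption, rule conjI)
    then obtain L where L: "subgroup L G" "openin T L" "L \<subseteq> ?W" by (elim exE conjE)
    have LG: "L \<subseteq> carrier G" using L subgroup.subset by auto
    have sHL: "subgroup (H <#> L) G"
      using mult_norm_subgroup[OF normal_above[OF H(1) subset_refl] L(1)] .
    have HHL: "H \<subseteq> H <#> L"
    proof
      fix h assume "h \<in> H"
      then have "h \<otimes> \<one> \<in> H <#> L" using subgroup.one_closed[OF L(1)] unfolding set_mult_def by blast
      then show "h \<in> H <#> L" using \<open>h \<in> H\<close> HG by auto
    qed
    have LHL: "L \<subseteq> H <#> L"
    proof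
      fix l assume "l \<in> L"
      then have "\<one> \<otimes> l \<in> H <#> L" using subgroup.one_closed[OF H(1)] unfolding set_mult_def by blast
      then show "l \<in> H <#> L" using \<open>l \<in> L\<close> LG by auto
    qed
    have "x \<notin> H <#> L"
    proof
      assume "x \<in> H <#> L"
      then obtain h l where hl: "h \<in> H" "l \<in> L" "x = h \<otimes> l" by (auto simp: set_mult_def)
      then have "x \<otimes> inv l = h" using HG LG by (simp add: subset_iff m_assoc)
      moreover have "inv l \<in> L" using hl L by (simp add: subgroup.m_inv_closed)
      ultimately show False using L(3) hl by auto
    qed
    moreover have "closedin T K" if K: "subgroup K G" "H <#> L \<subseteq> K" for K
    proof -
      have KG: "K \<subseteq> carrier G" using K subgroup.subset by auto
      have "openin T (carrier G - K)"
      proof (subst openin_subopen, intro ballI)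
        fix y assume y: "y \<in> carrier G - K"
        have "continuous_map T T (\<lambda>g. inv y \<otimes> g)"
          using y by (intro continuous_mult continuous_id continuous_const) auto
        then have "openin T {g \<in> topspace T. inv y \<otimes> g \<in> L}"
          using L(2) by (rule openin_continuous_map_preimage)
        moreover have "y \<in> {g \<in> topspace T. inv y \<otimes> g \<in> L}"
          using y subgroup.one_closed[OF L(1)] by (simp add: topspace)
        moreover have "{g \<in> topspace T. inv y \<otimes> g \<in> L} \<subseteq> carrier G - K"
        proof
          fix g assume g: "g \<in> {g \<in> topspace T. inv y \<otimes> g \<in> L}"
          then have gG: "g \<in> carrier G" and gK: "inv y \<otimes> g \<in> K" using LHL K by (auto simp: topspace)
          have "g \<notin> K"
          proof
            assume "g \<in> K"
            then have "g \<otimes> inv (inv y \<otimes> g) \<in> K"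
              using gK K by (simp add: subgroup.m_closed subgroup.m_inv_closed)
            moreover have "g \<otimes> inv (inv y \<otimes> g) = y"
              using y gG by (simp add: inv_mult_group m_assoc[symmetric])
            ultimately show False using y by simp
          qed
          then show "g \<in> carrier G - K" using gG by simp
        qed
        ultimately show "\<exists>S. openin T S \<and> y \<in> S \<and> S \<subseteq> carrier G - K" by blast
      qed
      then show ?thesis using KG by (simp add: closedin_def topspace)
    qed
    ultimately show ?thesis using sHL HHL by blast
  qed
  then obtain H0 where H0: "subgroup H0 G" "H \<subseteq> H0" "x \<notin> H0"
    "\<And>K. subgroup K G \<Longrightarrow> H0 \<subseteq> K \<Longrightarrow> closedin T K" by blast
  define A where "A = {K. subgroup K G \<and> H0 \<subseteq> K \<and> x \<notin> K}"
  have "\<exists>M\<in>A. \<forall>X\<in>A. M \<subseteq> X \<longrightarrow> X = M"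
  proof (rule subset_Zorn_nonempty)
    show "A \<noteq> {}" using H0 by (auto simp: A_def)
    fix C assume C: "C \<noteq> {}" "subset.chain A C"
    then have CA: "C \<subseteq> A" and chain: "\<And>X Y. X \<in> C \<Longrightarrow> Y \<in> C \<Longrightarrow> X \<subseteq> Y \<or> Y \<subseteq> X"
      by (auto simp: subset_chain_def)
    have sub: "subgroup X G" if "X \<in> C" for X using that CA by (auto simp: A_def)
    have "subgroup (\<Union>C) G"
    proof (rule subgroupI)
      show "\<Union>C \<subseteq> carrier G" using subgroup.subset[OF sub] by blast
      show "\<Union>C \<noteq> {}" using C(1) subgroup.one_closed[OF sub] by blast
      fix a assume "a \<in> \<Union>C" then show "inv a \<in> \<Union>C" using subgroup.m_inv_closed[OF sub] by blast
    next
      fix a b assume "a \<in> \<Union>C" "b \<in> \<Union>C"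
      then obtain X Y where XY: "X \<in> C" "Y \<in> C" "a \<in> X" "b \<in> Y" by auto
      then have "a \<otimes> b \<in> X \<or> a \<otimes> b \<in> Y"
        using chain[OF XY(1,2)] subgroup.m_closed[OF sub[OF XY(1)], of a b]
          subgroup.m_closed[OF sub[OF XY(2)], of a b] XY(3,4) by blast
      then show "a \<otimes> b \<in> \<Union>C" using XY by auto
    qed
    moreover have "H0 \<subseteq> \<Union>C" using C(1) CA by (auto simp: A_def)
    moreover have "x \<notin> \<Union>C" using CA by (auto simp: A_def)
    ultimately show "\<Union>C \<in> A" by (simp add: A_def)
  qed
  then obtain M where "M \<in> A" and max: "\<And>X. X \<in> A \<Longrightarrow> M \<subseteq> X \<Longrightarrow> X = M" by blast
  then have sM: "subgroup M G" and H0M: "H0 \<subseteq> M" and xM: "x \<notin> M" by (auto simp: A_def)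
  have nM: "M \<lhd> G" using normal_above[OF sM] H0(2) H0M by auto
  interpret M: normal M G by (rule nM)
  interpret Q: group "G Mod M" by (rule M.factorgroup_is_group)
  have carQ: "carrier (G Mod M) = (\<lambda>x. M #> x) ` carrier G" by (simp add: carrier_FactGroup)
  have in_M: "M #> v = M \<longleftrightarrow> v \<in> M" if "v \<in> carrier G" for v
    using that rcoset_self_iff[OF sM] by blast
  have powM: "(M #> y) [^]\<^bsub>G Mod M\<^esub> p = M" if "y \<in> carrier G" for y
  proof -
    have "y [^] p \<in> M" using pow[OF that] H0(2) H0M by auto
    then show ?thesis using M.FactGroup_pow[of y p] that in_M[of "y [^] p"] by simp
  qed
  have gen: "\<exists>k::int. M #> y = (M #> x) [^]\<^bsub>G Mod M\<^esub> k" if y: "y \<in> carrier G" for y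
  proof (cases "y \<in> M")
    case True
    then have "M #> y = (M #> x) [^]\<^bsub>G Mod M\<^esub> (0::int)" using in_M[OF y] by simp
    then show ?thesis by blast
  next
    case False
    have yQ: "M #> y \<in> carrier (G Mod M)" and xQ: "M #> x \<in> carrier (G Mod M)"
      using carQ y x(1) by blast+
    let ?B = "generate (G Mod M) {M #> y}"
    have sB: "subgroup ?B (G Mod M)" using yQ by (intro Q.generate_is_subgroup) auto
    have UB: "\<Union>?B = {g \<in> carrier G. M #> g \<in> ?B}" by (rule M.factgroup_subgroup_union_char[OF sB])
    have sUB: "subgroup (\<Union>?B) G" by (rule M.factgroup_subgroup_union_subgroup[OF sB])
    have "M \<subseteq> \<Union>?B" using subgroup.one_closed[OF sB] by auto
    moreover have "M #> y \<in> ?B" by (rule generate.incl) simp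
    then have "y \<in> \<Union>?B" unfolding UB using y by simp
    ultimately have "x \<in> \<Union>?B"
    proof (rule_tac ccontr)
      assume y': "y \<in> \<Union>?B" and MB: "M \<subseteq> \<Union>?B" and "x \<notin> \<Union>?B"
      then have "\<Union>?B \<in> A" using sUB H0M unfolding A_def by blast
      then have "\<Union>?B = M" using MB by (rule max)
      then show False using y' False by blast
    qed
    then have "M #> x \<in> ?B" unfolding UB by simp
    then obtain k :: int where k: "M #> x = (M #> y) [^]\<^bsub>G Mod M\<^esub> k"
      unfolding Q.generate_pow[OF yQ] by blast
    have "\<not> int p dvd k"
    proof
      assume "int p dvd k"
      then have "(M #> y) [^]\<^bsub>G Mod M\<^esub> k = \<one>\<^bsub>G Mod M\<^esub>"
      proof (elim dvdE)
        fix j assume "k = int p * j"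
        then have "(M #> y) [^]\<^bsub>G Mod M\<^esub> k = ((M #> y) [^]\<^bsub>G Mod M\<^esub> int p) [^]\<^bsub>G Mod M\<^esub> j"
          by (simp only: Q.int_pow_pow[OF yQ])
        also have "(M #> y) [^]\<^bsub>G Mod M\<^esub> int p = \<one>\<^bsub>G Mod M\<^esub>"
          using powM[OF y] by (simp only: int_pow_int one_FactGroup)
        finally show ?thesis by (simp only: Q.int_pow_one)
      qed
      then have "M #> x = M" using k by (simp only: one_FactGroup)
      then show False using xM in_M[OF x(1)] by blast
    qed
    then have "coprime k (int p)"
      using prime_imp_coprime[of "int p" k] prime by (simp add: coprime_commute)
    \<comment> \<open>\<open>x\<close> is the \<open>k\<close>-th power of \<open>y\<close> modulo \<open>M\<close>, so \<open>y\<close> is the \<open>u\<close>-th power of \<open>x\<close>\<close>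
    then obtain u v where uv: "u * k + v * int p = 1"
      using bezout_int[of k "int p"] by (auto simp: coprime_iff_gcd_eq_1)
    have "k * u + int p * v = 1" using uv by (simp add: mult.commute)
    then have "M #> y = (M #> y) [^]\<^bsub>G Mod M\<^esub> (k * u + int p * v)"
      by (simp only: Q.int_pow_1[OF yQ])
    also have "\<dots> = ((M #> y) [^]\<^bsub>G Mod M\<^esub> k) [^]\<^bsub>G Mod M\<^esub> u \<otimes>\<^bsub>G Mod M\<^esub>
        ((M #> y) [^]\<^bsub>G Mod M\<^esub> int p) [^]\<^bsub>G Mod M\<^esub> v"
      by (simp only: Q.int_pow_mult[OF yQ] Q.int_pow_pow[OF yQ])
    also have "(M #> y) [^]\<^bsub>G Mod M\<^esub> int p = \<one>\<^bsub>G Mod M\<^esub>"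
      using powM[OF y] by (simp only: int_pow_int one_FactGroup)
    also have "(M #> y) [^]\<^bsub>G Mod M\<^esub> k = M #> x" using k ..
    finally have "M #> y = (M #> x) [^]\<^bsub>G Mod M\<^esub> u"
      using xQ by (simp only: Q.int_pow_one Q.r_one Q.int_pow_closed)
    then show ?thesis by blast
  qed
  have "x [^] p \<in> M" using pow[OF x(1)] H0(2) H0M by auto
  then have "\<exists>\<theta>\<in>chars (carrier G). \<theta> x = 1 \<and> {v\<in>carrier G. \<theta> v = 0} = M"
    using gen nM xM x H0(4)[OF sM H0M] topspace closedin_topspace[of T]
    by (intro char_of_cyclic_quotient) (auto simp: subgroup_self)
  moreover have "H \<subseteq> M" using H0(2) H0M by auto
  ultimately show ?thesis by blast
qed

text \<open>A continuous homomorphism is determined by its values on topological generators.\<close>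

lemma card_chars_top_finitely_generated:
  assumes "top_finitely_generated G T"
  shows "finite (chars (carrier G))"
proof -
  obtain S where S: "finite S" "S \<subseteq> carrier G" "T closure_of (generate G S) = carrier G"
    using assms by (auto simp: top_finitely_generated_def)
  have clG: "closedin T (carrier G)" using closedin_topspace[of T] topspace by simp
  have "inj_on (\<lambda>\<theta>. restrict \<theta> S) (chars (carrier G))"
  proof (rule inj_onI)
    fix \<theta> \<psi> assume h: "\<theta> \<in> chars (carrier G)" "\<psi> \<in> chars (carrier G)" "restrict \<theta> S = restrict \<psi> S"
    define \<eta> where "\<eta> = (\<lambda>x\<in>carrier G. (\<theta> x + (-1) * \<psi> x) mod int p)"
    have \<eta>: "\<eta> \<in> chars (carrier G)" unfolding \<eta>_def
      by (rule char_add_mult[OF subgroup_self clG h(1,2)])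
    let ?K = "{x \<in> carrier G. \<eta> x = 0}"
    note K = char_kernel[OF subgroup_self clG \<eta>]
    have "S \<subseteq> ?K"
    proof
      fix s assume s: "s \<in> S"
      then have "\<theta> s = \<psi> s" using fun_cong[OF h(3), of s] by simp
      then show "s \<in> ?K" using s S by (auto simp: \<eta>_def)
    qed
    then have "generate G S \<subseteq> ?K" using K(1) by (rule generate_subgroup_incl)
    then have "carrier G \<subseteq> ?K" using S(3) closure_of_minimal[OF _ K(2)] by auto
    then have "(\<theta> x + (-1) * \<psi> x) mod int p = 0" if "x \<in> carrier G" for x
      using that by (auto simp: \<eta>_def)
    then have "\<theta> x mod int p = \<psi> x mod int p" if "x \<in> carrier G" for x
      using that by (simp add: mod_eq_dvd_iff dvd_eq_mod_eq_0)
    then show "\<theta> = \<psi>"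
      using h by (intro char_ext[OF subgroup_self clG]) (auto simp: char_mod[OF subgroup_self clG])
  qed
  moreover have "(\<lambda>\<theta>. restrict \<theta> S) ` chars (carrier G) \<subseteq> S \<rightarrow>\<^sub>E {0..<int p}"
    using S(2) by (auto simp: characters_def PiE_iff subset_iff)
  moreover have "finite (S \<rightarrow>\<^sub>E {0..<int p})" using S(1) by (simp add: finite_PiE)
  ultimately show ?thesis using finite_imageD finite_subset by blast
qed

end

context p_power_index begin

text \<open>
  The last of the normal steps of index \<open>p\<close> that lead from \<open>U\<close> up to \<open>G\<close> gives a normal subgroup of index \<open>p\<close>.
\<close>

lemma char_vanishing_on_proper:
  assumes U: "fin_sub U" "U \<noteq> carrier G"
  obtains \<theta> where "\<theta> \<in> chars (carrier G)" "\<And>u. u \<in> U \<Longrightarrow> \<theta> u = 0"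
    "index G (carrier G) {x\<in>carrier G. \<theta> x = 0} = p"
proof -
  obtain m where m: "index G (carrier G) U = p ^ m" using index_power[OF U(1)] .
  have "m \<noteq> 0"
  proof
    assume "m = 0"
    then show False
      using m index_eq_1_iff[OF fin_subD(1)[OF U(1)] subgroup_self fin_sub_subset[OF U(1)]] U(2) by simp
  qed
  then obtain M where M: "fin_sub M" "U \<subseteq> M" "index G (carrier G) M = p"
    using fin_sub_of_smaller_index[OF U(1) m, of 1] by auto
  have "M \<noteq> carrier G" using M(3) index_self[OF subgroup_self] p_gt_1 by auto
  then obtain V where V: "fin_sub V" "M \<subseteq> V" "index G V M = p"
    "\<And>v u. v \<in> V \<Longrightarrow> u \<in> M \<Longrightarrow> v \<otimes> u \<otimes> inv v \<in> M"
    using fin_sub_normal_step[OF M(1)] by blast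
  have "index G (carrier G) M = index G (carrier G) V * index G V M"
    using V M by (intro index_mult) (auto simp: fin_subD subgroup_self fin_sub_subset)
  then have "index G (carrier G) V = 1" using V(3) M(3) p_pos by simp
  then have "V = carrier G"
    using index_eq_1_iff[OF fin_subD(1)[OF V(1)] subgroup_self fin_sub_subset[OF V(1)]] by simp
  then have "\<exists>\<theta>\<in>chars (carrier G). {v\<in>carrier G. \<theta> v = 0} = M"
    using V M by (intro index_p_is_kernel) (auto simp: fin_subD subgroup_self)
  then show ?thesis using that M by blast
qed

end

section \<open>The number of characters and the rank\<close>

text \<open>
  For \<open>Q = G/\<Phi>\<^sub>p(G)\<close> this is \<^const>\<open>frattini_quotient_space\<close>.
\<close>

definition vector_space_of :: "('a, 'b) monoid_scheme \<Rightarrow> (int, 'a) module" where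
  "vector_space_of Q =
     \<lparr>carrier = carrier Q, monoid.mult = monoid.mult Q, one = \<one>\<^bsub>Q\<^esub>, ring.zero = \<one>\<^bsub>Q\<^esub>, add = monoid.mult Q,
      smult = (\<lambda>c x. x [^]\<^bsub>Q\<^esub> c)\<rparr>"

lemma vector_space_of_simps [simp]:
  "carrier (vector_space_of Q) = carrier Q" "\<zero>\<^bsub>vector_space_of Q\<^esub> = \<one>\<^bsub>Q\<^esub>"
  "x \<oplus>\<^bsub>vector_space_of Q\<^esub> y = x \<otimes>\<^bsub>Q\<^esub> y" "c \<odot>\<^bsub>vector_space_of Q\<^esub> x = x [^]\<^bsub>Q\<^esub> c"
  by (simp_all add: vector_space_of_def)

lemma (in comm_group) vectorspace_if_exponent_p:
  assumes p: "prime p" and exp: "\<And>x. x \<in> carrier G \<Longrightarrow> x [^] p = \<one>"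
  shows "vectorspace (residue_ring (int p)) (vector_space_of G)"
proof -
  interpret F: residues_prime p "residue_ring (int p)" by unfold_locales (use p in auto)
  have pow_mod: "x [^] (k mod int p) = x [^] k" if x: "x \<in> carrier G" for x and k :: int
  proof -
    have "x [^] k = x [^] (int p * (k div int p) + k mod int p)" by simp
    also have "\<dots> = (x [^] int p) [^] (k div int p) \<otimes> x [^] (k mod int p)"
      by (simp only: int_pow_mult[OF x] int_pow_pow[OF x])
    also have "x [^] int p = \<one>" using exp[OF x] by (simp only: int_pow_int)
    finally show ?thesis using x by (simp add: int_pow_one)
  qed
  have "abelian_group (vector_space_of G)"
    by (rule abelian_groupI) (auto simp: m_ac intro: l_inv_ex)
  then have "module (residue_ring (int p)) (vector_space_of G)"
  proof (rule moduleI[OF F.is_cring])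
    fix a b :: int and x assume "x \<in> carrier (vector_space_of G)"
    then have x: "x \<in> carrier G" by simp
    show "a \<odot>\<^bsub>vector_space_of G\<^esub> x \<in> carrier (vector_space_of G)" using x by simp
    show "(a \<oplus>\<^bsub>residue_ring (int p)\<^esub> b) \<odot>\<^bsub>vector_space_of G\<^esub> x
        = a \<odot>\<^bsub>vector_space_of G\<^esub> x \<oplus>\<^bsub>vector_space_of G\<^esub> b \<odot>\<^bsub>vector_space_of G\<^esub> x"
      by (simp add: F.res_add_eq pow_mod[OF x] int_pow_mult[OF x])
    show "(a \<otimes>\<^bsub>residue_ring (int p)\<^esub> b) \<odot>\<^bsub>vector_space_of G\<^esub> x
        = a \<odot>\<^bsub>vector_space_of G\<^esub> (b \<odot>\<^bsub>vector_space_of G\<^esub> x)"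
      by (simp add: F.res_mult_eq pow_mod[OF x] int_pow_pow[OF x] mult.commute)
    show "\<one>\<^bsub>residue_ring (int p)\<^esub> \<odot>\<^bsub>vector_space_of G\<^esub> x = x"
      by (simp add: F.res_one_eq x)
    fix y assume "y \<in> carrier (vector_space_of G)"
    then show "a \<odot>\<^bsub>vector_space_of G\<^esub> (x \<oplus>\<^bsub>vector_space_of G\<^esub> y)
        = a \<odot>\<^bsub>vector_space_of G\<^esub> x \<oplus>\<^bsub>vector_space_of G\<^esub> a \<odot>\<^bsub>vector_space_of G\<^esub> y"
      using x by (simp add: int_pow_mult_distrib m_comm)
  qed
  then show ?thesis by (simp add: vectorspace_def F.is_field)
qed

text \<open>
  Scalars act by powers, and inverses are powers with exponent \<open>p - 1\<close>.
\<close>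

lemma (in group) submodule_iff_subgroup:
  assumes "module (residue_ring (int p)) (vector_space_of G)" "prime p"
    and exp: "\<And>x. x \<in> carrier G \<Longrightarrow> x [^] p = \<one>"
  shows "submodule (residue_ring (int p)) N (vector_space_of G) \<longleftrightarrow> subgroup N G"
proof
  assume "submodule (residue_ring (int p)) N (vector_space_of G)"
  then interpret N: submodule "residue_ring (int p)" N "vector_space_of G" .
  have NG: "N \<subseteq> carrier G" using N.subset by simp
  show "subgroup N G"
  proof (rule subgroupI[OF NG])
    show "N \<noteq> {}" using N.zero_closed by auto
    fix a assume a: "a \<in> N"
    then have aG: "a \<in> carrier G" using NG by auto
    have "int (p - 1) \<in> carrier (residue_ring (int p))"
      using prime_gt_0_nat[OF assms(2)] by (simp add: residue_ring_def)
    then have "a [^] int (p - 1) \<in> N" using N.smult_closed[of "int (p - 1)" a] a by simp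
    moreover have "a [^] (p - 1) = inv a"
    proof -
      have "a [^] (p - 1) \<otimes> a = \<one>"
        using exp[OF aG] prime_gt_0_nat[OF assms(2)] by (metis Suc_diff_1 nat_pow_Suc)
      then show ?thesis using aG inv_equality nat_pow_closed by auto
    qed
    ultimately show "inv a \<in> N" by (simp add: int_pow_int)
  next
    fix a b assume "a \<in> N" "b \<in> N"
    then show "a \<otimes> b \<in> N" using N.m_closed[of a b] by simp
  qed
next
  assume "subgroup N G"
  then show "submodule (residue_ring (int p)) N (vector_space_of G)"
    using assms(1) by (intro submodule.intro)
      (auto simp: subgroup.subset subgroup.m_closed subgroup.one_closed subgroup_int_pow_closed)
qed

context discrete_or_profinite begin

lemma subgroup_closure:
  assumes H: "subgroup H G"
  shows "subgroup (T closure_of H) G"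
proof (rule subgroupI)
  have HG: "H \<subseteq> carrier G" using H subgroup.subset by auto
  show "T closure_of H \<subseteq> carrier G" using closure_of_subset_topspace[of T H] by (simp add: topspace)
  have "H \<subseteq> T closure_of H" using HG by (intro closure_of_subset) (simp add: topspace)
  then show "T closure_of H \<noteq> {}" using subgroup_ne[OF H] by auto
  have "(\<lambda>x. inv x) ` (T closure_of H) \<subseteq> T closure_of ((\<lambda>x. inv x) ` H)"
    using continuous_inv by (rule continuous_map_image_closure_subset)
  also have "(\<lambda>x. inv x) ` H \<subseteq> H" using H by (auto simp: subgroup.m_inv_closed)
  then have "T closure_of ((\<lambda>x. inv x) ` H) \<subseteq> T closure_of H" by (rule closure_of_mono)
  finally show "inv a \<in> T closure_of H" if "a \<in> T closure_of H" for a using that by auto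
  have "continuous_map (prod_topology T T) T (\<lambda>(x, y). x \<otimes> y)"
    using top_group by (simp add: topological_group_def)
  then have "(\<lambda>(x, y). x \<otimes> y) ` (prod_topology T T closure_of (H \<times> H))
      \<subseteq> T closure_of ((\<lambda>(x, y). x \<otimes> y) ` (H \<times> H))"
    by (rule continuous_map_image_closure_subset)
  also have "(\<lambda>(x, y). x \<otimes> y) ` (H \<times> H) \<subseteq> H" using H by (auto simp: subgroup.m_closed)
  then have "T closure_of ((\<lambda>(x, y). x \<otimes> y) ` (H \<times> H)) \<subseteq> T closure_of H" by (rule closure_of_mono)
  finally have "(\<lambda>(x, y). x \<otimes> y) ` ((T closure_of H) \<times> (T closure_of H)) \<subseteq> T closure_of H"
    by (simp add: closure_of_Times)
  then show "a \<otimes> b \<in> T closure_of H" if "a \<in> T closure_of H" "b \<in> T closure_of H" for a b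
    using that by auto
qed

lemma closedin_set_mult:
  assumes "closedin T A" "closedin T B"
  shows "closedin T (A <#> B)"
  using discrete_or_profinite
proof
  assume "T = discrete_topology (carrier G)"
  then show ?thesis
    using closedin_subset_carrier[OF assms(1)] closedin_subset_carrier[OF assms(2)]
    by (simp add: setmult_subset_G)
next
  assume P: "profinite_group G T"
  then have "compactin T A" "compactin T B"
    using assms closedin_compact_space by (auto simp: profinite_group_def)
  then have "compactin (prod_topology T T) (A \<times> B)" by (simp add: compactin_Times)
  moreover have "continuous_map (prod_topology T T) T (\<lambda>(x, y). x \<otimes> y)"
    using top_group by (simp add: topological_group_def)
  ultimately have "compactin T ((\<lambda>(x, y). x \<otimes> y) ` (A \<times> B))" by (rule image_compactin)
  moreover have "(\<lambda>(x, y). x \<otimes> y) ` (A \<times> B) = A <#> B" by (auto simp: set_mult_def)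
  ultimately show ?thesis using P compactin_imp_closedin by (auto simp: profinite_group_def)
qed

end

context discrete_or_profinite_mod begin

abbreviation frattini :: "'a set" where "frattini \<equiv> frattini_p p G T"

lemma closedin_carrier: "closedin T (carrier G)"
  using closedin_topspace[of T] topspace by simp

lemma frattini_properties:
  shows "subgroup frattini G" and "closedin T frattini"
    and "\<And>a b. a \<in> carrier G \<Longrightarrow> b \<in> carrier G \<Longrightarrow> a \<otimes> b \<otimes> inv a \<otimes> inv b \<in> frattini"
    and "\<And>a. a \<in> carrier G \<Longrightarrow> a [^] p \<in> frattini"
proof -
  let ?D = "derived G (carrier G)" and ?P = "generate G ((\<lambda>x. x [^] p) ` carrier G)"
  let ?A = "T closure_of ?D" and ?B = "T closure_of ?P"
  have frat: "frattini = ?A <#> ?B" by (simp add: frattini_p_def)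
  have D: "subgroup ?D G" by (rule derived_is_subgroup) simp
  have P: "subgroup ?P G" by (rule generate_is_subgroup) auto
  note sA = subgroup_closure[OF D] and sB = subgroup_closure[OF P]
  have DA: "?D \<subseteq> ?A" using subgroup.subset[OF D] by (intro closure_of_subset) (simp add: topspace)
  have PB: "?P \<subseteq> ?B" using subgroup.subset[OF P] by (intro closure_of_subset) (simp add: topspace)
  have comm: "a \<otimes> b \<otimes> inv a \<otimes> inv b \<in> ?A" if "a \<in> carrier G" "b \<in> carrier G" for a b
  proof -
    have "a \<otimes> b \<otimes> inv a \<otimes> inv b \<in> ?D"
      unfolding derived_def by (rule generate.incl) (use that in blast)
    then show ?thesis using DA by blast
  qed
  have nA: "?A \<lhd> G" using sA comm by (rule normal_if_commutators)
  show sF: "subgroup frattini G" unfolding frat by (rule mult_norm_subgroup[OF nA sB])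
  show "closedin T frattini" unfolding frat by (intro closedin_set_mult) simp_all
  show "a \<otimes> b \<otimes> inv a \<otimes> inv b \<in> frattini" if ab: "a \<in> carrier G" "b \<in> carrier G" for a b
  proof -
    have "(a \<otimes> b \<otimes> inv a \<otimes> inv b) \<otimes> \<one> \<in> frattini" unfolding frat set_mult_def
      using comm[OF ab] subgroup.one_closed[OF sB] by blast
    then show ?thesis using ab by simp
  qed
  show "a [^] p \<in> frattini" if a: "a \<in> carrier G" for a
  proof -
    have "a [^] p \<in> ?P" by (rule generate.incl) (use a in blast)
    then have "\<one> \<otimes> a [^] p \<in> frattini" unfolding frat set_mult_def
      using PB subgroup.one_closed[OF sA] by blast
    then show ?thesis using a by simp
  qed
qed

text \<open>
  The kernel of a character is a closed subgroup that contains all commutators and \<open>p\<close>-th powers.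
\<close>

lemma frattini_subset_kernel:
  assumes \<theta>: "\<theta> \<in> chars (carrier G)"
  shows "frattini \<subseteq> {x \<in> carrier G. \<theta> x = 0}"
proof -
  let ?K = "{x \<in> carrier G. \<theta> x = 0}"
  note K = char_kernel[OF subgroup_self closedin_carrier \<theta>]
  note mult = char_mult[OF subgroup_self closedin_carrier \<theta>]
  note eq_iff = char_eq_iff[OF subgroup_self closedin_carrier \<theta>]
  have "a \<otimes> b \<otimes> inv a \<otimes> inv b \<in> ?K" if ab: "a \<in> carrier G" "b \<in> carrier G" for a b
  proof -
    have "\<theta> (a \<otimes> b) = \<theta> (b \<otimes> a)" using mult ab by (simp add: add.commute)
    then have "\<theta> (a \<otimes> b \<otimes> inv (b \<otimes> a)) = 0" using eq_iff[of "a \<otimes> b" "b \<otimes> a"] ab by simp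
    then show ?thesis using ab by (simp add: inv_mult_group m_assoc)
  qed
  then have "generate G (derived_set G (carrier G)) \<subseteq> ?K"
    by (intro generate_subgroup_incl K(1)) blast
  then have A: "T closure_of (derived G (carrier G)) \<subseteq> ?K"
    unfolding derived_def by (rule closure_of_minimal[OF _ K(2)])
  have "a [^] p \<in> ?K" if a: "a \<in> carrier G" for a
    using char_pow[OF subgroup_self closedin_carrier \<theta> a, of p] by simp
  then have "generate G ((\<lambda>x. x [^] p) ` carrier G) \<subseteq> ?K"
    by (intro generate_subgroup_incl K(1)) blast
  then have B: "T closure_of (generate G ((\<lambda>x. x [^] p) ` carrier G)) \<subseteq> ?K"
    by (rule closure_of_minimal[OF _ K(2)])
  show ?thesis
    unfolding frattini_p_def set_mult_def
    using A B subgroup.m_closed[OF K(1)] by blast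
qed

text \<open>
  Duality of finite \<open>\<F>\<^sub>p\<close>-vector spaces: \<open>char_separating\<close> provides the basis dual to a basis
  of \<open>G/\<Phi>(G)\<close>.
\<close>

theorem card_chars_eq_power_d_p:
  assumes fin: "finite (chars (carrier G))"
  shows "card (chars (carrier G)) = p ^ d_p p G T"
proof -
  note self = subgroup_self closedin_carrier
  note \<Phi> = frattini_properties
  define \<Phi>' where "\<Phi>' = frattini"
  have s\<Phi>: "subgroup \<Phi>' G" and cl\<Phi>: "closedin T \<Phi>'"
    and comm: "\<And>a b. a \<in> carrier G \<Longrightarrow> b \<in> carrier G \<Longrightarrow> a \<otimes> b \<otimes> inv a \<otimes> inv b \<in> \<Phi>'"
    and pow: "\<And>a. a \<in> carrier G \<Longrightarrow> a [^] p \<in> \<Phi>'"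
    using \<Phi> by (simp_all add: \<Phi>'_def)
  have n\<Phi>: "\<Phi>' \<lhd> G" using s\<Phi> comm by (rule normal_if_commutators)
  interpret N: normal \<Phi>' G by (rule n\<Phi>)
  define Q where "Q = G Mod \<Phi>'"
  have grpQ: "group Q" unfolding Q_def by (rule N.factorgroup_is_group)
  interpret Q: group Q by (rule grpQ)
  \<comment> \<open>the projection to \<open>G/\<Phi>\<^sub>p(G)\<close>\<close>
  define c where "c x = \<Phi>' #> x" for x
  have carQ: "carrier Q = c ` carrier G" by (simp add: Q_def c_def carrier_FactGroup)
  have c_eq: "c x = c y \<longleftrightarrow> x \<otimes> inv y \<in> \<Phi>'" if "x \<in> carrier G" "y \<in> carrier G" for x y
    unfolding c_def using that by (rule rcoset_eq_iff[OF s\<Phi>])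
  have c_mult: "c (x \<otimes> y) = c x \<otimes>\<^bsub>Q\<^esub> c y" if "x \<in> carrier G" "y \<in> carrier G" for x y
    using N.rcos_sum[OF that] by (simp add: c_def Q_def)
  have c_in: "c x \<in> carrier Q" if "x \<in> carrier G" for x using carQ that by blast
  have c_one: "c x = \<one>\<^bsub>Q\<^esub> \<longleftrightarrow> x \<in> \<Phi>'" if "x \<in> carrier G" for x
    using rcoset_self_iff[OF s\<Phi> that] by (simp add: c_def Q_def)
  have c_pow: "c x [^]\<^bsub>Q\<^esub> p = \<one>\<^bsub>Q\<^esub>" if "x \<in> carrier G" for x
  proof -
    have "c x [^]\<^bsub>Q\<^esub> p = c (x [^] p)" using N.FactGroup_pow[OF that, of p] by (simp add: c_def Q_def)
    also have "\<dots> = \<one>\<^bsub>Q\<^esub>" using c_one[of "x [^] p"] pow[OF that] that by simp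
    finally show ?thesis .
  qed
  have "comm_group Q"
  proof (rule Q.group_comm_groupI)
    fix C D assume "C \<in> carrier Q" "D \<in> carrier Q"
    then obtain x y where xy: "x \<in> carrier G" "y \<in> carrier G" "C = c x" "D = c y" unfolding carQ by blast
    have "x \<otimes> y \<otimes> inv (y \<otimes> x) \<in> \<Phi>'" using comm[OF xy(1,2)] xy by (simp add: inv_mult_group m_assoc)
    then have "c (x \<otimes> y) = c (y \<otimes> x)" using c_eq xy by simp
    then show "C \<otimes>\<^bsub>Q\<^esub> D = D \<otimes>\<^bsub>Q\<^esub> C" using xy c_mult by simp
  qed
  then interpret Q: comm_group Q .
  have expQ: "C [^]\<^bsub>Q\<^esub> p = \<one>\<^bsub>Q\<^esub>" if "C \<in> carrier Q" for C
    using that c_pow unfolding carQ by blast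
  define V where "V = vector_space_of Q"
  have V_eq: "V = frattini_quotient_space p G T"
    by (simp add: V_def vector_space_of_def frattini_quotient_space_def Q_def \<Phi>'_def Let_def)
  define K where "K = residue_ring (int p)"
  have vs: "vectorspace K V" unfolding K_def V_def
    using prime expQ by (rule Q.vectorspace_if_exponent_p)
  interpret V: vectorspace K V by (rule vs)
  have submod: "submodule K S V \<longleftrightarrow> subgroup S Q" for S
    unfolding K_def V_def using expQ prime V.module_axioms
    by (intro Q.submodule_iff_subgroup) (auto simp: K_def V_def)
  have carV: "carrier V = carrier Q" by (simp add: V_def)
  have char_c: "\<theta> x = \<theta> y" if "\<theta> \<in> chars (carrier G)" "x \<in> carrier G" "y \<in> carrier G" "c x = c y" for \<theta> x y
  proof -
    have "x \<otimes> inv y \<in> \<Phi>'" using that c_eq by blast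
    then have "\<theta> (x \<otimes> inv y) = 0" using frattini_subset_kernel[OF that(1)] by (auto simp: \<Phi>'_def)
    then show ?thesis using char_eq_iff[OF self that(1-3)] by simp
  qed
  \<comment> \<open>The characters separate the points of \<open>G/\<Phi>\<^sub>p(G)\<close>; as there are finitely many, this quotient is finite.\<close>
  have index: "index G (carrier G) \<Phi>' = card ((\<lambda>x. \<lambda>\<theta>\<in>chars (carrier G). \<theta> x) ` carrier G)"
  proof (rule index_eq_card_image[OF s\<Phi> subset_refl])
    fix x y assume xy: "x \<in> carrier G" "y \<in> carrier G"
    show "(\<lambda>\<theta>\<in>chars (carrier G). \<theta> x) = (\<lambda>\<theta>\<in>chars (carrier G). \<theta> y) \<longleftrightarrow> x \<otimes> inv y \<in> \<Phi>'"
    proof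
      assume eq: "(\<lambda>\<theta>\<in>chars (carrier G). \<theta> x) = (\<lambda>\<theta>\<in>chars (carrier G). \<theta> y)"
      show "x \<otimes> inv y \<in> \<Phi>'"
      proof (rule ccontr)
        assume n: "x \<otimes> inv y \<notin> \<Phi>'"
        have "x \<otimes> inv y \<in> carrier G" using xy by simp
        then obtain \<theta> where \<theta>: "\<theta> \<in> chars (carrier G)" "\<theta> (x \<otimes> inv y) = 1"
          using char_separating[OF s\<Phi> cl\<Phi> _ n comm pow] by blast
        have "\<theta> x = \<theta> y" using fun_cong[OF eq, of \<theta>] \<theta> by simp
        then show False using char_eq_iff[OF self \<theta>(1) xy] \<theta>(2) by simp
      qed
    next
      assume "x \<otimes> inv y \<in> \<Phi>'"
      then have "c x = c y" using c_eq xy by simp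
      then show "(\<lambda>\<theta>\<in>chars (carrier G). \<theta> x) = (\<lambda>\<theta>\<in>chars (carrier G). \<theta> y)"
        using char_c xy by (intro restrict_ext) blast
    qed
  qed
  have "(\<lambda>\<theta>\<in>chars (carrier G). \<theta> x) \<in> chars (carrier G) \<rightarrow>\<^sub>E {0..<int p}" if "x \<in> carrier G" for x
    using char_range[OF self _ that] by (intro restrict_PiE_iff[THEN iffD2] ballI) auto
  then have "finite ((\<lambda>x. \<lambda>\<theta>\<in>chars (carrier G). \<theta> x) ` carrier G)"
    by (intro finite_subset[OF image_subsetI finite_PiE[OF fin, of "\<lambda>_. {0..<int p}"]]) auto
  then have index_pos: "0 < index G (carrier G) \<Phi>'"
    using index subgroup_ne[OF subgroup_self] by (simp add: card_gt_0_iff)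
  then have finQ: "finite (carrier Q)"
    using index_pos_iff[OF subgroup_ne[OF subgroup_self], of \<Phi>'] by (simp add: carQ c_def)
  have "V.fin_dim" unfolding V.fin_dim_def
  proof (intro exI[of _ "carrier V"] conjI)
    show "finite (carrier V)" using finQ carV by simp
    show "V.gen_set (carrier V)"
      using V.in_own_span[OF subset_refl] V.span_is_subset2[OF subset_refl] by (rule equalityI[rotated])
  qed simp
  then obtain \<beta> where \<beta>: "finite \<beta>" "V.basis \<beta>" using V.finite_basis_exists by blast
  have li: "V.lin_indpt \<beta>" and gen: "V.gen_set \<beta>" and \<beta>V: "\<beta> \<subseteq> carrier V"
    using \<beta>(2) unfolding V.basis_def by blast+
  have dim: "d_p p G T = card \<beta>"
    unfolding d_p_def using V.dim_basis[OF \<beta>] by (simp add: V_eq K_def)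
  define rep where "rep C = (SOME x. x \<in> carrier G \<and> c x = C)" for C
  have rep: "rep C \<in> carrier G \<and> c (rep C) = C" if "C \<in> \<beta>" for C
  proof -
    have "C \<in> c ` carrier G" using subsetD[OF \<beta>V that] by (simp only: carV carQ)
    then have "\<exists>x. x \<in> carrier G \<and> c x = C" by auto
    then show ?thesis unfolding rep_def by (rule someI_ex)
  qed
  \<comment> \<open>\<open>\<Theta>\<close> evaluates a character on a basis of \<open>G/\<Phi>\<^sub>p(G)\<close>. It is injective since kernels are subspaces, and onto since the
     basis has a dual basis.\<close>
  define \<Theta> where "\<Theta> \<theta> = (\<lambda>C\<in>\<beta>. \<theta> (rep C))" for \<theta> :: "'a \<Rightarrow> int"
  have inj: "inj_on \<Theta> (chars (carrier G))"
  proof (rule inj_onI)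
    fix \<theta> \<psi> assume h: "\<theta> \<in> chars (carrier G)" "\<psi> \<in> chars (carrier G)" "\<Theta> \<theta> = \<Theta> \<psi>"
    define \<eta> where "\<eta> = (\<lambda>x\<in>carrier G. (\<theta> x + (-1) * \<psi> x) mod int p)"
    have \<eta>: "\<eta> \<in> chars (carrier G)" unfolding \<eta>_def by (rule char_add_mult[OF self h(1,2)])
    let ?K = "{x \<in> carrier G. \<eta> x = 0}"
    have "group_hom G Q c"
      using c_mult c_in by (intro group_hom.intro group_hom_axioms.intro is_group grpQ) (simp add: hom_def)
    then have "subgroup (c ` ?K) Q"
      by (rule group_hom.subgroup_img_is_subgroup) (rule char_kernel(1)[OF self \<eta>])
    then have "submodule K (c ` ?K) V" using submod by blast
    moreover have "\<beta> \<subseteq> c ` ?K"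
    proof
      fix C assume C: "C \<in> \<beta>"
      have "\<theta> (rep C) = \<psi> (rep C)" using fun_cong[OF h(3), of C] C by (simp add: \<Theta>_def)
      then have "rep C \<in> ?K" using rep[OF C] by (simp add: \<eta>_def)
      then show "C \<in> c ` ?K" using rep[OF C] by force
    qed
    ultimately have "V.span \<beta> \<subseteq> c ` ?K" by (rule V.span_is_subset[rotated])
    then have span: "carrier Q \<subseteq> c ` ?K" by (simp only: gen carV)
    show "\<theta> = \<psi>"
    proof (rule char_ext[OF self h(1,2)])
      fix x assume x: "x \<in> carrier G"
      obtain y where y: "y \<in> ?K" "c x = c y" using subsetD[OF span c_in[OF x]] by (elim imageE)
      then have "\<eta> x = 0" using char_c[OF \<eta> x, of y] by simp
      then have "\<theta> x mod int p = \<psi> x mod int p" using x by (simp add: \<eta>_def mod_eq_dvd_iff dvd_eq_mod_eq_0)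
      then show "\<theta> x = \<psi> x" using h x by (simp add: char_mod[OF self])
    qed
  qed
  have "\<exists>\<theta>. \<theta> \<in> chars (carrier G) \<and> \<theta> (rep b) = 1 \<and> (\<forall>b'\<in>\<beta> - {b}. \<theta> (rep b') = 0)" if b: "b \<in> \<beta>" for b
  proof -
    define S where "S = V.span (\<beta> - {b})"
    have sub: "\<beta> - {b} \<subseteq> carrier V" using \<beta>V by blast
    have "V.lin_indpt (\<beta> - {b})" using V.subset_li_is_li[OF li] by blast
    then have "b \<in> S \<longleftrightarrow> V.lin_dep ((\<beta> - {b}) \<union> {b})"
      unfolding S_def using sub b \<beta>V by (intro V.lin_dep_iff_in_span) auto
    moreover have "(\<beta> - {b}) \<union> {b} = \<beta>" using b by blast
    ultimately have bS: "b \<notin> S" using li by simp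
    have "submodule K S V" unfolding S_def by (rule V.span_is_submodule[OF sub])
    then have sS: "subgroup S Q" using submod by blast
    have UB: "\<Union>S = {x \<in> carrier G. c x \<in> S}"
      using N.factgroup_subgroup_union_char[of S] sS by (simp add: Q_def c_def)
    have sUB: "subgroup (\<Union>S) G"
      using N.factgroup_subgroup_union_subgroup[of S] sS by (simp add: Q_def)
    have "\<Phi>' \<in> S" using subgroup.one_closed[OF sS] by (simp add: Q_def)
    then have \<Phi>S: "\<Phi>' \<subseteq> \<Union>S" by blast
    have clS: "closedin T (\<Union>S)"
      using index_mono_pos(2)[OF s\<Phi> sUB \<Phi>S index_pos] by (rule closed_supergroup[OF s\<Phi> cl\<Phi> sUB \<Phi>S])
    have nb: "rep b \<notin> \<Union>S" using rep[OF b] bS by (simp only: UB mem_Collect_eq simp_thms)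
    have "\<exists>\<theta>\<in>chars (carrier G). \<theta> (rep b) = 1 \<and> (\<forall>h\<in>\<Union>S. \<theta> h = 0)"
      by (rule char_separating[OF sUB clS conjunct1[OF rep[OF b]] nb])
        (erule (1) subsetD[OF \<Phi>S comm], erule subsetD[OF \<Phi>S pow])
    then obtain \<theta> where \<theta>: "\<theta> \<in> chars (carrier G)" "\<theta> (rep b) = 1" "\<forall>h\<in>\<Union>S. \<theta> h = 0"
      by (elim bexE conjE)
    have "rep b' \<in> \<Union>S" if b': "b' \<in> \<beta> - {b}" for b'
    proof -
      have "b' \<in> S" using V.in_own_span[OF sub] b' unfolding S_def by blast
      then show ?thesis using rep[of b'] b' by (simp only: UB mem_Collect_eq Diff_iff simp_thms)
    qed
    then show ?thesis using \<theta> by (intro exI[of _ \<theta>] conjI ballI) auto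
  qed
  note ex_dual = this
  define dual where "dual b = (SOME \<theta>. \<theta> \<in> chars (carrier G) \<and> \<theta> (rep b) = 1 \<and>
    (\<forall>b'\<in>\<beta> - {b}. \<theta> (rep b') = 0))" for b
  have dual_all: "dual b \<in> chars (carrier G) \<and> dual b (rep b) = 1 \<and>
      (\<forall>b'\<in>\<beta> - {b}. dual b (rep b') = 0)" if "b \<in> \<beta>" for b
    unfolding dual_def using ex_dual[OF that] by (rule someI_ex)
  then have dual: "\<And>b. b \<in> \<beta> \<Longrightarrow> dual b \<in> chars (carrier G)"
    "\<And>b. b \<in> \<beta> \<Longrightarrow> dual b (rep b) = 1"
    "\<And>b b'. b \<in> \<beta> \<Longrightarrow> b' \<in> \<beta> \<Longrightarrow> b' \<noteq> b \<Longrightarrow> dual b (rep b') = 0" by auto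
  have "\<Theta> ` chars (carrier G) = \<beta> \<rightarrow>\<^sub>E {0..<int p}"
  proof (intro equalityI subsetI)
    fix f assume "f \<in> \<Theta> ` chars (carrier G)"
    then obtain \<theta> where \<theta>: "\<theta> \<in> chars (carrier G)" "f = \<Theta> \<theta>" by (elim imageE)
    have "\<theta> (rep C) \<in> {0..<int p}" if "C \<in> \<beta>" for C
      using char_range[OF self \<theta>(1)] rep[OF that] by simp
    then show "f \<in> \<beta> \<rightarrow>\<^sub>E {0..<int p}" by (simp add: \<Theta>_def \<theta>(2))
  next
    fix f assume f: "f \<in> \<beta> \<rightarrow>\<^sub>E {0..<int p}"
    define \<theta> where "\<theta> = (\<lambda>x\<in>carrier G. (\<Sum>b\<in>\<beta>. f b * dual b x) mod int p)"
    have \<theta>: "\<theta> \<in> chars (carrier G)" unfolding \<theta>_def by (rule char_lincomb[OF self \<beta>(1) dual(1)])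
    have "\<theta> (rep b) = f b" if b: "b \<in> \<beta>" for b
    proof -
      have "(\<Sum>b'\<in>\<beta>. f b' * dual b' (rep b)) = (\<Sum>b'\<in>\<beta>. if b' = b then f b' else 0)"
        using dual(2,3) b by (intro sum.cong) auto
      also have "\<dots> = f b" using b \<beta>(1) by simp
      finally have "\<theta> (rep b) = f b mod int p" using rep[OF b] by (simp add: \<theta>_def)
      then show ?thesis using PiE_mem[OF f b] by simp
    qed
    then have "\<Theta> \<theta> = f" using f by (auto simp: \<Theta>_def PiE_iff extensional_def)
    then show "f \<in> \<Theta> ` chars (carrier G)" using \<theta> by blast
  qed
  then have "card (chars (carrier G)) = card (\<beta> \<rightarrow>\<^sub>E {0..<int p})" using card_image[OF inj] by simp
  also have "\<dots> = p ^ card \<beta>" using \<beta>(1) by (simp add: card_PiE)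
  finally show ?thesis using dim by simp
qed

text \<open>This makes \<open>card_chars_eq_power_d_p\<close>, which is about the whole group, available for closed subgroups.\<close>

lemma closed_subgroup_discrete_or_profinite:
  assumes U: "subgroup U G" "closedin T U"
  shows "discrete_or_profinite_mod (G\<lparr>carrier := U\<rparr>) (subtopology T U) p"
proof -
  let ?G = "G\<lparr>carrier := U\<rparr>" and ?T = "subtopology T U"
  have UG: "U \<subseteq> carrier G" using U subgroup.subset by auto
  have grp: "group ?G" using U(1) by (rule subgroup_imp_group)
  have top: "topspace ?T = U" using UG by (auto simp: topspace)
  have tg: "topological_group ?G ?T"
    unfolding topological_group_def
  proof (intro conjI grp)
    show "topspace ?T = carrier ?G" using top by simp
    have "continuous_map (prod_topology T T) T (\<lambda>(x, y). x \<otimes> y)"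
      using top_group by (simp add: topological_group_def)
    then have "continuous_map (subtopology (prod_topology T T) (U \<times> U)) T (\<lambda>(x, y). x \<otimes> y)"
      by (rule continuous_map_from_subtopology)
    then have "continuous_map (prod_topology ?T ?T) T (\<lambda>(x, y). x \<otimes> y)"
      by (simp only: subtopology_Times)
    moreover have "(\<lambda>(x, y). x \<otimes> y) \<in> topspace (prod_topology ?T ?T) \<rightarrow> U"
      unfolding topspace_prod_topology top using subgroup.m_closed[OF U(1)] by fast
    ultimately show "continuous_map (prod_topology ?T ?T) ?T (\<lambda>(x, y). x \<otimes>\<^bsub>?G\<^esub> y)"
      by (simp add: continuous_map_in_subtopology)
    have "continuous_map ?T T (\<lambda>x. inv x)" using continuous_inv by (rule continuous_map_from_subtopology)
    moreover have "(\<lambda>x. inv x) \<in> topspace ?T \<rightarrow> U"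
      unfolding top using subgroup.m_inv_closed[OF U(1)] by fast
    ultimately have "continuous_map ?T ?T (\<lambda>x. inv x)"
      by (simp add: continuous_map_in_subtopology)
    then show "continuous_map ?T ?T (\<lambda>x. inv\<^bsub>?G\<^esub> x)"
      by (rule continuous_map_eq) (use U(1) top in \<open>simp add: m_inv_consistent\<close>)
  qed
  have "?T = discrete_topology (carrier ?G) \<or> profinite_group ?G ?T"
    using discrete_or_profinite
  proof
    assume "T = discrete_topology (carrier G)"
    then show ?thesis using UG by (simp add: subtopology_discrete_topology Int_absorb1)
  next
    assume P: "profinite_group G T"
    have "compactin T U" using P U(2) closedin_compact_space by (auto simp: profinite_group_def)
    then have "compact_space ?T" by (rule compact_space_subtopology)
    moreover have "Hausdorff_space ?T" using P by (simp add: profinite_group_def Hausdorff_space_subtopology)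
    moreover have "\<exists>H. subgroup H ?G \<and> openin ?T H \<and> H \<subseteq> W" if W: "openin ?T W" "\<one> \<in> W" for W
    proof -
      obtain W' where W': "openin T W'" "W = W' \<inter> U" using W(1) by (auto simp: openin_subtopology)
      have "\<forall>W. openin T W \<and> \<one> \<in> W \<longrightarrow> (\<exists>L. subgroup L G \<and> openin T L \<and> L \<subseteq> W)"
        using P unfolding profinite_group_def by (elim conjE)
      moreover have "openin T W' \<and> \<one> \<in> W'" using W' W(2) by simp
      ultimately have "\<exists>L. subgroup L G \<and> openin T L \<and> L \<subseteq> W'" by (elim allE[of _ W'] mp)
      then obtain H where H: "subgroup H G" "openin T H" "H \<subseteq> W'" by (elim exE conjE)
      have "subgroup (H \<inter> U) ?G"
        using H U by (intro subgroup_incl) (auto simp: subgroups_Inter_pair)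
      moreover have "openin ?T (H \<inter> U)" using H(2) by (auto simp: openin_subtopology)
      ultimately show ?thesis using H(3) W'(2) by blast
    qed
    ultimately show ?thesis using tg by (simp add: profinite_group_def)
  qed
  then show ?thesis using tg grp prime
    by (simp add: discrete_or_profinite_mod_def discrete_or_profinite_mod_axioms_def
        discrete_or_profinite_def discrete_or_profinite_axioms_def)
qed

lemma card_chars_eq_power_d_p_sub:
  assumes U: "subgroup U G" "closedin T U" and fin: "finite (chars U)"
  shows "card (chars U) = p ^ d_p_sub p G T U"
proof -
  interpret U: discrete_or_profinite_mod "G\<lparr>carrier := U\<rparr>" "subtopology T U" p
    by (rule closed_subgroup_discrete_or_profinite[OF U])
  have "closedin (subtopology T U) {x \<in> U. \<theta> x = 0} \<longleftrightarrow> closedin T {x \<in> U. \<theta> x = 0}" for \<theta> :: "'a \<Rightarrow> int"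
    using closedin_closed_subtopology[OF U(2)] by simp
  then have "U.chars (carrier (G\<lparr>carrier := U\<rparr>)) = chars U" by (simp add: characters_def)
  then show ?thesis using U.card_chars_eq_power_d_p fin by (simp add: d_p_sub_def)
qed

end

section \<open>Direct powers of \<open>G\<close> inside \<open>G\<close>\<close>

lemma (in discrete_or_profinite) closedin_one: "closedin T {\<one>}"
  using discrete_or_profinite
proof
  assume "profinite_group G T"
  then have "Hausdorff_space T" by (simp add: profinite_group_def)
  then show ?thesis by (rule closedin_Hausdorff_singleton) (simp add: topspace)
qed simp

text \<open>
  The maps \<open>\<pi> i\<close> are the coordinates of an isomorphism of the open subgroup \<open>N\<close> with a direct power of \<open>G\<close>
  whose factors are indexed by \<open>I\<close>.
\<close>

locale power_coordinates = p_power_index +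
  fixes N :: "'a set" and I :: "'i set" and \<pi> :: "'i \<Rightarrow> 'a \<Rightarrow> 'a"
  assumes fin_sub_N: "fin_sub N" and finite_I: "finite I"
    and coord_mult: "i \<in> I \<Longrightarrow> x \<in> N \<Longrightarrow> y \<in> N \<Longrightarrow> \<pi> i (x \<otimes> y) = \<pi> i x \<otimes> \<pi> i y"
    and coord_continuous: "i \<in> I \<Longrightarrow> continuous_map (subtopology T N) T (\<pi> i)"
    and coord_bij: "bij_betw (\<lambda>x. \<lambda>i\<in>I. \<pi> i x) N (I \<rightarrow>\<^sub>E carrier G)"
begin

lemma N_subset: "N \<subseteq> carrier G" and sub_N: "subgroup N G" and closed_N: "closedin T N"
  using fin_sub_subset[OF fin_sub_N] fin_subD[OF fin_sub_N] by auto

lemma coord_closed: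
  assumes "i \<in> I" "x \<in> N" shows "\<pi> i x \<in> carrier G"
proof -
  have "(\<lambda>i\<in>I. \<pi> i x) \<in> I \<rightarrow>\<^sub>E carrier G" using coord_bij assms(2) by (rule bij_betwE[rule_format])
  then show ?thesis using PiE_mem[of _ I "\<lambda>_. carrier G" i] assms(1) by fastforce
qed

lemma coord_inj:
  assumes "x \<in> N" "y \<in> N" "\<And>i. i \<in> I \<Longrightarrow> \<pi> i x = \<pi> i y" shows "x = y"
proof -
  have "(\<lambda>i\<in>I. \<pi> i x) = (\<lambda>i\<in>I. \<pi> i y)" using assms(3) by (rule restrict_ext)
  then show ?thesis using bij_betw_imp_inj_on[OF coord_bij] assms(1,2) by (auto dest: inj_onD)
qed

lemma coord_surj:
  assumes "\<forall>i\<in>I. g i \<in> carrier G"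
  shows "\<exists>x\<in>N. \<forall>i\<in>I. \<pi> i x = g i"
proof -
  have "(\<lambda>i\<in>I. g i) \<in> (\<lambda>x. \<lambda>i\<in>I. \<pi> i x) ` N"
    unfolding bij_betw_imp_surj_on[OF coord_bij] using assms by (simp add: restrict_PiE_iff)
  then obtain x where x: "x \<in> N" "(\<lambda>i\<in>I. g i) = (\<lambda>i\<in>I. \<pi> i x)" by (elim imageE)
  have "\<pi> i x = g i" if "i \<in> I" for i using fun_cong[OF x(2), of i] that by simp
  then show ?thesis using x(1) by blast
qed

lemma coord_hom: "i \<in> I \<Longrightarrow> \<pi> i \<in> hom (G\<lparr>carrier := N\<rparr>) G"
  by (simp add: hom_def coord_closed coord_mult)

lemma coord_group_hom: "i \<in> I \<Longrightarrow> group_hom (G\<lparr>carrier := N\<rparr>) G (\<pi> i)"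
  by (simp add: group_hom_def group_hom_axioms_def coord_hom subgroup_imp_group[OF sub_N])

lemma coord_one: "i \<in> I \<Longrightarrow> \<pi> i \<one> = \<one>"
  using group_hom.hom_one[OF coord_group_hom] by simp

lemma coord_inv: "i \<in> I \<Longrightarrow> x \<in> N \<Longrightarrow> \<pi> i (inv x) = inv (\<pi> i x)"
  using group_hom.hom_inv[OF coord_group_hom, of i x] m_inv_consistent[OF sub_N] by simp

definition product_sub :: "('i \<Rightarrow> 'a set) \<Rightarrow> 'a set" where
  "product_sub U = {x \<in> N. \<forall>i\<in>I. \<pi> i x \<in> U i}"

lemma product_sub_carrier: "product_sub (\<lambda>_. carrier G) = N"
  by (auto simp: product_sub_def coord_closed)

text \<open>
  A coset of \<open>\<Prod>U\<^sub>i\<close> in \<open>N\<close> is a family of cosets of the \<open>U\<^sub>i\<close>.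
\<close>

lemma product_sub:
  assumes U: "\<And>i. i \<in> I \<Longrightarrow> fin_sub (U i)"
  shows "fin_sub (product_sub U)"
    and "index G (carrier G) (product_sub U) = index G (carrier G) N * (\<Prod>i\<in>I. index G (carrier G) (U i))"
proof -
  let ?P = "product_sub U"
  have PN: "?P \<subseteq> N" by (auto simp: product_sub_def)
  have sP: "subgroup ?P G"
  proof (rule subgroupI)
    show "?P \<subseteq> carrier G" using PN N_subset by blast
    have "\<one> \<in> ?P"
      using subgroup.one_closed[OF sub_N] subgroup.one_closed[OF fin_subD(1)[OF U]]
      by (simp add: product_sub_def coord_one)
    then show "?P \<noteq> {}" by blast
    fix a assume "a \<in> ?P"
    then show "inv a \<in> ?P"
      using subgroup.m_inv_closed[OF sub_N] subgroup.m_inv_closed[OF fin_subD(1)[OF U]]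
      by (simp add: product_sub_def coord_inv)
  next
    fix a b assume "a \<in> ?P" "b \<in> ?P"
    then show "a \<otimes> b \<in> ?P"
      using subgroup.m_closed[OF sub_N] subgroup.m_closed[OF fin_subD(1)[OF U]]
      by (simp add: product_sub_def coord_mult)
  qed
  have clP: "closedin T ?P"
  proof (cases "I = {}")
    case True
    then have "?P = N" unfolding product_sub_def by blast
    then show ?thesis using closed_N by (simp only:)
  next
    case False
    have "closedin T (\<Inter>i\<in>I. {x \<in> N. \<pi> i x \<in> U i})"
      using False coord_continuous closed_N fin_subD(2)[OF U]
      by (intro closedin_INT closedin_preimage_sub[where T' = T]) auto
    also have "(\<Inter>i\<in>I. {x \<in> N. \<pi> i x \<in> U i}) = ?P" using False by (auto simp: product_sub_def)
    finally show ?thesis .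
  qed
  define g where "g x = (\<lambda>i\<in>I. U i #> \<pi> i x)" for x
  have g_eq: "g x = g y \<longleftrightarrow> x \<otimes> inv y \<in> ?P" if xy: "x \<in> N" "y \<in> N" for x y
  proof -
    have xy': "inv y \<in> N" "x \<otimes> inv y \<in> N"
      using xy sub_N by (auto simp: subgroup.m_inv_closed subgroup.m_closed)
    have "g x = g y \<longleftrightarrow> (\<forall>i\<in>I. U i #> \<pi> i x = U i #> \<pi> i y)"
      unfolding g_def by (rule restrict_eq_iff)
    also have "\<dots> \<longleftrightarrow> (\<forall>i\<in>I. \<pi> i (x \<otimes> inv y) \<in> U i)"
    proof (intro ball_cong refl)
      fix i assume i: "i \<in> I"
      show "U i #> \<pi> i x = U i #> \<pi> i y \<longleftrightarrow> \<pi> i (x \<otimes> inv y) \<in> U i"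
        using rcoset_eq_iff[OF fin_subD(1)[OF U[OF i]] coord_closed[OF i xy(1)] coord_closed[OF i xy(2)]]
        by (simp only: coord_mult[OF i xy(1) xy'(1)] coord_inv[OF i xy(2)])
    qed
    finally show ?thesis using xy' by (simp add: product_sub_def)
  qed
  have "index G N ?P = card (g ` N)"
    using sP N_subset g_eq by (rule index_eq_card_image)
  also have "g ` N = PiE I (\<lambda>i. (\<lambda>x. U i #> x) ` carrier G)"
  proof (intro equalityI subsetI)
    fix h assume "h \<in> g ` N"
    then obtain x where x: "x \<in> N" "h = g x" by (elim imageE)
    then show "h \<in> PiE I (\<lambda>i. (\<lambda>x. U i #> x) ` carrier G)"
      by (simp add: g_def restrict_PiE_iff coord_closed)
  next
    fix h assume h: "h \<in> PiE I (\<lambda>i. (\<lambda>x. U i #> x) ` carrier G)"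
    define k where "k i = (SOME y. y \<in> carrier G \<and> h i = U i #> y)" for i
    have k: "k i \<in> carrier G \<and> h i = U i #> k i" if i: "i \<in> I" for i
    proof -
      have "h i \<in> (\<lambda>x. U i #> x) ` carrier G" using PiE_mem[OF h i] .
      then have "\<exists>y. y \<in> carrier G \<and> h i = U i #> y" by (elim imageE) (intro exI conjI)
      then show ?thesis unfolding k_def by (rule someI_ex)
    qed
    have "\<forall>i\<in>I. k i \<in> carrier G" using k by simp
    from bexE[OF coord_surj[OF this]] obtain x where x: "x \<in> N" "\<forall>i\<in>I. \<pi> i x = k i" by blast
    have "h = g x"
    proof (rule extensionalityI[of _ I])
      show "h \<in> extensional I" using h by (simp add: PiE_iff)
    qed (use k x(2) in \<open>simp_all add: g_def\<close>)
    then show "h \<in> g ` N" using x(1) by (rule image_eqI)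
  qed
  finally have iNP: "index G N ?P = (\<Prod>i\<in>I. index G (carrier G) (U i))"
    using finite_I by (simp add: card_PiE index_def)
  have "index G (carrier G) ?P = index G (carrier G) N * index G N ?P"
    using sP sub_N subgroup_self PN N_subset by (rule index_mult)
  then show iP: "index G (carrier G) ?P = index G (carrier G) N * (\<Prod>i\<in>I. index G (carrier G) (U i))"
    using iNP by simp
  have "0 < (\<Prod>i\<in>I. index G (carrier G) (U i))" using fin_subD(3)[OF U] by (intro prod_pos) auto
  then show "fin_sub ?P" using sP clP iP fin_subD(3)[OF fin_sub_N] by (simp add: fin_sub_def)
qed

lemma char_coord:
  assumes i: "i \<in> I" and P: "subgroup P G" "closedin T P" "P \<subseteq> N" and U: "\<pi> i ` P \<subseteq> V" and \<psi>: "\<psi> \<in> chars V"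
  shows "(\<lambda>x\<in>P. \<psi> (\<pi> i x)) \<in> chars P"
  using P(3) by (intro pullback_char[OF P(1,2) _ coord_continuous[OF i] closed_N P(3) U \<psi>] coord_mult[OF i]) auto

text \<open>Summing characters of the factors embeds \<open>\<Prod>Hom(U\<^sub>i, \<int>/p)\<close> into \<open>Hom(\<Prod>U\<^sub>i, \<int>/p)\<close>.\<close>

lemma prod_card_chars_le:
  assumes U: "\<And>i. i \<in> I \<Longrightarrow> fin_sub (U i)" and fin: "finite (chars (product_sub U))"
  shows "(\<Prod>i\<in>I. card (chars (U i))) \<le> card (chars (product_sub U))"
proof -
  let ?P = "product_sub U"
  note P = fin_subD[OF product_sub(1)[OF U]]
  have PN: "?P \<subseteq> N" by (auto simp: product_sub_def)
  define F where "F \<xi> = (\<lambda>x\<in>?P. (\<Sum>i\<in>I. 1 * (\<lambda>x\<in>?P. \<xi> i (\<pi> i x)) x) mod int p)" for \<xi> :: "'i \<Rightarrow> 'a \<Rightarrow> int"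
  have "F \<xi> \<in> chars ?P" if \<xi>: "\<xi> \<in> PiE I (\<lambda>i. chars (U i))" for \<xi>
    unfolding F_def
  proof (rule char_lincomb[OF P(1,2) finite_I])
    fix i assume i: "i \<in> I"
    show "(\<lambda>x\<in>?P. \<xi> i (\<pi> i x)) \<in> chars ?P"
      using i PiE_mem[OF \<xi> i] by (intro char_coord[OF i P(1,2) PN]) (auto simp: product_sub_def)
  qed
  then have sub: "F ` PiE I (\<lambda>i. chars (U i)) \<subseteq> chars ?P" by blast
  have inj: "inj_on F (PiE I (\<lambda>i. chars (U i)))"
  proof (rule inj_onI)
    fix \<xi> \<zeta> assume h: "\<xi> \<in> PiE I (\<lambda>i. chars (U i))" "\<zeta> \<in> PiE I (\<lambda>i. chars (U i))" "F \<xi> = F \<zeta>"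
    show "\<xi> = \<zeta>"
    proof (rule PiE_ext[OF h(1,2)])
      fix i assume i: "i \<in> I"
      note Ui = fin_subD[OF U[OF i]]
      show "\<xi> i = \<zeta> i"
      proof (rule char_ext[OF Ui(1,2) PiE_mem[OF h(1) i] PiE_mem[OF h(2) i]])
        fix u assume u: "u \<in> U i"
        then have uG: "u \<in> carrier G" using fin_sub_subset[OF U[OF i]] by blast
        have "\<forall>j\<in>I. (if j = i then u else \<one>) \<in> carrier G" using uG by simp
        from bexE[OF coord_surj[OF this]]
        obtain x where x: "x \<in> N" "\<forall>j\<in>I. \<pi> j x = (if j = i then u else \<one>)" by blast
        have xP: "x \<in> ?P" using x u subgroup.one_closed[OF fin_subD(1)[OF U]] by (simp add: product_sub_def)
        have F: "F \<eta> x = \<eta> i u" if \<eta>: "\<eta> \<in> PiE I (\<lambda>i. chars (U i))" for \<eta>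
        proof -
          have "(\<Sum>j\<in>I. \<eta> j (\<pi> j x)) = (\<Sum>j\<in>I. if j = i then \<eta> i u else 0)"
          proof (intro sum.cong refl)
            fix j assume j: "j \<in> I"
            note Uj = fin_subD[OF U[OF j]]
            show "\<eta> j (\<pi> j x) = (if j = i then \<eta> i u else 0)"
              using x(2)[rule_format, OF j] char_one[OF Uj(1,2) PiE_mem[OF \<eta> j]] by simp
          qed
          also have "\<dots> = \<eta> i u" using i finite_I by simp
          finally have "F \<eta> x = \<eta> i u mod int p" using xP by (simp add: F_def)
          then show ?thesis using char_mod[OF Ui(1,2) PiE_mem[OF \<eta> i] u] by simp
        qed
        show "\<xi> i u = \<zeta> i u" using F[OF h(1)] F[OF h(2)] h(3) by simp
      qed
    qed
  qed
  have "(\<Prod>i\<in>I. card (chars (U i))) = card (PiE I (\<lambda>i. chars (U i)))" using finite_I by (simp add: card_PiE)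
  also have "\<dots> \<le> card (chars ?P)" using inj sub fin by (rule card_inj_on_le)
  finally show ?thesis .
qed

text \<open>
  Filter \<open>W\<close> by the vanishing of more and more coordinates. The successive quotients are closed subgroups of
  the factors; the indices multiply, and so do the bounds for the numbers of characters.
\<close>

lemma partial_power_filtration:
  assumes "J \<subseteq> I" "subgroup W G" "closedin T W" "W \<subseteq> {x \<in> N. \<forall>i\<in>I - J. \<pi> i x = \<one>}"
    "0 < index G {x \<in> N. \<forall>i\<in>I - J. \<pi> i x = \<one>} W"
  shows "\<exists>V. (\<forall>i\<in>J. fin_sub (V i)) \<and>
    (\<Prod>i\<in>J. index G (carrier G) (V i)) = index G {x \<in> N. \<forall>i\<in>I - J. \<pi> i x = \<one>} W \<and>
    ((\<forall>i\<in>J. finite (chars (V i))) \<longrightarrow>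
      finite (chars W) \<and> card (chars W) \<le> (\<Prod>i\<in>J. card (chars (V i))))"
proof -
  have "finite J" using assms(1) finite_I by (rule finite_subset)
  then show ?thesis using assms
  proof (induction J arbitrary: W rule: finite_induct)
    case empty
    have 1: "x = \<one>" if "x \<in> N" "\<forall>i\<in>I. \<pi> i x = \<one>" for x
    proof (rule coord_inj[OF that(1) subgroup.one_closed[OF sub_N]])
      fix i assume "i \<in> I" then show "\<pi> i x = \<pi> i \<one>" using that(2) coord_one by simp
    qed
    have oneW: "\<one> \<in> W" using empty(2) by (rule subgroup.one_closed)
    have triv: "{x \<in> N. \<forall>i\<in>I - {}. \<pi> i x = \<one>} = {\<one>}"
    proof (intro equalityI subsetI)
      fix x assume "x \<in> {x \<in> N. \<forall>i\<in>I - {}. \<pi> i x = \<one>}"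
      then show "x \<in> {\<one>}" using 1[of x] by simp
    next
      fix x assume "x \<in> {\<one>}"
      then show "x \<in> {x \<in> N. \<forall>i\<in>I - {}. \<pi> i x = \<one>}"
        using subgroup.one_closed[OF sub_N] by (simp add: coord_one)
    qed
    have "W \<subseteq> {\<one>}" using empty(4) by (simp only: triv)
    then have W: "W = {\<one>}" using oneW by (intro equalityI) simp_all
    have "chars W \<subseteq> {\<lambda>x\<in>W. 0}"
    proof
      fix \<theta> assume \<theta>: "\<theta> \<in> chars W"
      have "\<theta> = (\<lambda>x\<in>W. 0)"
        using char_one[OF empty(2,3) \<theta>] W by (intro char_ext[OF empty(2,3) \<theta> char_zero[OF empty(2,3)]]) simp
      then show "\<theta> \<in> {\<lambda>x\<in>W. 0}" by simp
    qed
    then have "finite (chars W) \<and> card (chars W) \<le> 1"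
      using finite_subset card_mono[of "{\<lambda>x\<in>W. 0}" "chars W"] by auto
    moreover have "index G {x \<in> N. \<forall>i\<in>I - {}. \<pi> i x = \<one>} W = 1"
      using index_self[OF empty(2)] triv W by simp
    ultimately show ?case by simp
  next
    case (insert a J)
    define NJ where "NJ = {x \<in> N. \<forall>i\<in>I - J. \<pi> i x = \<one>}"
    define K where "K = {x \<in> N. \<forall>i\<in>I - insert a J. \<pi> i x = \<one>}"
    note sW = insert.prems(2) and clW = insert.prems(3)
    have WK: "W \<subseteq> K" and iKW: "0 < index G K W" using insert.prems(4,5) by (simp_all only: K_def)
    have a: "a \<in> I" and JI: "J \<subseteq> I" using insert.prems(1) by auto
    have KN: "K \<subseteq> N" by (auto simp: K_def)
    have WN: "W \<subseteq> N" using WK KN by blast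
    have sub: "subgroup {x \<in> N. \<forall>i\<in>I - B. \<pi> i x = \<one>} G" for B
    proof (rule subgroupI)
      show "{x \<in> N. \<forall>i\<in>I - B. \<pi> i x = \<one>} \<subseteq> carrier G" using N_subset by blast
      have "\<one> \<in> {x \<in> N. \<forall>i\<in>I - B. \<pi> i x = \<one>}"
        using subgroup.one_closed[OF sub_N] by (simp add: coord_one)
      then show "{x \<in> N. \<forall>i\<in>I - B. \<pi> i x = \<one>} \<noteq> {}" by blast
      fix x assume "x \<in> {x \<in> N. \<forall>i\<in>I - B. \<pi> i x = \<one>}"
      then show "inv x \<in> {x \<in> N. \<forall>i\<in>I - B. \<pi> i x = \<one>}"
        using subgroup.m_inv_closed[OF sub_N] by (simp add: coord_inv)
    next
      fix x y assume "x \<in> {x \<in> N. \<forall>i\<in>I - B. \<pi> i x = \<one>}" "y \<in> {x \<in> N. \<forall>i\<in>I - B. \<pi> i x = \<one>}"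
      then show "x \<otimes> y \<in> {x \<in> N. \<forall>i\<in>I - B. \<pi> i x = \<one>}"
        using subgroup.m_closed[OF sub_N] by (simp add: coord_mult)
    qed
    have sK: "subgroup K G" and sNJ: "subgroup NJ G" using sub by (simp_all add: K_def NJ_def)
    have NJ_eq: "NJ = {x \<in> K. \<pi> a x = \<one>}" using insert.hyps(2) a by (auto simp: K_def NJ_def)
    have homK: "\<pi> a \<in> hom (G\<lparr>carrier := K\<rparr>) G"
      using KN by (simp add: hom_def Pi_iff subset_iff coord_closed[OF a] coord_mult[OF a])
    have "\<pi> a ` K = carrier G"
    proof (intro equalityI subsetI)
      fix g assume "g \<in> \<pi> a ` K" then show "g \<in> carrier G" using KN coord_closed[OF a] by blast
    next
      fix g assume g: "g \<in> carrier G"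
      have "\<forall>j\<in>I. (if j = a then g else \<one>) \<in> carrier G" using g by simp
      from bexE[OF coord_surj[OF this]]
      obtain x where x: "x \<in> N" "\<forall>j\<in>I. \<pi> j x = (if j = a then g else \<one>)" by blast
      then have "x \<in> K" by (auto simp: K_def)
      moreover have "\<pi> a x = g" using x(2)[rule_format, OF a] by simp
      ultimately show "g \<in> \<pi> a ` K" by blast
    qed
    then have idx: "index G K W = index G (carrier G) (\<pi> a ` W) * index G NJ (W \<inter> NJ)"
      using index_hom_image[OF homK is_group sK sW WK NJ_eq] by simp
    have pos: "0 < index G (carrier G) (\<pi> a ` W)" "0 < index G NJ (W \<inter> NJ)"
      using iKW idx by (auto intro: Nat.gr0I)
    have "subgroup W (G\<lparr>carrier := N\<rparr>)" using sW sub_N WN by (rule subgroup_incl)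
    then have "subgroup (\<pi> a ` W) G" by (rule group_hom.subgroup_img_is_subgroup[OF coord_group_hom[OF a]])
    moreover have "closedin T (\<pi> a ` W)" by (rule closedin_image[OF coord_continuous[OF a] clW WN])
    ultimately have fsV: "fin_sub (\<pi> a ` W)" using pos by (simp add: fin_sub_def)
    have sW': "subgroup (W \<inter> NJ) G" using sW sNJ by (simp add: subgroups_Inter_pair)
    have "W \<inter> NJ = {x \<in> N. \<pi> a x \<in> {\<one>}} \<inter> W" using NJ_eq WK KN by auto
    moreover have "closedin T {\<one>}" using closedin_one .
    then have "closedin T {x \<in> N. \<pi> a x \<in> {\<one>}}"
      by (rule closedin_preimage_sub[OF coord_continuous[OF a] closed_N])
    ultimately have clW': "closedin T (W \<inter> NJ)" using clW by (simp add: closedin_Int)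
    have "\<exists>V. (\<forall>i\<in>J. fin_sub (V i)) \<and>
        (\<Prod>i\<in>J. index G (carrier G) (V i)) = index G NJ (W \<inter> NJ) \<and>
        ((\<forall>i\<in>J. finite (chars (V i))) \<longrightarrow>
          finite (chars (W \<inter> NJ)) \<and> card (chars (W \<inter> NJ)) \<le> (\<Prod>i\<in>J. card (chars (V i))))"
      using insert.IH[OF JI sW' clW'] pos(2) unfolding NJ_def by blast
    then obtain V where V: "\<forall>i\<in>J. fin_sub (V i)"
      "(\<Prod>i\<in>J. index G (carrier G) (V i)) = index G NJ (W \<inter> NJ)"
      "(\<forall>i\<in>J. finite (chars (V i))) \<longrightarrow>
          finite (chars (W \<inter> NJ)) \<and> card (chars (W \<inter> NJ)) \<le> (\<Prod>i\<in>J. card (chars (V i)))"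
      by (elim exE conjE)
    \<comment> \<open>the quotient of \<open>W\<close> by the part on which the coordinate \<open>a\<close> vanishes becomes the factor at \<open>a\<close>\<close>
    define V' where "V' = V(a := \<pi> a ` W)"
    have V'a: "V' a = \<pi> a ` W" and V'J: "\<And>i. i \<in> J \<Longrightarrow> V' i = V i"
      using insert.hyps(2) by (auto simp: V'_def)
    have prodJ: "(\<Prod>i\<in>J. h (V' i)) = (\<Prod>i\<in>J. h (V i))" for h :: "'a set \<Rightarrow> nat"
      by (intro prod.cong refl) (simp add: V'J)
    have 1: "\<forall>i\<in>insert a J. fin_sub (V' i)" using fsV V(1) V'a V'J by simp
    have 2: "(\<Prod>i\<in>insert a J. index G (carrier G) (V' i)) = index G K W"
      using insert.hyps idx V(2) by (simp add: V'a prodJ)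
    have 3: "finite (chars W) \<and> card (chars W) \<le> (\<Prod>i\<in>insert a J. card (chars (V' i)))"
      if fin: "\<forall>i\<in>insert a J. finite (chars (V' i))"
    proof -
      have finJ: "finite (chars (W \<inter> NJ)) \<and> card (chars (W \<inter> NJ)) \<le> (\<Prod>i\<in>J. card (chars (V i)))"
        using V(3) fin V'J by simp
      have fina: "finite (chars (\<pi> a ` W))" using fin V'a by simp
      let ?Z = "{\<theta> \<in> chars W. \<forall>x\<in>W \<inter> NJ. \<theta> x = 0}"
      have Zsub: "?Z \<subseteq> (\<lambda>\<psi>. \<lambda>x\<in>W. \<psi> (\<pi> a x)) ` chars (\<pi> a ` W)"
      proof
        fix \<theta> assume "\<theta> \<in> ?Z"
        then have \<theta>: "\<theta> \<in> chars W" and van: "\<And>x. x \<in> W \<inter> NJ \<Longrightarrow> \<theta> x = 0" by auto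
        have "\<exists>\<psi>\<in>chars (\<pi> a ` W). \<theta> = (\<lambda>x\<in>W. \<psi> (\<pi> a x))"
        proof (rule vanishing_subset_pullback[OF sW clW _ _ \<theta>])
          show "\<pi> a (x \<otimes> y) = \<pi> a x \<otimes> \<pi> a y" if "x \<in> W" "y \<in> W" for x y
            using that WN by (intro coord_mult[OF a]) auto
          show "closedin T (\<pi> a ` C)" if "closedin T C" "C \<subseteq> W" for C
            using that WN by (intro closedin_image[OF coord_continuous[OF a]]) auto
          fix x y assume xy: "x \<in> W" "y \<in> W" "\<pi> a x = \<pi> a y"
          then have xyN: "x \<in> N" "y \<in> N" "inv y \<in> N" using WN sub_N by (auto simp: subgroup.m_inv_closed)
          have "x \<otimes> inv y \<in> W" using xy sW by (simp add: subgroup.m_closed subgroup.m_inv_closed)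
          moreover have "\<pi> a (x \<otimes> inv y) = \<one>"
            using xy(3) xyN coord_closed[OF a xyN(2)] by (simp add: coord_mult[OF a] coord_inv[OF a])
          ultimately have "x \<otimes> inv y \<in> W \<inter> NJ" using NJ_eq WK by blast
          then show "\<theta> x = \<theta> y" using van char_eq_iff[OF sW clW \<theta> xy(1,2)] by simp
        qed
        then show "\<theta> \<in> (\<lambda>\<psi>. \<lambda>x\<in>W. \<psi> (\<pi> a x)) ` chars (\<pi> a ` W)" by (elim bexE) (rule image_eqI)
      qed
      then have finZ: "finite ?Z" using fina finite_surj by blast
      have cardZ: "card ?Z \<le> card (chars (\<pi> a ` W))" using fina Zsub by (rule surj_card_le)
      have "W \<inter> NJ \<subseteq> W" by blast
      note le = card_chars_le_restrict[OF sW clW sW' clW' this conjunct1[OF finJ] finZ]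
      have "card (chars W) \<le> card (chars (\<pi> a ` W)) * (\<Prod>i\<in>J. card (chars (V i)))"
        using le(2) cardZ conjunct2[OF finJ] by (meson le_trans mult_le_mono)
      then show ?thesis using le(1) insert.hyps by (simp add: V'a prodJ[of "\<lambda>S. card (chars S)"])
    qed
    then have "(\<forall>i\<in>insert a J. finite (chars (V' i))) \<longrightarrow>
        finite (chars W) \<and> card (chars W) \<le> (\<Prod>i\<in>insert a J. card (chars (V' i)))" by (rule impI)
    then show ?case using 1 2 unfolding K_def by blast
  qed
qed

lemma power_filtration:
  assumes W: "fin_sub W" "W \<subseteq> N"
  shows "\<exists>V. (\<forall>i\<in>I. fin_sub (V i)) \<and>
    (\<Prod>i\<in>I. index G (carrier G) (V i)) = index G N W \<and>
    ((\<forall>i\<in>I. finite (chars (V i))) \<longrightarrow>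
      finite (chars W) \<and> card (chars W) \<le> (\<Prod>i\<in>I. card (chars (V i))))"
proof -
  have N: "{x \<in> N. \<forall>i\<in>I - I. \<pi> i x = \<one>} = N" by blast
  have "0 < index G N W"
    using index_pos_subset(1)[OF fin_subD(3)[OF W(1)] N_subset subgroup_ne[OF sub_N]] .
  then show ?thesis
    using partial_power_filtration[OF subset_refl fin_subD(1,2)[OF W(1)], unfolded N, OF W(2)] by (simp only:)
qed

text \<open>
  One inequality is \<open>prod_card_chars_le\<close>. For the other one take \<open>W = N\<close> in the filtration: the product of the
  indices of the subgroups \<open>V i\<close> is \<open>1\<close>, so they all equal \<open>G\<close>.
\<close>

lemma card_chars_power:
  assumes fin: "finite (chars (carrier G))"
  shows "card (chars N) = card (chars (carrier G)) ^ card I"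
proof -
  obtain V where V: "\<forall>i\<in>I. fin_sub (V i)"
    "(\<Prod>i\<in>I. index G (carrier G) (V i)) = index G N N"
    "(\<forall>i\<in>I. finite (chars (V i))) \<longrightarrow>
      finite (chars N) \<and> card (chars N) \<le> (\<Prod>i\<in>I. card (chars (V i)))"
    using power_filtration[OF fin_sub_N subset_refl] by (elim exE conjE)
  have "V i = carrier G" if i: "i \<in> I" for i
  proof -
    have "(\<Prod>i\<in>I. index G (carrier G) (V i)) = 1" using V(2) index_self[OF sub_N] by simp
    then have "index G (carrier G) (V i) = 1"
      using dvd_prodI[OF finite_I i, of "\<lambda>i. index G (carrier G) (V i)"] by simp
    moreover have Vi: "fin_sub (V i)" using V(1) i by blast
    ultimately show ?thesis
      using index_eq_1_iff[OF fin_subD(1)[OF Vi] subgroup_self fin_sub_subset[OF Vi]] by (simp only:)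
  qed
  then have le: "finite (chars N)" "card (chars N) \<le> card (chars (carrier G)) ^ card I"
    using V(3) fin by simp_all
  have "(\<Prod>i\<in>I. card (chars (carrier G))) \<le> card (chars (product_sub (\<lambda>_. carrier G)))"
    using le(1) by (intro prod_card_chars_le fin_sub_carrier) (simp add: product_sub_carrier)
  then show ?thesis using le(2) by (simp add: product_sub_carrier)
qed

end

lemma (in p_power_index) power_coordinates_of_iso:
  assumes N: "fin_sub N" and f: "f \<in> isos_to_power G T N k"
  shows "power_coordinates G T p N {..<k} (\<lambda>i x. f x i)"
proof unfold_locales
  have iso: "f \<in> iso (G\<lparr>carrier := N\<rparr>) (power_group G k)"
    and homeo: "homeomorphic_map (subtopology T N) (power_top T k) f"
    using f by (auto simp: isos_to_power_def top_group_iso_def)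
  have bij: "bij_betw f N ({..<k} \<rightarrow>\<^sub>E carrier G)" using iso by (simp add: iso_def)
  have ext: "(\<lambda>i\<in>{..<k}. f x i) = f x" if "x \<in> N" for x
    using bij_betwE[OF bij] that by (auto simp: PiE_iff extensional_restrict)
  show "fin_sub N" by (rule N)
  show "finite {..<k}" by simp
  show "f (x \<otimes>\<^bsub>G\<^esub> y) i = f x i \<otimes>\<^bsub>G\<^esub> f y i" if "i \<in> {..<k}" "x \<in> N" "y \<in> N" for i x y
  proof -
    have "f (x \<otimes> y) = f x \<otimes>\<^bsub>power_group G k\<^esub> f y"
      using iso that by (simp add: iso_def hom_def)
    then show ?thesis using that by simp
  qed
  show "continuous_map (subtopology T N) T (\<lambda>x. f x i)" if "i \<in> {..<k}" for i
    using homeomorphic_imp_continuous_map[OF homeo] that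
    by (simp add: continuous_map_componentwise)
  show "bij_betw (\<lambda>x. \<lambda>i\<in>{..<k}. f x i) N ({..<k} \<rightarrow>\<^sub>E carrier G)"
    using bij by (rule bij_betw_cong[THEN iffD2, rotated]) (simp add: ext)
qed

section \<open>Principal congruence subgroups as direct powers\<close>

definition words :: "nat \<Rightarrow> nat \<Rightarrow> nat list set" where
  "words r n = {w. set w \<subseteq> {..<r} \<and> length w = n}"

lemma finite_words: "finite (words r n)" and card_words: "card (words r n) = r ^ n"
  by (simp_all add: words_def finite_lists_length_eq card_lists_length_eq)

lemma words_0: "words r 0 = {[]}"
  by (auto simp: words_def)

lemma Cons_in_words: "i # w \<in> words r (Suc n) \<longleftrightarrow> i < r \<and> w \<in> words r n"
  by (auto simp: words_def)

lemma words_SucE: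
  assumes "w \<in> words r (Suc n)" obtains i v where "w = i # v" "i < r" "v \<in> words r n"
  using assms by (cases w) (auto simp: words_def)

locale self_replicating = p_power_index +
  fixes r :: nat and G\<^sub>1 :: "'a set" and \<phi> :: "'a \<Rightarrow> nat \<Rightarrow> 'a"
  assumes self_rep: "self_replicating_by G T r G\<^sub>1 \<phi>"
begin

lemma r_ge_2: "2 \<le> r" and G1_proper: "G\<^sub>1 \<noteq> carrier G" and \<phi>_iso: "\<phi> \<in> isos_to_power G T G\<^sub>1 r"
  using self_rep by (simp_all add: self_replicating_by_def)

lemma fin_sub_G1: "fin_sub G\<^sub>1"
  using self_rep by (simp add: self_replicating_by_def fin_sub_def normal_imp_subgroup
      index_pos_iff[OF subgroup_ne[OF subgroup_self]] rcosets_eq_image)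

sublocale first: power_coordinates G T p G\<^sub>1 "{..<r}" "\<lambda>i x. \<phi> x i"
  by (rule power_coordinates_of_iso[OF fin_sub_G1 \<phi>_iso])

abbreviation pcs :: "nat \<Rightarrow> 'a set" where
  "pcs \<equiv> principal_congruence_subgroup G r G\<^sub>1 \<phi>"

lemma pcs_eq: "pcs n = {x \<in> carrier G. \<forall>w. length w < n \<and> set w \<subseteq> {..<r} \<longrightarrow> foldl \<phi> x w \<in> G\<^sub>1}"
proof (induction n)
  case (Suc n)
  show ?case unfolding principal_congruence_subgroup.simps(2) Suc.IH less_Suc_eq by blast
qed simp

text \<open>The recursion of the definition replaces the innermost factors; this one replaces the outermost one.\<close>

lemma pcs_Suc: "pcs (Suc n) = first.product_sub (\<lambda>_. pcs n)"
proof (intro equalityI subsetI)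
  fix x assume "x \<in> pcs (Suc n)"
  then have xG: "x \<in> carrier G"
    and x: "\<And>w. length w < Suc n \<Longrightarrow> set w \<subseteq> {..<r} \<Longrightarrow> foldl \<phi> x w \<in> G\<^sub>1"
    unfolding pcs_eq[of "Suc n"] by auto
  have x1: "x \<in> G\<^sub>1" using x[of "[]"] by simp
  have "\<phi> x i \<in> pcs n" if i: "i < r" for i
    unfolding pcs_eq using first.coord_closed[of i x] i x1 x[of "i # _"] by auto
  then show "x \<in> first.product_sub (\<lambda>_. pcs n)" using x1 by (simp add: first.product_sub_def)
next
  fix x assume "x \<in> first.product_sub (\<lambda>_. pcs n)"
  then have x1: "x \<in> G\<^sub>1" and x: "\<And>i. i < r \<Longrightarrow> \<phi> x i \<in> pcs n" by (auto simp: first.product_sub_def)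
  have "foldl \<phi> x w \<in> G\<^sub>1" if w: "length w < Suc n" "set w \<subseteq> {..<r}" for w
  proof (cases w)
    case Nil
    then show ?thesis using x1 by simp
  next
    case (Cons i v)
    then have "\<phi> x i \<in> pcs n" "length v < n" "set v \<subseteq> {..<r}" using w x by auto
    then show ?thesis unfolding pcs_eq Cons by simp
  qed
  then show "x \<in> pcs (Suc n)" unfolding pcs_eq[of "Suc n"] using x1 first.N_subset by blast
qed

text \<open>Iterating \<open>\<phi>\<close> identifies \<open>G\<^sub>n\<close> with the direct power of \<open>G\<close> indexed by the words of length \<open>n\<close>.\<close>

lemma pcs_power_coordinates: "power_coordinates G T p (pcs n) (words r n) (\<lambda>w x. foldl \<phi> x w)"
proof (induction n)
  case 0
  show ?case
  proof unfold_locales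
    have "continuous_map (subtopology T (carrier G)) T (\<lambda>x. x)"
      by (intro continuous_map_from_subtopology) simp
    then show "continuous_map (subtopology T (pcs 0)) T (\<lambda>x. foldl \<phi> x w)" if "w \<in> words r 0" for w
      using that by (simp add: words_0)
    show "bij_betw (\<lambda>x. \<lambda>w\<in>words r 0. foldl \<phi> x w) (pcs 0) (words r 0 \<rightarrow>\<^sub>E carrier G)"
      unfolding words_0
    proof (rule bij_betwI[where g = "\<lambda>h. h []"])
      fix h :: "nat list \<Rightarrow> 'a" assume "h \<in> {[]} \<rightarrow>\<^sub>E carrier G"
      then show "(\<lambda>w\<in>{[]}. foldl \<phi> (h []) w) = h" by (auto simp: PiE_iff extensional_def)
    qed auto
  qed (simp_all add: fin_sub_carrier words_0)
next
  case (Suc n)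
  interpret C: power_coordinates G T p "pcs n" "words r n" "\<lambda>w x. foldl \<phi> x w" by (rule Suc)
  define P where "P = pcs (Suc n)"
  have P_eq: "P = first.product_sub (\<lambda>_. pcs n)" by (simp only: P_def pcs_Suc)
  have fsP: "fin_sub P" unfolding P_eq by (rule first.product_sub(1)[OF C.fin_sub_N])
  have P1: "P \<subseteq> G\<^sub>1" by (auto simp: P_eq first.product_sub_def)
  have Pn: "\<phi> x i \<in> pcs n" if "x \<in> P" "i < r" for x i
    using that by (simp add: P_eq first.product_sub_def)
  have "power_coordinates G T p P (words r (Suc n)) (\<lambda>w x. foldl \<phi> x w)"
  proof unfold_locales
    show "fin_sub P" by (rule fsP)
    show "finite (words r (Suc n))" by (rule finite_words)
  next
    fix w x y assume w: "w \<in> words r (Suc n)" and xy: "x \<in> P" "y \<in> P"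
    obtain i v where iv: "w = i # v" "i < r" "v \<in> words r n" using w by (rule words_SucE)
    have "\<phi> (x \<otimes>\<^bsub>G\<^esub> y) i = \<phi> x i \<otimes>\<^bsub>G\<^esub> \<phi> y i" using first.coord_mult[of i x y] iv(2) xy P1 by auto
    then show "foldl \<phi> (x \<otimes>\<^bsub>G\<^esub> y) w = foldl \<phi> x w \<otimes>\<^bsub>G\<^esub> foldl \<phi> y w"
      using C.coord_mult[OF iv(3) Pn[OF xy(1) iv(2)] Pn[OF xy(2) iv(2)]] by (simp add: iv(1))
  next
    fix w assume w: "w \<in> words r (Suc n)"
    obtain i v where iv: "w = i # v" "i < r" "v \<in> words r n" using w by (rule words_SucE)
    have "continuous_map (subtopology T G\<^sub>1) T (\<lambda>x. \<phi> x i)" using first.coord_continuous[of i] iv(2) by simp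
    then have "continuous_map (subtopology T P) T (\<lambda>x. \<phi> x i)"
      using P1 by (rule continuous_map_from_subtopology_mono)
    moreover have "topspace (subtopology T P) = P"
      using fin_sub_subset[OF fsP] by (auto simp: topspace)
    ultimately have "continuous_map (subtopology T P) (subtopology T (pcs n)) (\<lambda>x. \<phi> x i)"
      using Pn iv(2) by (simp add: continuous_map_in_subtopology)
    then have "continuous_map (subtopology T P) T ((\<lambda>x. foldl \<phi> x v) \<circ> (\<lambda>x. \<phi> x i))"
      using C.coord_continuous[OF iv(3)] by (rule continuous_map_compose)
    then show "continuous_map (subtopology T P) T (\<lambda>x. foldl \<phi> x w)" by (simp add: o_def iv(1))
  next
    show "bij_betw (\<lambda>x. \<lambda>w\<in>words r (Suc n). foldl \<phi> x w) P (words r (Suc n) \<rightarrow>\<^sub>E carrier G)"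
      unfolding bij_betw_def
    proof (intro conjI inj_onI equalityI subsetI)
      fix x y assume xy: "x \<in> P" "y \<in> P"
        "(\<lambda>w\<in>words r (Suc n). foldl \<phi> x w) = (\<lambda>w\<in>words r (Suc n). foldl \<phi> y w)"
      show "x = y"
      proof (rule first.coord_inj)
        show "x \<in> G\<^sub>1" "y \<in> G\<^sub>1" using xy P1 by auto
        fix i assume "i \<in> {..<r}"
        then have i: "i < r" by simp
        show "\<phi> x i = \<phi> y i"
        proof (rule C.coord_inj[OF Pn[OF xy(1) i] Pn[OF xy(2) i]])
          fix v assume "v \<in> words r n"
          then show "foldl \<phi> (\<phi> x i) v = foldl \<phi> (\<phi> y i) v"
            using fun_cong[OF xy(3), of "i # v"] i by (simp add: Cons_in_words)
        qed
      qed
    next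
      fix h assume "h \<in> (\<lambda>x. \<lambda>w\<in>words r (Suc n). foldl \<phi> x w) ` P"
      then obtain x where x: "x \<in> P" "h = (\<lambda>w\<in>words r (Suc n). foldl \<phi> x w)" by (elim imageE)
      have "foldl \<phi> x w \<in> carrier G" if w: "w \<in> words r (Suc n)" for w
      proof -
        obtain i v where iv: "w = i # v" "i < r" "v \<in> words r n" using w by (rule words_SucE)
        show ?thesis using C.coord_closed[OF iv(3) Pn[OF x(1) iv(2)]] by (simp add: iv(1))
      qed
      then show "h \<in> words r (Suc n) \<rightarrow>\<^sub>E carrier G" unfolding x(2) by (simp add: restrict_PiE_iff)
    next
      fix h assume h: "h \<in> words r (Suc n) \<rightarrow>\<^sub>E carrier G"
      have ex: "\<exists>y\<in>pcs n. \<forall>v\<in>words r n. foldl \<phi> y v = h (i # v)" if i: "i < r" for i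
      proof (rule C.coord_surj, intro ballI)
        fix v assume "v \<in> words r n"
        then have "i # v \<in> words r (Suc n)" using i by (simp add: Cons_in_words)
        then show "h (i # v) \<in> carrier G" by (rule PiE_mem[OF h])
      qed
      define y where "y i = (SOME y. y \<in> pcs n \<and> (\<forall>v\<in>words r n. foldl \<phi> y v = h (i # v)))" for i
      have y: "y i \<in> pcs n \<and> (\<forall>v\<in>words r n. foldl \<phi> (y i) v = h (i # v))" if i: "i < r" for i
      proof -
        have "\<exists>y. y \<in> pcs n \<and> (\<forall>v\<in>words r n. foldl \<phi> y v = h (i # v))"
          using ex[OF i] by (elim bexE) (intro exI conjI)
        then show ?thesis unfolding y_def by (rule someI_ex)
      qed
      have "\<forall>i\<in>{..<r}. y i \<in> carrier G" using y C.N_subset by blast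
      from bexE[OF first.coord_surj[OF this]]
      obtain x where x: "x \<in> G\<^sub>1" "\<forall>i\<in>{..<r}. \<phi> x i = y i" by blast
      have xP: "x \<in> P" using x y by (simp add: P_eq first.product_sub_def)
      have "h = (\<lambda>w\<in>words r (Suc n). foldl \<phi> x w)"
      proof (rule extensionalityI[of _ "words r (Suc n)"])
        show "h \<in> extensional (words r (Suc n))" using h by (simp add: PiE_iff)
        fix w assume w: "w \<in> words r (Suc n)"
        obtain i v where iv: "w = i # v" "i < r" "v \<in> words r n" using w by (rule words_SucE)
        show "h w = (\<lambda>w\<in>words r (Suc n). foldl \<phi> x w) w"
          using w y[OF iv(2)] iv x(2) by simp
      qed simp
      then show "h \<in> (\<lambda>x. \<lambda>w\<in>words r (Suc n). foldl \<phi> x w) ` P" using xP by (rule image_eqI)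
    qed
  qed
  then show ?case unfolding P_def .
qed

end

section \<open>Subgroups and characters by index\<close>

context p_power_index begin

definition level :: "nat \<Rightarrow> 'a set set" where
  "level m = {U. fin_sub U \<and> index G (carrier G) U = p ^ m}"

lemma level_0: "level 0 = {carrier G}"
proof (intro equalityI subsetI)
  fix U assume "U \<in> level 0"
  then have U: "fin_sub U" "index G (carrier G) U = 1" by (simp_all add: level_def)
  have "U = carrier G"
    using index_eq_1_iff[OF fin_subD(1)[OF U(1)] subgroup_self fin_sub_subset[OF U(1)]] U(2) by simp
  then show "U \<in> {carrier G}" by simp
next
  fix U assume "U \<in> {carrier G}"
  then show "U \<in> level 0" using fin_sub_carrier index_self[OF subgroup_self] by (simp add: level_def)
qed

lemma fin_sub_level: "fin_sub U \<Longrightarrow> \<exists>m. U \<in> level m"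
  using index_power[of U] by (auto simp: level_def)

text \<open>
  A subgroup of index \<open>p\<^sup>m\<^sup>+\<^sup>1\<close> is normal of index \<open>p\<close> in one of index \<open>p\<^sup>m\<close>.
\<close>

lemma level_Suc_subset: "level (Suc m) \<subseteq> (\<Union>V\<in>level m. (\<lambda>\<theta>. {x\<in>V. \<theta> x = 0}) ` chars V)"
proof
  fix U assume "U \<in> level (Suc m)"
  then have U: "fin_sub U" "index G (carrier G) U = p ^ Suc m" by (simp_all add: level_def)
  have "U \<noteq> carrier G" using U(2) index_self[OF subgroup_self] p_gt_1 by auto
  then obtain V where V: "fin_sub V" "U \<subseteq> V" "index G V U = p"
    "\<And>v u. v \<in> V \<Longrightarrow> u \<in> U \<Longrightarrow> v \<otimes> u \<otimes> inv v \<in> U"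
    using fin_sub_normal_step[OF U(1) \<open>U \<noteq> carrier G\<close>] by blast
  have "index G (carrier G) U = index G (carrier G) V * index G V U"
    using fin_subD(1)[OF U(1)] fin_subD(1)[OF V(1)] subgroup_self V(2) fin_sub_subset[OF V(1)]
    by (rule index_mult)
  then have "index G (carrier G) V = p ^ m" using U(2) V(3) p_pos by simp
  then have "V \<in> level m" using V(1) by (simp add: level_def)
  moreover have "\<exists>\<theta>\<in>chars V. {v\<in>V. \<theta> v = 0} = U"
    using fin_subD(1,2)[OF V(1)] fin_subD(1,2)[OF U(1)] V(2-4) by (rule index_p_is_kernel)
  ultimately show "U \<in> (\<Union>V\<in>level m. (\<lambda>\<theta>. {x\<in>V. \<theta> x = 0}) ` chars V)" by blast
qed

text \<open>
  By \<open>level_Suc_subset\<close> a subgroup of index \<open>p\<^sup>m\<close> accounts for at most as many subgroups of index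
  \<open>p\<^sup>m\<^sup>+\<^sup>1\<close> as it has characters.
\<close>

lemma card_level_le:
  assumes "\<And>m U. U \<in> level m \<Longrightarrow> finite (chars U) \<and> card (chars U) \<le> p ^ c m"
  shows "finite (level m) \<and> card (level m) \<le> p ^ (\<Sum>i<m. c i)"
proof (induction m)
  case 0
  then show ?case by (simp add: level_0)
next
  case (Suc m)
  let ?K = "\<lambda>V. (\<lambda>\<theta>. {x\<in>V. \<theta> x = 0}) ` chars V"
  have K: "finite (?K V) \<and> card (?K V) \<le> p ^ c m" if "V \<in> level m" for V
    using assms[OF that] card_image_le[of "chars V" "\<lambda>\<theta>. {x\<in>V. \<theta> x = 0}"] by auto
  have fin: "finite (\<Union>V\<in>level m. ?K V)" using Suc K by blast
  have "card (level (Suc m)) \<le> card (\<Union>V\<in>level m. ?K V)" using fin level_Suc_subset by (rule card_mono)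
  also have "\<dots> \<le> (\<Sum>V\<in>level m. card (?K V))" using Suc by (intro card_UN_le) simp
  also have "\<dots> \<le> (\<Sum>V\<in>level m. p ^ c m)" using K by (intro sum_mono) blast
  also have "\<dots> = card (level m) * p ^ c m" by simp
  also have "\<dots> \<le> p ^ (\<Sum>i<m. c i) * p ^ c m" using Suc by simp
  also have "\<dots> = p ^ (\<Sum>i<Suc m. c i)" by (simp add: power_add)
  finally show ?case using fin level_Suc_subset finite_subset by blast
qed

lemma d_p_max_eq: "d_p_max p G T m = Max (d_p_sub p G T ` level m)"
proof -
  have "{U. closed_subgroup U G T \<and> card (rcosets U) = p ^ m} = level m"
    using p_pos by (auto simp: level_def fin_sub_def closed_subgroup_def card_rcosets)
  then show ?thesis by (simp add: d_p_max_def)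
qed

lemma card_chars_le_d_p_max:
  assumes fin: "finite (level m)" and U: "U \<in> level m" "finite (chars U)"
  shows "card (chars U) \<le> p ^ d_p_max p G T m"
proof -
  have "card (chars U) = p ^ d_p_sub p G T U"
    using U by (intro card_chars_eq_power_d_p_sub) (auto simp: level_def fin_sub_def)
  moreover have "d_p_sub p G T U \<le> d_p_max p G T m"
    unfolding d_p_max_eq using fin U(1) by (intro Max_ge) auto
  ultimately show ?thesis using p_pos by (simp add: power_increasing)
qed

lemma d_p_max_attained:
  assumes "finite (level m)" "level m \<noteq> {}" "\<And>U. U \<in> level m \<Longrightarrow> finite (chars U)"
  obtains U where "U \<in> level m" "card (chars U) = p ^ d_p_max p G T m"
proof -
  have "Max (d_p_sub p G T ` level m) \<in> d_p_sub p G T ` level m" using assms(1,2) by (intro Max_in) auto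
  then obtain U where U: "U \<in> level m" "d_p_max p G T m = d_p_sub p G T U"
    unfolding d_p_max_eq by (elim imageE)
  have "card (chars U) = p ^ d_p_sub p G T U"
    using U(1) assms(3)[OF U(1)] by (intro card_chars_eq_power_d_p_sub) (auto simp: level_def fin_sub_def)
  then show ?thesis using that U by simp
qed

lemma card_chars_carrier:
  assumes "finite (chars (carrier G))"
  shows "card (chars (carrier G)) = p ^ d_p p G T"
  using assms by (rule card_chars_eq_power_d_p)

text \<open>
  Such a character is constant on the cosets of \<open>U \<inter> N\<close> in \<open>U\<close>, and there are at most \<open>|G : N|\<close> of them.
\<close>

lemma vanishing_chars_le_index:
  assumes N: "fin_sub N" and U: "fin_sub U"
  shows "finite {\<theta> \<in> chars U. \<forall>x\<in>U \<inter> N. \<theta> x = 0}"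
    "card {\<theta> \<in> chars U. \<forall>x\<in>U \<inter> N. \<theta> x = 0} \<le> p ^ index G (carrier G) N"
proof -
  let ?Z = "{\<theta> \<in> chars U. \<forall>x\<in>U \<inter> N. \<theta> x = 0}"
  note sU = fin_subD(1,2)[OF U] and sN = fin_subD(1)[OF N]
  have UG: "U \<subseteq> carrier G" using U by (rule fin_sub_subset)
  define X where "X = (\<lambda>x. N #> x) ` U"
  have pos: "0 < index G U N" "index G U N \<le> index G (carrier G) N"
    using index_pos_subset[OF fin_subD(3)[OF N] UG subgroup_ne[OF sU(1)]] by auto
  then have finX: "finite X" using subgroup_ne[OF sU(1)] by (simp add: index_pos_iff X_def)
  \<comment> \<open>a representative in \<open>U\<close> of the coset \<open>C\<close> of \<open>N\<close>\<close>
  define R where "R C = (SOME x. x \<in> U \<and> N #> x = C)" for C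
  define F where "F \<theta> = (\<lambda>C\<in>X. \<theta> (R C))" for \<theta> :: "'a \<Rightarrow> int"
  have R: "R (N #> x) \<in> U \<and> N #> R (N #> x) = N #> x" if "x \<in> U" for x
  proof -
    have "\<exists>y. y \<in> U \<and> N #> y = N #> x" using that by (intro exI[of _ x]) simp
    then show ?thesis unfolding R_def by (rule someI_ex)
  qed
  have FR: "\<theta> (R (N #> x)) = \<theta> x" if \<theta>: "\<theta> \<in> ?Z" and x: "x \<in> U" for \<theta> x
  proof -
    have RU: "R (N #> x) \<in> U" using R[OF x] by simp
    have "R (N #> x) \<otimes> inv x \<in> N"
      using R[OF x] x UG rcoset_eq_iff[OF sN, of "R (N #> x)" x] by auto
    moreover have "R (N #> x) \<otimes> inv x \<in> U"
      using RU x sU(1) by (simp add: subgroup.m_closed subgroup.m_inv_closed)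
    ultimately have "\<theta> (R (N #> x) \<otimes> inv x) = 0" using \<theta> by simp
    moreover have "\<theta> \<in> chars U" using \<theta> by simp
    ultimately show ?thesis using char_eq_iff[OF sU _ RU x] by blast
  qed
  have inj: "inj_on F ?Z"
  proof (rule inj_onI)
    fix \<theta> \<psi> assume h: "\<theta> \<in> ?Z" "\<psi> \<in> ?Z" "F \<theta> = F \<psi>"
    then have c: "\<theta> \<in> chars U" "\<psi> \<in> chars U" by simp_all
    show "\<theta> = \<psi>"
    proof (rule char_ext[OF sU c])
      fix x assume x: "x \<in> U"
      have "\<theta> (R (N #> x)) = \<psi> (R (N #> x))" using fun_cong[OF h(3), of "N #> x"] x by (simp add: F_def X_def)
      then show "\<theta> x = \<psi> x" using FR[OF h(1) x] FR[OF h(2) x] by simp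
    qed
  qed
  have sub: "F ` ?Z \<subseteq> X \<rightarrow>\<^sub>E {0..<int p}"
  proof
    fix h assume "h \<in> F ` ?Z"
    then obtain \<theta> where \<theta>: "\<theta> \<in> ?Z" "h = F \<theta>" by (elim imageE)
    have "\<theta> (R C) \<in> {0..<int p}" if "C \<in> X" for C
    proof -
      have "R C \<in> U" using that R by (auto simp: X_def)
      then show ?thesis using char_range[OF sU, of \<theta> "R C"] \<theta>(1) by simp
    qed
    then show "h \<in> X \<rightarrow>\<^sub>E {0..<int p}" by (simp add: \<theta>(2) F_def restrict_PiE_iff)
  qed
  have fin: "finite (X \<rightarrow>\<^sub>E {0..<int p})" using finX by (simp add: finite_PiE)
  show "finite ?Z" using inj sub fin by (rule inj_on_finite)
  have "card ?Z \<le> card (X \<rightarrow>\<^sub>E {0..<int p})" using inj sub fin by (rule card_inj_on_le)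
  also have "\<dots> = p ^ index G U N" using finX by (simp add: card_PiE X_def index_def)
  also have "\<dots> \<le> p ^ index G (carrier G) N" using pos(2) p_pos by (simp add: power_increasing)
  finally show "card ?Z \<le> p ^ index G (carrier G) N" .
qed

text \<open>
  For normal \<open>N\<close> the characters of \<open>U\<close> that vanish on \<open>U \<inter> N\<close> come from the subgroup \<open>UN/N\<close> of \<open>G/N\<close>.
\<close>

lemma vanishing_chars_le_max_subgroup_rank:
  assumes N: "fin_sub N" "N \<lhd> G" and U: "fin_sub U"
  shows "card {\<theta> \<in> chars U. \<forall>x\<in>U \<inter> N. \<theta> x = 0} \<le> p ^ max_subgroup_rank p (G Mod N)"
proof -
  let ?Z = "{\<theta> \<in> chars U. \<forall>x\<in>U \<inter> N. \<theta> x = 0}"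
  define Q where "Q = G Mod N"
  let ?T = "discrete_topology (carrier Q)"
  note sU = fin_subD(1,2)[OF U] and sN = fin_subD(1)[OF N(1)]
  have UG: "U \<subseteq> carrier G" using U by (rule fin_sub_subset)
  interpret N: normal N G by (rule N(2))
  have grpQ: "group Q" unfolding Q_def by (rule N.factorgroup_is_group)
  interpret Q: discrete_or_profinite_mod Q ?T p
    using grpQ topological_group_discrete[OF grpQ] prime
    by (simp add: discrete_or_profinite_mod_def discrete_or_profinite_mod_axioms_def
        discrete_or_profinite_def discrete_or_profinite_axioms_def)
  define c where "c x = N #> x" for x
  have carQ: "carrier Q = c ` carrier G" by (simp add: Q_def c_def carrier_FactGroup)
  have finQ: "finite (carrier Q)"
    using index_pos_iff[OF subgroup_ne[OF subgroup_self], of N] fin_subD(3)[OF N(1)] by (simp add: carQ c_def)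
  have c_mult: "c (x \<otimes> y) = c x \<otimes>\<^bsub>Q\<^esub> c y" if "x \<in> carrier G" "y \<in> carrier G" for x y
    using N.rcos_sum[OF that] by (simp add: c_def Q_def)
  have "group_hom G Q c"
    using c_mult carQ by (intro group_hom.intro group_hom_axioms.intro is_group grpQ) (auto simp: hom_def)
  then have sH: "subgroup (c ` U) Q" using sU(1) by (rule group_hom.subgroup_img_is_subgroup)
  have HQ: "c ` U \<subseteq> carrier Q" using sH by (rule subgroup.subset)
  have clH: "closedin ?T (c ` U)" using HQ by simp
  have finH: "finite (c ` U)" using HQ finQ by (rule finite_subset)
  have finC: "finite (Q.chars (c ` U))"
    using finH by (intro finite_subset[OF _ finite_PiE[of "c ` U" "\<lambda>_. {0..<int p}"]]) (auto simp: characters_def)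
  have "?Z \<subseteq> (\<lambda>\<psi>. \<lambda>x\<in>U. \<psi> (c x)) ` Q.chars (c ` U)"
  proof
    fix \<theta> assume "\<theta> \<in> ?Z"
    then have \<theta>: "\<theta> \<in> chars U" and van: "\<And>x. x \<in> U \<inter> N \<Longrightarrow> \<theta> x = 0" by auto
    have "\<exists>\<psi>\<in>Q.chars (c ` U). \<theta> = (\<lambda>x\<in>U. \<psi> (c x))"
    proof (rule vanishing_subset_pullback[OF sU _ _ \<theta>])
      show "c (x \<otimes> y) = c x \<otimes>\<^bsub>Q\<^esub> c y" if "x \<in> U" "y \<in> U" for x y
        using that UG by (intro c_mult) auto
      show "closedin ?T (c ` C)" if "C \<subseteq> U" for C
        using image_mono[OF that, of c] HQ by simp
      fix x y assume xy: "x \<in> U" "y \<in> U" "c x = c y"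
      have "x \<otimes> inv y \<in> N" using xy UG rcoset_eq_iff[OF sN, of x y] by (auto simp: c_def)
      moreover have "x \<otimes> inv y \<in> U" using xy sU(1) by (simp add: subgroup.m_closed subgroup.m_inv_closed)
      ultimately have "\<theta> (x \<otimes> inv y) = 0" by (intro van IntI)
      then show "\<theta> x = \<theta> y" using char_eq_iff[OF sU \<theta> xy(1,2)] by simp
    qed
    then show "\<theta> \<in> (\<lambda>\<psi>. \<lambda>x\<in>U. \<psi> (c x)) ` Q.chars (c ` U)" by (elim bexE) (rule image_eqI)
  qed
  then have "card ?Z \<le> card (Q.chars (c ` U))" by (rule surj_card_le[OF finC])
  also have "\<dots> = p ^ d_p_sub p Q ?T (c ` U)" by (rule Q.card_chars_eq_power_d_p_sub[OF sH clH finC])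
  also have "\<dots> \<le> p ^ max_subgroup_rank p Q"
  proof -
    have "{H. subgroup H Q} \<subseteq> Pow (carrier Q)" using subgroup.subset by fast
    then have "finite {H. subgroup H Q}" using finQ by (rule finite_subset[OF _ finite_Pow_iff[THEN iffD2]])
    then have "d_p_sub p Q ?T (c ` U) \<le> max_subgroup_rank p Q"
      unfolding max_subgroup_rank_def using sH by (intro Max_ge) auto
    then show ?thesis using p_pos by (simp add: power_increasing)
  qed
  finally show ?thesis by (simp add: Q_def)
qed

end

context power_coordinates begin

text \<open>
  Since \<open>N\<close> lies in every open subgroup of index \<open>p\<close>, a proper open subgroup \<open>U\<close> of index \<open>p\<^sup>m\<close> meets \<open>N\<close> in a
  subgroup of index at most \<open>p\<^sup>m\<^sup>-\<^sup>1\<close>. This gain of one pays for the additive constant \<open>C\<close> and for the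
  multiplication of \<open>d\<close> by \<open>card I\<close>.
\<close>

lemma card_chars_level_le:
  assumes fin: "finite (chars (carrier G))" and d: "card (chars (carrier G)) = p ^ d"
    and killed: "\<forall>\<theta>\<in>chars (carrier G). \<forall>x\<in>N. \<theta> x = 0"
    and C: "\<And>U. fin_sub U \<Longrightarrow> card {\<theta> \<in> chars U. \<forall>x\<in>U \<inter> N. \<theta> x = 0} \<le> p ^ C"
    and k: "card I = Suc k"
    and U: "U \<in> level m"
  shows "finite (chars U) \<and> card (chars U) \<le> p ^ ((C + k * d) * m + d)"
  using U
proof (induction m arbitrary: U rule: less_induct)
  case (less m)
  have U: "fin_sub U" "index G (carrier G) U = p ^ m" using less.prems by (simp_all add: level_def)
  show ?case
  proof (cases "m = 0")
    case True
    then have "U = carrier G" using less.prems level_0 by simp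
    then show ?thesis using fin d True by simp
  next
    case False
    then obtain m' where m': "m = Suc m'" by (cases m) auto
    have ne: "U \<noteq> carrier G" using U(2) index_self[OF subgroup_self] p_gt_1 m' by auto
    note sU = fin_subD(1,2)[OF U(1)]
    define W where "W = U \<inter> N"
    have fsW: "fin_sub W" unfolding W_def by (rule fin_sub_inter[OF U(1) fin_sub_N])
    have WN: "W \<subseteq> N" and WU: "W \<subseteq> U" by (auto simp: W_def)
    \<comment> \<open>\<open>U\<close> and \<open>N\<close> lie in a common subgroup of index \<open>p\<close>, so \<open>N\<close> meets at most \<open>p\<^sup>m\<^sup>-\<^sup>1\<close> cosets of \<open>U\<close>.\<close>
    obtain \<theta> where \<theta>: "\<theta> \<in> chars (carrier G)" "\<And>u. u \<in> U \<Longrightarrow> \<theta> u = 0"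
      "index G (carrier G) {x\<in>carrier G. \<theta> x = 0} = p"
      using char_vanishing_on_proper[OF U(1) ne] by blast
    let ?M = "{x\<in>carrier G. \<theta> x = 0}"
    have sM: "subgroup ?M G" by (rule char_kernel(1)[OF subgroup_self closedin_carrier \<theta>(1)])
    have UM: "U \<subseteq> ?M" using fin_sub_subset[OF U(1)] \<theta>(2) by blast
    have NM: "N \<subseteq> ?M" using N_subset killed \<theta>(1) by blast
    have "index G (carrier G) U = index G (carrier G) ?M * index G ?M U"
      using sU(1) sM subgroup_self UM by (rule index_mult) blast
    then have iMU: "index G ?M U = p ^ m'" using U(2) \<theta>(3) m' p_pos by simp
    have "index G N W = index G N U" unfolding W_def using index_inter[OF sU(1) sub_N] by (simp add: Int_commute)
    also have "\<dots> \<le> index G ?M U"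
      using iMU p_pos NM subgroup_ne[OF sub_N] by (intro index_pos_subset(2)) auto
    finally have iNW: "index G N W \<le> p ^ m'" using iMU by simp
    obtain V where V: "\<forall>i\<in>I. fin_sub (V i)" "(\<Prod>i\<in>I. index G (carrier G) (V i)) = index G N W"
      "(\<forall>i\<in>I. finite (chars (V i))) \<longrightarrow>
        finite (chars W) \<and> card (chars W) \<le> (\<Prod>i\<in>I. card (chars (V i)))"
      using power_filtration[OF fsW WN] by (elim exE conjE)
    define e where "e i = (SOME j. V i \<in> level j)" for i
    have e: "V i \<in> level (e i)" if "i \<in> I" for i
      unfolding e_def by (rule someI_ex, rule fin_sub_level, rule bspec[OF V(1) that])
    have "(\<Prod>i\<in>I. index G (carrier G) (V i)) = (\<Prod>i\<in>I. p ^ e i)"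
      using e by (intro prod.cong refl) (simp add: level_def)
    also have "\<dots> = p ^ (\<Sum>i\<in>I. e i)" by (simp add: power_sum)
    finally have "p ^ (\<Sum>i\<in>I. e i) \<le> p ^ m'" using V(2) iNW by simp
    then have sum_e: "(\<Sum>i\<in>I. e i) \<le> m'" by (rule power_le_imp_le_exp[OF p_gt_1])
    let ?A = "C + k * d"
    have IH: "finite (chars (V i)) \<and> card (chars (V i)) \<le> p ^ (?A * e i + d)" if i: "i \<in> I" for i
    proof (rule less.IH[OF _ e[OF i]])
      have "e i \<le> (\<Sum>i\<in>I. e i)" using finite_I i by (intro member_le_sum) auto
      then show "e i < m" using sum_e m' by simp
    qed
    then have W: "finite (chars W)" "card (chars W) \<le> (\<Prod>i\<in>I. card (chars (V i)))"
      using V(3) by simp_all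
    have "(\<Prod>i\<in>I. card (chars (V i))) \<le> (\<Prod>i\<in>I. p ^ (?A * e i + d))"
      using IH by (intro prod_mono) simp
    also have "\<dots> = p ^ (\<Sum>i\<in>I. ?A * e i + d)" by (simp add: power_sum)
    also have "(\<Sum>i\<in>I. ?A * e i + d) = ?A * (\<Sum>i\<in>I. e i) + Suc k * d"
      using k by (simp only: sum.distrib sum_distrib_left sum_constant of_nat_id)
    also have "p ^ (?A * (\<Sum>i\<in>I. e i) + Suc k * d) \<le> p ^ (?A * m' + Suc k * d)"
      using sum_e p_pos by (intro power_increasing add_right_mono mult_left_mono) auto
    finally have cW: "card (chars W) \<le> p ^ (?A * m' + Suc k * d)" using W(2) by linarith
    let ?Z = "{\<theta> \<in> chars U. \<forall>x\<in>W. \<theta> x = 0}"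
    have finZ: "finite ?Z" unfolding W_def by (rule vanishing_chars_le_index(1)[OF fin_sub_N U(1)])
    have cZ: "card ?Z \<le> p ^ C" unfolding W_def by (rule C[OF U(1)])
    note le = card_chars_le_restrict[OF sU fin_subD(1,2)[OF fsW] WU W(1) finZ]
    have "card (chars U) \<le> p ^ C * p ^ (?A * m' + Suc k * d)"
      using le(2) mult_le_mono[OF cZ cW] by linarith
    also have "\<dots> = p ^ (?A * m + d)" by (simp add: m' power_add[symmetric] algebra_simps)
    finally show ?thesis using le(1) by simp
  qed
qed

text \<open>
  The subgroups \<open>U\<^sup>I \<le> N\<close> have larger index than \<open>U\<close>, so that there are subgroups of arbitrarily large index, and
  above them subgroups of every smaller \<open>p\<close>-power index.
\<close>

lemma level_nonempty:
  assumes "N \<noteq> carrier G" "I \<noteq> {}"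
  shows "level m \<noteq> {}"
proof -
  have "\<exists>U M. U \<in> level M \<and> m \<le> M"
  proof (induction m)
    case 0
    show ?case using level_0 by blast
  next
    case (Suc m)
    then obtain U M where U: "U \<in> level M" "m \<le> M" by blast
    then have fsU: "fin_sub U" and iU: "index G (carrier G) U = p ^ M" by (simp_all add: level_def)
    let ?P = "product_sub (\<lambda>_. U)"
    obtain l where l: "N \<in> level l" using fin_sub_level[OF fin_sub_N] by blast
    have "l \<noteq> 0"
    proof
      assume "l = 0" then show False using l level_0 assms(1) by simp
    qed
    have "index G (carrier G) ?P = p ^ l * (p ^ M) ^ card I"
      using product_sub(2)[of "\<lambda>_. U"] fsU iU l by (simp add: level_def)
    then have "?P \<in> level (l + M * card I)"
      using product_sub(1)[of "\<lambda>_. U"] fsU by (simp add: level_def power_add power_mult)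
    moreover have "1 \<le> card I" using assms(2) finite_I by (simp add: Suc_le_eq card_gt_0_iff)
    then have "M * 1 \<le> M * card I" by (rule mult_le_mono2)
    then have "Suc m \<le> l + M * card I" using U(2) \<open>l \<noteq> 0\<close> by linarith
    ultimately show ?case by blast
  qed
  then obtain U M where U: "U \<in> level M" "m \<le> M" by blast
  then have "\<exists>V. fin_sub V \<and> U \<subseteq> V \<and> index G (carrier G) V = p ^ m"
    by (intro fin_sub_of_smaller_index) (auto simp: level_def)
  then show ?thesis by (auto simp: level_def)
qed

text \<open>
  Choose subgroups \<open>U\<^sub>i\<close> of index \<open>p\<^bsup>m i\<^esup>\<close> that attain the maximum and consider \<open>\<Prod>U\<^sub>i \<le> N\<close>.
\<close>

lemma d_p_max_superadditive:
  assumes fin: "\<And>m. finite (level m)" "\<And>m. level m \<noteq> {}" "\<And>U. fin_sub U \<Longrightarrow> finite (chars U)"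
    and N: "N \<in> level l"
  shows "(\<Sum>i\<in>I. d_p_max p G T (m i)) \<le> d_p_max p G T (l + (\<Sum>i\<in>I. m i))"
proof -
  have "\<forall>i. \<exists>U. U \<in> level (m i) \<and> card (chars U) = p ^ d_p_max p G T (m i)"
  proof
    fix i
    have "finite (chars U)" if "U \<in> level (m i)" for U using that fin(3) by (simp add: level_def)
    then show "\<exists>U. U \<in> level (m i) \<and> card (chars U) = p ^ d_p_max p G T (m i)"
      using d_p_max_attained[OF fin(1,2), of "m i"] by blast
  qed
  from choice[OF this]
  obtain U where "\<forall>i. U i \<in> level (m i) \<and> card (chars (U i)) = p ^ d_p_max p G T (m i)" by (elim exE)
  then have U: "\<And>i. U i \<in> level (m i)" "\<And>i. card (chars (U i)) = p ^ d_p_max p G T (m i)" by simp_all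
  have fsU: "fin_sub (U i)" for i using U(1)[of i] by (simp add: level_def)
  note P = product_sub[of U, OF fsU]
  have "index G (carrier G) (product_sub U) = p ^ (l + (\<Sum>i\<in>I. m i))"
    using P(2) N U(1) by (simp add: level_def power_add power_sum)
  then have lev: "product_sub U \<in> level (l + (\<Sum>i\<in>I. m i))" using P(1) by (simp add: level_def)
  have "p ^ (\<Sum>i\<in>I. d_p_max p G T (m i)) = (\<Prod>i\<in>I. card (chars (U i)))" by (simp add: U(2) power_sum)
  also have "\<dots> \<le> card (chars (product_sub U))" using fsU fin(3)[OF P(1)] by (rule prod_card_chars_le)
  also have "\<dots> \<le> p ^ d_p_max p G T (l + (\<Sum>i\<in>I. m i))"
    using fin(1) lev fin(3)[OF P(1)] by (rule card_chars_le_d_p_max)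
  finally show ?thesis by (rule power_le_imp_le_exp[OF p_gt_1])
qed

end

section \<open>A limit theorem for superadditive sequences\<close>

text \<open>
  A version of Fekete's lemma: shifting the argument by \<open>l/q\<close> turns the hypothesis into superadditivity
  for sums of \<open>q + 1\<close> terms.
\<close>

lemma superadditive_limit:
  fixes f :: "nat \<Rightarrow> nat" and q l A d :: nat
  assumes q: "0 < q" and l: "0 < l"
    and super: "\<And>m s. q * f m + f s \<le> f (q * m + l + s)"
    and lin: "\<And>m. f m \<le> A * m + d"
  defines "L \<equiv> SUP m. real (f m) / (real m + real l / real q)"
  shows "bdd_above (range (\<lambda>m. real (f m) / (real m + real l / real q)))"
    and "(\<lambda>m. real (f m) / real m) \<longlonglongrightarrow> L"
    and "real q * real (f 0) / real l \<le> L" and "L \<le> real A"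
proof -
  define c where "c = real l / real q"
  have c: "0 < c" using q l by (simp add: c_def)
  define g where "g m = real (f m) / (real m + c)" for m
  have lin': "real (f m) \<le> real A * real m + real d" for m
    using lin[of m] by (simp only: of_nat_mult[symmetric] of_nat_add[symmetric] of_nat_le_iff)
  have "g m \<le> real A + real d / c" for m
  proof -
    have "(real A + real d / c) * (real m + c)
        = real A * real m + real d + (real A * c + real d / c * real m)"
      using c by (simp add: distrib_left distrib_right)
    moreover have "0 \<le> real A * c + real d / c * real m" using c by simp
    ultimately have "real A * real m + real d \<le> (real A + real d / c) * (real m + c)" by linarith
    then show ?thesis using lin'[of m] c by (simp add: g_def pos_divide_le_eq)
  qed
  then have bdd: "bdd_above (range g)" by (intro bdd_aboveI[of _ "real A + real d / c"]) auto
  then show "bdd_above (range (\<lambda>m. real (f m) / (real m + real l / real q)))"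
    by (simp add: g_def c_def)
  have L: "L = (SUP m. g m)" by (simp add: L_def g_def c_def)
  have gL: "g m \<le> L" for m unfolding L using bdd by (rule cSUP_upper[rotated]) simp
  show "real q * real (f 0) / real l \<le> L" using gL[of 0] q l by (simp add: g_def c_def field_simps)
  have iter: "j * (q * f m) \<le> f (j * (q * m + l) + s)" for j m s
  proof (induction j)
    case (Suc j)
    have "Suc j * (q * f m) \<le> q * f m + f (j * (q * m + l) + s)" using Suc by simp
    also have "\<dots> \<le> f (q * m + l + (j * (q * m + l) + s))" by (rule super)
    finally show ?case by (simp add: algebra_simps)
  qed simp
  have upper: "real (f m) / real m \<le> L * (1 + c * (1 / real m))" if "0 < m" for m
  proof -
    have "real (f m) = g m * (real m + c)" using c by (simp add: g_def)
    also have "\<dots> \<le> L * (real m + c)" using gL[of m] c by (intro mult_right_mono) auto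
    also have "\<dots> = L * (1 + c * (1 / real m)) * real m" using that by (simp add: field_simps)
    finally show ?thesis using that by (simp add: pos_divide_le_eq)
  qed
  \<comment> \<open>divide \<open>m\<close> by \<open>q m0 + l\<close> and iterate the hypothesis\<close>
  have lower: "(1 / real (q * m0 + l) - 1 / real m) * real (q * f m0) \<le> real (f m) / real m" if "0 < m" for m m0
  proof -
    define D where "D = q * m0 + l"
    have D: "0 < D" using l by (simp add: D_def)
    have m: "m div D * D + m mod D = m" by (rule div_mult_mod_eq)
    have "m div D * (q * f m0) \<le> f m" using iter[of "m div D" m0 "m mod D"] by (simp add: D_def[symmetric] m)
    then have le: "real (m div D) * real (q * f m0) \<le> real (f m)"
      by (simp only: of_nat_mult[symmetric] of_nat_le_iff)
    have "m mod D < D" using D by (rule mod_less_divisor)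
    then have "m \<le> (m div D + 1) * D" using m unfolding add_mult_distrib by linarith
    then have "real m \<le> real ((m div D + 1) * D)" by (simp only: of_nat_le_iff)
    then have "real m / real D \<le> real (m div D) + 1" using D by (simp add: pos_divide_le_eq distrib_right)
    then have "(real m / real D - 1) * real (q * f m0) \<le> real (m div D) * real (q * f m0)"
      by (intro mult_right_mono) simp_all
    with le have "(real m / real D - 1) * real (q * f m0) \<le> real (f m)" by linarith
    moreover have "(1 / real D - 1 / real m) * real (q * f m0) = (real m / real D - 1) * real (q * f m0) / real m"
      using that D by (simp add: field_simps)
    ultimately show ?thesis using that unfolding D_def by (simp add: divide_right_mono)
  qed
  have inv0: "(\<lambda>m. 1 / real m) \<longlonglongrightarrow> 0" by (rule lim_1_over_n)
  have pos: "eventually (\<lambda>m::nat. 0 < m) sequentially" by (rule eventually_gt_at_top)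
  show lim: "(\<lambda>m. real (f m) / real m) \<longlonglongrightarrow> L"
  proof (rule order_tendstoI)
    fix a assume "a < L"
    then obtain m0 where m0: "a < g m0" unfolding L using bdd by (auto simp: less_cSUP_iff)
    have "(\<lambda>m. (1 / real (q * m0 + l) - 1 / real m) * real (q * f m0))
        \<longlonglongrightarrow> (1 / real (q * m0 + l) - 0) * real (q * f m0)"
      by (intro tendsto_intros inv0)
    also have "(1 / real (q * m0 + l) - 0) * real (q * f m0) = g m0"
      using q l by (simp add: g_def c_def field_simps)
    finally have "eventually (\<lambda>m. a < (1 / real (q * m0 + l) - 1 / real m) * real (q * f m0)) sequentially"
      using m0 by (rule order_tendstoD)
    then show "eventually (\<lambda>m. a < real (f m) / real m) sequentially"
      using pos
    proof eventually_elim
      case (elim m)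
      then show ?case using lower[of m m0] by linarith
    qed
  next
    fix a assume a: "L < a"
    have "(\<lambda>m. L * (1 + c * (1 / real m))) \<longlonglongrightarrow> L * (1 + c * 0)"
      by (intro tendsto_intros inv0)
    then have "eventually (\<lambda>m. L * (1 + c * (1 / real m)) < a) sequentially"
      using a by (intro order_tendstoD) auto
    then show "eventually (\<lambda>m. real (f m) / real m < a) sequentially"
      using pos
    proof eventually_elim
      case (elim m)
      then show ?case using upper[of m] by linarith
    qed
  qed
  have "(\<lambda>m. real A + real d * (1 / real m)) \<longlonglongrightarrow> real A + real d * 0"
    by (intro tendsto_intros inv0)
  then have limA: "(\<lambda>m. real A + real d * (1 / real m)) \<longlonglongrightarrow> real A" by simp
  have "eventually (\<lambda>m. real (f m) / real m \<le> real A + real d * (1 / real m)) sequentially"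
    using pos
  proof eventually_elim
    case (elim m)
    then show ?case using lin'[of m] by (simp add: field_simps)
  qed
  then show "L \<le> real A" by (rule tendsto_le[OF sequentially_bot limA lim])
qed

section \<open>Subgroup growth\<close>

context power_coordinates begin

text \<open>
  A nontrivial character of \<open>G\<close> maps \<open>N\<close> onto \<open>\<F>\<^sub>p\<^sup>I\<close>. The subspaces of \<open>\<F>\<^sub>p\<^sup>I\<close> that are given by the equations
  \<open>x\<^sub>i + \<Sum>t\<in>I - J. A (i, t) x\<^sub>t = 0\<close> for \<open>i \<in> J\<close> are pairwise distinct for distinct \<open>A\<close>.
\<close>

lemma card_subgroups_ge:
  assumes ne: "N \<noteq> carrier G" and J: "J \<subseteq> I" "J \<noteq> {}"
    and fin: "finite {W. fin_sub W \<and> index G (carrier G) W = index G (carrier G) N * p ^ card J}"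
  shows "p ^ (card J * card (I - J))
    \<le> card {W. fin_sub W \<and> index G (carrier G) W = index G (carrier G) N * p ^ card J}"
proof -
  note self = subgroup_self closedin_carrier
  have finJ: "finite J" using J(1) finite_I by (rule finite_subset)
  obtain \<theta> where \<theta>: "\<theta> \<in> chars (carrier G)" "index G (carrier G) {x\<in>carrier G. \<theta> x = 0} = p"
    using char_vanishing_on_proper[OF fin_sub_N ne] by blast
  have "\<theta> ` carrier G \<subseteq> {0..<int p}" using char_range[OF self \<theta>(1)] by auto
  moreover have "card (\<theta> ` carrier G) = card {0..<int p}" using char_kernel(3)[OF self \<theta>(1)] \<theta>(2) by simp
  ultimately have \<theta>_surj: "\<theta> ` carrier G = {0..<int p}" by (intro card_subset_eq) simp_all
  define \<psi> where "\<psi> t = (\<lambda>x\<in>N. \<theta> (\<pi> t x))" for t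
  have \<psi>: "\<psi> t \<in> chars N" if t: "t \<in> I" for t
    unfolding \<psi>_def using coord_closed[OF t]
    by (intro char_coord[OF t sub_N closed_N subset_refl _ \<theta>(1)]) auto
  have real: "\<exists>x\<in>N. \<forall>t\<in>I. \<psi> t x = h t" if h: "\<forall>t\<in>I. h t \<in> {0..<int p}" for h
  proof -
    have "\<forall>t\<in>I. \<exists>y. y \<in> carrier G \<and> \<theta> y = h t"
    proof
      fix t assume "t \<in> I"
      then have "h t \<in> \<theta> ` carrier G" using h \<theta>_surj by simp
      then show "\<exists>y. y \<in> carrier G \<and> \<theta> y = h t" by auto
    qed
    from bchoice[OF this] obtain y where y: "\<forall>t\<in>I. y t \<in> carrier G \<and> \<theta> (y t) = h t" by (elim exE)
    then have "\<forall>t\<in>I. y t \<in> carrier G" by blast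
    from bexE[OF coord_surj[OF this]] obtain x where x: "x \<in> N" "\<forall>t\<in>I. \<pi> t x = y t" by blast
    have "\<forall>t\<in>I. \<psi> t x = h t" using x y by (simp add: \<psi>_def)
    then show ?thesis using x(1) by blast
  qed
  define coef where "coef A i t = (if t = i then 1 else if t \<in> J then 0 else A (i, t))"
    for A :: "'i \<times> 'i \<Rightarrow> int" and i t
  define \<eta> where "\<eta> A i = (\<lambda>x\<in>N. (\<Sum>t\<in>I. coef A i t * \<psi> t x) mod int p)" for A i
  have \<eta>: "\<eta> A i \<in> chars N" for A i
    unfolding \<eta>_def by (rule char_lincomb[OF sub_N closed_N finite_I \<psi>])
  have \<eta>_val: "\<eta> A i x = (\<psi> i x + (\<Sum>t\<in>I - J. A (i, t) * \<psi> t x)) mod int p" if "x \<in> N" "i \<in> J" for A i x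
  proof -
    have "(\<Sum>t\<in>I. coef A i t * \<psi> t x) = (\<Sum>t\<in>I - J. coef A i t * \<psi> t x) + (\<Sum>t\<in>J. coef A i t * \<psi> t x)"
      using J(1) finite_I by (rule sum.subset_diff)
    also have "(\<Sum>t\<in>I - J. coef A i t * \<psi> t x) = (\<Sum>t\<in>I - J. A (i, t) * \<psi> t x)"
      using that by (intro sum.cong refl) (auto simp: coef_def)
    also have "(\<Sum>t\<in>J. coef A i t * \<psi> t x) = (\<Sum>t\<in>J. if t = i then \<psi> i x else 0)"
      by (intro sum.cong refl) (simp add: coef_def)
    also have "\<dots> = \<psi> i x" using that finJ by simp
    finally show ?thesis using that by (simp add: \<eta>_def add.commute)
  qed
  define W where "W A = {x\<in>N. \<forall>i\<in>J. \<eta> A i x = 0}" for A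
  have W_Inter: "W A = (\<Inter>i\<in>J. {x\<in>N. \<eta> A i x = 0})" for A using J(2) by (auto simp: W_def)
  have sW: "subgroup (W A) G" for A
    unfolding W_Inter using J(2) char_kernel(1)[OF sub_N closed_N \<eta>] by (intro subgroups_Inter) auto
  have clW: "closedin T (W A)" for A
    unfolding W_Inter using J(2) char_kernel(2)[OF sub_N closed_N \<eta>] by (intro closedin_INT) auto
  have iNW: "index G N (W A) = p ^ card J" for A
  proof -
    have "index G N (W A) = card ((\<lambda>x. \<lambda>i\<in>J. \<eta> A i x) ` N)"
    proof (rule index_eq_card_image[OF sW N_subset])
      fix x y assume xy: "x \<in> N" "y \<in> N"
      then have "x \<otimes> inv y \<in> N" using sub_N by (simp add: subgroup.m_closed subgroup.m_inv_closed)
      then have "x \<otimes> inv y \<in> W A \<longleftrightarrow> (\<forall>i\<in>J. \<eta> A i x = \<eta> A i y)"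
        using char_eq_iff[OF sub_N closed_N \<eta> xy] by (simp add: W_def)
      then show "(\<lambda>i\<in>J. \<eta> A i x) = (\<lambda>i\<in>J. \<eta> A i y) \<longleftrightarrow> x \<otimes> inv y \<in> W A"
        by (simp only: restrict_eq_iff)
    qed
    also have "(\<lambda>x. \<lambda>i\<in>J. \<eta> A i x) ` N = J \<rightarrow>\<^sub>E {0..<int p}"
    proof (intro equalityI subsetI)
      fix h assume "h \<in> (\<lambda>x. \<lambda>i\<in>J. \<eta> A i x) ` N"
      then obtain x where x: "x \<in> N" "h = (\<lambda>i\<in>J. \<eta> A i x)" by (elim imageE)
      then show "h \<in> J \<rightarrow>\<^sub>E {0..<int p}"
        using char_range[OF sub_N closed_N \<eta> x(1)] by (simp add: restrict_PiE_iff)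
    next
      fix h assume h: "h \<in> J \<rightarrow>\<^sub>E {0..<int p}"
      have hJ: "h i \<in> {0..<int p}" if "i \<in> J" for i using PiE_mem[OF h that] .
      have "\<forall>t\<in>I. (if t \<in> J then h t else 0) \<in> {0..<int p}" using hJ p_pos by simp
      from bexE[OF real[OF this]]
      obtain x where x: "x \<in> N" "\<forall>t\<in>I. \<psi> t x = (if t \<in> J then h t else 0)" by blast
      have "h = (\<lambda>i\<in>J. \<eta> A i x)"
      proof (rule extensionalityI[of _ J])
        show "h \<in> extensional J" using h by (simp add: PiE_iff)
        fix i assume i: "i \<in> J"
        have "\<psi> i x = h i" using x(2) i J(1) by auto
        moreover have "(\<Sum>t\<in>I - J. A (i, t) * \<psi> t x) = 0" using x(2) by (intro sum.neutral) auto
        ultimately show "h i = (\<lambda>i\<in>J. \<eta> A i x) i" using \<eta>_val[OF x(1) i] hJ[OF i] i by simp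
      qed simp
      then show "h \<in> (\<lambda>x. \<lambda>i\<in>J. \<eta> A i x) ` N" using x(1) by (rule image_eqI)
    qed
    finally show ?thesis using finJ by (simp add: card_PiE)
  qed
  have WS: "W A \<in> {W. fin_sub W \<and> index G (carrier G) W = index G (carrier G) N * p ^ card J}" for A
  proof -
    have "index G (carrier G) (W A) = index G (carrier G) N * index G N (W A)"
      using sW sub_N subgroup_self _ N_subset by (rule index_mult) (auto simp: W_def)
    then show ?thesis using sW clW iNW fin_subD(3)[OF fin_sub_N] p_pos by (simp add: fin_sub_def)
  qed
  let ?M = "(J \<times> (I - J)) \<rightarrow>\<^sub>E {0..<int p}"
  have "inj_on W ?M"
  proof (rule inj_onI, rule ccontr)
    fix A B assume AB: "A \<in> ?M" "B \<in> ?M" "W A = W B" "A \<noteq> B"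
    then obtain i t where it: "i \<in> J" "t \<in> I - J" "A (i, t) \<noteq> B (i, t)"
      using PiE_ext[OF AB(1,2)] by auto
    \<comment> \<open>a point of the subspace for \<open>A\<close> at which the \<open>i\<close>-th equation for \<open>B\<close> fails\<close>
    define h where "h s = (if s \<in> J then (- A (s, t)) mod int p else if s = t then 1 else 0)" for s
    have "\<forall>s\<in>I. h s \<in> {0..<int p}" using p_gt_1 by (simp add: h_def)
    from bexE[OF real[OF this]] obtain x where x: "x \<in> N" "\<forall>s\<in>I. \<psi> s x = h s" by blast
    have val: "\<eta> D s x = (- A (s, t) + D (s, t)) mod int p" if s: "s \<in> J" for D s
    proof -
      have "(\<Sum>u\<in>I - J. D (s, u) * \<psi> u x) = (\<Sum>u\<in>I - J. if u = t then D (s, t) else 0)"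
        using x(2) by (intro sum.cong refl) (simp add: h_def)
      also have "\<dots> = D (s, t)" using it(2) finite_I by simp
      finally have "\<eta> D s x = ((- A (s, t)) mod int p + D (s, t)) mod int p"
        using \<eta>_val[OF x(1) s] x(2) s J(1) by (auto simp: h_def)
      then show ?thesis by (simp only: mod_add_left_eq)
    qed
    have "x \<in> W A" using x(1) val by (simp add: W_def)
    then have "x \<in> W B" using AB(3) by simp
    then have "\<eta> B i x = 0" using it(1) by (simp add: W_def)
    then have "(B (i, t) - A (i, t)) mod int p = 0" using val[OF it(1), of B] by (simp add: algebra_simps)
    then have "B (i, t) mod int p = A (i, t) mod int p" by (simp add: mod_eq_dvd_iff dvd_eq_mod_eq_0)
    moreover have "A (i, t) \<in> {0..<int p}" "B (i, t) \<in> {0..<int p}"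
      using PiE_mem[OF AB(1)] PiE_mem[OF AB(2)] it by auto
    ultimately show False using it(3) by simp
  qed
  then have "card ?M \<le> card {W. fin_sub W \<and> index G (carrier G) W = index G (carrier G) N * p ^ card J}"
    using WS fin by (intro card_inj_on_le) auto
  moreover have "card ?M = p ^ (card J * card (I - J))"
    using finJ finite_I by (simp add: card_PiE card_cartesian_product)
  ultimately show ?thesis by simp
qed

end

context p_power_index begin

lemma subgroups_index_le_eq:
  "subgroups_index_le G T n = {U. fin_sub U \<and> index G (carrier G) U \<le> n}"
proof -
  have "finite (rcosets U) \<longleftrightarrow> 0 < index G (carrier G) U" for U
    by (simp add: index_pos_iff[OF subgroup_ne[OF subgroup_self]] rcosets_eq_image)
  then show ?thesis by (auto simp: subgroups_index_le_def closed_subgroup_def fin_sub_def card_rcosets)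
qed

lemma subgroups_index_le_levels:
  "subgroups_index_le G T n = (\<Union>m\<in>{m. p ^ m \<le> n}. level m)"
proof (intro equalityI subsetI)
  fix U assume "U \<in> subgroups_index_le G T n"
  then have U: "fin_sub U" "index G (carrier G) U \<le> n" by (simp_all add: subgroups_index_le_eq)
  obtain m where "U \<in> level m" using fin_sub_level[OF U(1)] by (elim exE)
  then show "U \<in> (\<Union>m\<in>{m. p ^ m \<le> n}. level m)" using U(2) by (auto simp: level_def)
qed (auto simp: subgroups_index_le_eq level_def)

lemma powr_log_powr:
  assumes "1 \<le> n"
  shows "(real n powr log (real p) (real n)) powr a = real p powr (a * (log (real p) (real n))\<^sup>2)"
proof -
  have "real n = real p powr log (real p) (real n)" using assms p_gt_1 by simp
  then have "real n powr log (real p) (real n) = real p powr (log (real p) (real n) * log (real p) (real n))"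
    by (metis powr_powr)
  then show ?thesis by (simp add: powr_powr power2_eq_square mult.commute)
qed

text \<open>
  There are at most \<open>p\<close> to the power \<open>\<Sum>i<m. (A i + d) \<le> (A + d) m\<^sup>2\<close> subgroups of index \<open>p\<^sup>m\<close>, and \<open>m \<le> log n\<close> if \<open>p\<^sup>m \<le> n\<close>.
\<close>

lemma subgroup_growth_upper:
  assumes chars: "\<And>m U. U \<in> level m \<Longrightarrow> finite (chars U) \<and> card (chars U) \<le> p ^ (A * m + d)"
  shows "finite (subgroups_index_le G T n)"
    and "1 \<le> n \<Longrightarrow> real (card (subgroups_index_le G T n))
      \<le> (real n powr log (real p) (real n)) powr real (A + d + 1)"
proof -
  have level: "finite (level m)" "card (level m) \<le> p ^ ((A + d) * m\<^sup>2)" for m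
  proof -
    note le = card_level_le[of "\<lambda>m. A * m + d" m, OF chars]
    then show "finite (level m)" by simp
    have "(\<Sum>i<m. A * i + d) \<le> (\<Sum>i<m. (A + d) * m)"
    proof (rule sum_mono)
      fix i assume "i \<in> {..<m}"
      then have im: "i \<le> m" "1 \<le> m" by auto
      have "A * i \<le> A * m" using im(1) by (rule mult_le_mono2)
      moreover have "d * 1 \<le> d * m" using im(2) by (rule mult_le_mono2)
      ultimately show "A * i + d \<le> (A + d) * m" unfolding add_mult_distrib by linarith
    qed
    also have "\<dots> = (A + d) * m\<^sup>2" by (simp add: power2_eq_square)
    finally have "p ^ (\<Sum>i<m. A * i + d) \<le> p ^ ((A + d) * m\<^sup>2)" using p_pos by (intro power_increasing) auto
    then show "card (level m) \<le> p ^ ((A + d) * m\<^sup>2)" using le by linarith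
  qed
  have "m < n + 1" if "p ^ m \<le> n" for m
  proof -
    have "m < 2 ^ m" by (rule less_exp)
    also have "(2::nat) ^ m \<le> p ^ m" using p_gt_1 by (intro power_mono) auto
    finally show ?thesis using that by simp
  qed
  then have "{m. p ^ m \<le> n} \<subseteq> {..<n + 1}" by blast
  then have fin: "finite {m. p ^ m \<le> n}" by (rule finite_subset) simp
  show "finite (subgroups_index_le G T n)"
    unfolding subgroups_index_le_levels using fin level(1) by (intro finite_UN_I)
  assume n: "1 \<le> n"
  define M where "M = Max {m. p ^ m \<le> n}"
  have "0 \<in> {m. p ^ m \<le> n}" using n by simp
  then have "{m. p ^ m \<le> n} \<noteq> {}" by blast
  then have "M \<in> {m. p ^ m \<le> n}" unfolding M_def by (rule Max_in[OF fin])
  then have M: "p ^ M \<le> n" by (rule CollectD)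
  have sub: "{m. p ^ m \<le> n} \<subseteq> {..M}" using fin by (auto simp: M_def)
  have "card (subgroups_index_le G T n) \<le> (\<Sum>m\<in>{m. p ^ m \<le> n}. card (level m))"
    unfolding subgroups_index_le_levels using fin by (rule card_UN_le)
  also have "\<dots> \<le> (\<Sum>m\<in>{..M}. card (level m))" using sub by (intro sum_mono2) auto
  also have "\<dots> \<le> (\<Sum>m\<in>{..M}. p ^ ((A + d) * M\<^sup>2))"
  proof (rule sum_mono)
    fix m assume "m \<in> {..M}"
    then have "m\<^sup>2 \<le> M\<^sup>2" by (simp add: power_mono)
    then have "p ^ ((A + d) * m\<^sup>2) \<le> p ^ ((A + d) * M\<^sup>2)"
      using p_pos by (intro power_increasing mult_le_mono2) auto
    then show "card (level m) \<le> p ^ ((A + d) * M\<^sup>2)" using level(2)[of m] by linarith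
  qed
  also have "\<dots> = Suc M * p ^ ((A + d) * M\<^sup>2)" by simp
  also have "\<dots> \<le> p ^ M * p ^ ((A + d) * M\<^sup>2)"
  proof (rule mult_le_mono1)
    have "Suc M \<le> 2 ^ M" using less_exp[of M] by (simp add: Suc_le_eq)
    also have "(2::nat) ^ M \<le> p ^ M" using p_gt_1 by (intro power_mono) auto
    finally show "Suc M \<le> p ^ M" .
  qed
  also have "\<dots> \<le> p ^ (M\<^sup>2) * p ^ ((A + d) * M\<^sup>2)"
    using p_pos by (intro mult_le_mono1 power_increasing) (auto simp: power2_eq_square)
  also have "\<dots> = p ^ ((A + d + 1) * M\<^sup>2)" by (simp add: power_add[symmetric] add_mult_distrib)
  finally have "real (card (subgroups_index_le G T n)) \<le> real (p ^ ((A + d + 1) * M\<^sup>2))"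
    by (simp only: of_nat_le_iff)
  also have "\<dots> = real p powr real ((A + d + 1) * M\<^sup>2)"
    using p_pos by (simp only: powr_realpow of_nat_0_less_iff of_nat_power)
  also have "\<dots> \<le> real p powr (real (A + d + 1) * (log (real p) (real n))\<^sup>2)"
  proof (rule powr_mono)
    have "real p ^ M \<le> real n" using M by (simp only: of_nat_power[symmetric] of_nat_le_iff)
    then have "real p powr real M \<le> real n" using p_pos by (simp only: powr_realpow of_nat_0_less_iff)
    moreover have "1 < real p" "0 < real n" using p_gt_1 n by simp_all
    ultimately have "real M \<le> log (real p) (real n)" by (simp only: le_log_iff)
    then have "(real M)\<^sup>2 \<le> (log (real p) (real n))\<^sup>2" by (intro power_mono) auto
    then have "real (A + d + 1) * (real M)\<^sup>2 \<le> real (A + d + 1) * (log (real p) (real n))\<^sup>2"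
      by (intro mult_left_mono) auto
    then show "real ((A + d + 1) * M\<^sup>2) \<le> real (A + d + 1) * (log (real p) (real n))\<^sup>2"
      by (simp only: of_nat_mult of_nat_power)
    show "1 \<le> real p" using p_gt_1 by simp
  qed
  also have "\<dots> = (real n powr log (real p) (real n)) powr real (A + d + 1)"
    using powr_log_powr[OF n] by simp
  finally show "real (card (subgroups_index_le G T n))
      \<le> (real n powr log (real p) (real n)) powr real (A + d + 1)" .
qed

end

context self_replicating begin

text \<open>The exponents satisfy the recursion \<open>e\<^sub>n\<^sub>+\<^sub>1 = l + r e\<^sub>n\<close>, since \<open>G\<^sub>n\<^sub>+\<^sub>1\<close> is \<open>G\<^sub>n\<^sup>r\<close> inside \<open>G\<^sub>1 \<cong> G\<^sup>r\<close>.\<close>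

lemma pcs_level:
  assumes "G\<^sub>1 \<in> level l"
  obtains e where "pcs n \<in> level e" "e + l \<le> l * r ^ n"
proof -
  have "\<exists>e. pcs n \<in> level e \<and> e + l \<le> l * r ^ n"
  proof (induction n)
    case 0
    then show ?case using level_0 by auto
  next
    case (Suc n)
    then obtain e where e: "pcs n \<in> level e" "e + l \<le> l * r ^ n" by (elim exE conjE)
    then have fs: "fin_sub (pcs n)" by (simp add: level_def)
    have "pcs (Suc n) \<in> level (l + e * r)"
      using first.product_sub[of "\<lambda>_. pcs n", OF fs] assms e(1)
      by (simp add: level_def pcs_Suc power_add power_mult del: principal_congruence_subgroup.simps)
    moreover have "l + e * r + l \<le> l * r ^ Suc n"
    proof -
      have "l * 2 \<le> l * r" using r_ge_2 by (rule mult_le_mono2)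
      moreover have "(e + l) * r \<le> l * r ^ n * r" using e(2) by (rule mult_le_mono1)
      ultimately have "l * 2 + e * r \<le> l * r ^ n * r" unfolding add_mult_distrib by linarith
      then show ?thesis by (simp add: mult_ac)
    qed
    ultimately show ?case by blast
  qed
  then show ?thesis using that by (elim exE conjE)
qed

text \<open>
  Let \<open>G\<^sub>1\<close> have index \<open>p\<^sup>l\<close>. With \<open>j\<close> about half the number \<open>D\<close> of its factors, a principal congruence subgroup has at
  least \<open>p\<close> to the power \<open>j (D - j) \<ge> D\<^sup>2/8\<close> subgroups of index \<open>p\<^sup>j\<close>, and their index in \<open>G\<close> is at most
  \<open>p\<close> to the power \<open>(l + 1) D\<close>.
\<close>

lemma subgroup_growth_lower:
  assumes fin: "\<And>n. finite (subgroups_index_le G T n)"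
  shows "\<exists>b>0. \<exists>\<^sub>\<infinity>n. (real n powr log (real p) (real n)) powr b \<le> real (card (subgroups_index_le G T n))"
proof -
  obtain l where l: "G\<^sub>1 \<in> level l" using fin_sub_level[OF fin_sub_G1] by (elim exE)
  define b where "b = 1 / (8 * (real l + 1)\<^sup>2)"
  have b: "0 < b" by (simp add: b_def)
  have "\<exists>n>m. (real n powr log (real p) (real n)) powr b \<le> real (card (subgroups_index_le G T n))" for m
  proof -
    define D where "D = r ^ Suc m"
    define j where "j = D div 2"
    have D2: "2 ^ Suc m \<le> D" unfolding D_def using r_ge_2 by (rule power_mono) simp
    then have j2: "2 ^ m \<le> j" by (simp add: j_def)
    have "(1::nat) \<le> 2 ^ m" by simp
    then have D_ge: "2 \<le> D" using D2 unfolding power_Suc by linarith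
    interpret C: power_coordinates G T p "pcs (Suc m)" "words r (Suc m)" "\<lambda>w x. foldl \<phi> x w"
      by (rule pcs_power_coordinates)
    obtain e where e: "pcs (Suc m) \<in> level e" "e + l \<le> l * r ^ Suc m" using pcs_level[OF l] .
    have eD: "e \<le> l * D" using e(2) by (simp add: D_def)
    define n where "n = p ^ (e + j)"
    have ne: "pcs (Suc m) \<noteq> carrier G"
    proof
      assume "pcs (Suc m) = carrier G"
      moreover have "pcs (Suc m) \<subseteq> G\<^sub>1" unfolding pcs_Suc by (auto simp: first.product_sub_def)
      ultimately show False using G1_proper first.N_subset by blast
    qed
    have cardw: "card (words r (Suc m)) = D" by (simp only: card_words D_def)
    have "j \<le> card (words r (Suc m))" by (simp add: cardw j_def)
    then obtain J where J: "J \<subseteq> words r (Suc m)" "card J = j" by (rule obtain_subset_with_card_n)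
    have "J \<noteq> {}" using J(2) j2 one_le_power[of "2::nat" m] by auto
    have sub: "{W. fin_sub W \<and> index G (carrier G) W = index G (carrier G) (pcs (Suc m)) * p ^ card J}
      \<subseteq> subgroups_index_le G T n"
      using e(1) J(2) by (auto simp: subgroups_index_le_eq level_def n_def power_add)
    have "p ^ (card J * card (words r (Suc m) - J))
      \<le> card {W. fin_sub W \<and> index G (carrier G) W = index G (carrier G) (pcs (Suc m)) * p ^ card J}"
      using ne J(1) \<open>J \<noteq> {}\<close> finite_subset[OF sub fin] by (rule C.card_subgroups_ge)
    also have "\<dots> \<le> card (subgroups_index_le G T n)" using fin sub by (rule card_mono)
    also have "card (words r (Suc m) - J) = D - j"
      using card_Diff_subset[OF finite_subset[OF J(1) finite_words] J(1)] cardw J(2) by (simp only:)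
    finally have cnt: "p ^ (j * (D - j)) \<le> card (subgroups_index_le G T n)" using J(2) by simp
    have n1: "1 \<le> n" using p_pos by (simp add: n_def)
    have log_n: "log (real p) (real n) = real (e + j)"
      using p_gt_1 by (simp add: n_def log_nat_power)
    have jD: "real j \<le> real D / 2" "real D / 4 \<le> real j"
    proof -
      have "2 * j \<le> D" by (simp add: j_def)
      then show "real j \<le> real D / 2" by linarith
      have "D \<le> 4 * j" using D_ge by (simp add: j_def)
      then show "real D / 4 \<le> real j" by linarith
    qed
    have "b * (real (e + j))\<^sup>2 \<le> b * ((real l + 1) * real D)\<^sup>2"
    proof (intro mult_left_mono power_mono)
      have "real e \<le> real l * real D" using eD by (simp only: of_nat_mult[symmetric] of_nat_le_iff)
      then show "real (e + j) \<le> (real l + 1) * real D" using jD(1) by (simp add: algebra_simps)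
    qed (use b in auto)
    also have "\<dots> = real D / 4 * (real D / 2)"
    proof -
      have "0 < (real l + 1)\<^sup>2" by simp
      then show ?thesis by (simp add: b_def power_mult_distrib power2_eq_square[of "real D"])
    qed
    also have "\<dots> \<le> real j * real (D - j)"
      using jD by (intro mult_mono) (auto simp: j_def)
    finally have "real p powr (b * (log (real p) (real n))\<^sup>2) \<le> real p powr real (j * (D - j))"
      using p_gt_1 by (simp add: log_n)
    also have "\<dots> = real (p ^ (j * (D - j)))"
      using p_pos by (simp only: powr_realpow of_nat_0_less_iff of_nat_power)
    also have "\<dots> \<le> real (card (subgroups_index_le G T n))" using cnt by (simp only: of_nat_le_iff)
    finally have "(real n powr log (real p) (real n)) powr b \<le> real (card (subgroups_index_le G T n))"
      by (simp only: powr_log_powr[OF n1])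
    moreover have "m < n"
    proof -
      have "m < 2 ^ m" by (rule less_exp)
      also have "2 ^ m \<le> j" by (rule j2)
      also have "j < 2 ^ j" by (rule less_exp)
      also have "(2::nat) ^ j \<le> p ^ j" using p_gt_1 by (intro power_mono) auto
      also have "p ^ j \<le> n" unfolding n_def using p_pos by (intro power_increasing) auto
      finally show ?thesis .
    qed
    ultimately show ?thesis by blast
  qed
  then show ?thesis using b by (auto simp: INFM_nat)
qed

end

section \<open>Rank growth\<close>

context self_replicating begin

text \<open>
  \<open>G\<close> has the proper open subgroup \<open>G\<^sub>1\<close> and hence a nontrivial character.
\<close>

lemma proper_if_killed_by_chars:
  assumes "\<forall>\<theta>\<in>chars (carrier G). \<forall>x\<in>K. \<theta> x = 0"
  shows "K \<noteq> carrier G"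
proof
  assume eq: "K = carrier G"
  obtain \<theta> where \<theta>: "\<theta> \<in> chars (carrier G)" "index G (carrier G) {x\<in>carrier G. \<theta> x = 0} = p"
    using char_vanishing_on_proper[OF fin_sub_G1 G1_proper] by blast
  have "{x\<in>carrier G. \<theta> x = 0} = carrier G" using assms \<theta>(1) eq by blast
  then show False using \<theta>(2) index_self[OF subgroup_self] p_gt_1 by simp
qed

text \<open>
  The common kernel of the finitely many characters of \<open>G\<close> is an open subgroup, so that the congruence
  subgroup property applies to it.
\<close>

lemma exists_pcs_killed_by_chars:
  assumes fin: "finite (chars (carrier G))" and csp: "congruence_subgroup_property G T r G\<^sub>1 \<phi>"
  shows "\<exists>n. \<forall>\<theta>\<in>chars (carrier G). \<forall>x\<in>pcs n. \<theta> x = 0"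
proof -
  note self = subgroup_self closedin_carrier
  let ?X = "chars (carrier G)"
  have ne: "?X \<noteq> {}" using char_zero[OF self] by blast
  define K where "K = (\<Inter>\<theta>\<in>?X. {x\<in>carrier G. \<theta> x = 0})"
  have sK: "subgroup K G"
    unfolding K_def using ne char_kernel(1)[OF self] by (intro subgroups_Inter) auto
  have clK: "closedin T K"
    unfolding K_def using ne char_kernel(2)[OF self] by (intro closedin_INT) auto
  have in_K: "x \<in> K \<longleftrightarrow> (\<forall>\<theta>\<in>?X. \<theta> x = 0)" if "x \<in> carrier G" for x
    using that ne by (auto simp: K_def)
  have "index G (carrier G) K = card ((\<lambda>x. \<lambda>\<theta>\<in>?X. \<theta> x) ` carrier G)"
  proof (rule index_eq_card_image[OF sK subset_refl])
    fix x y assume xy: "x \<in> carrier G" "y \<in> carrier G"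
    then have "x \<otimes> inv y \<in> K \<longleftrightarrow> (\<forall>\<theta>\<in>?X. \<theta> x = \<theta> y)"
      using in_K[of "x \<otimes> inv y"] char_eq_iff[OF self _ xy] by simp
    then show "(\<lambda>\<theta>\<in>?X. \<theta> x) = (\<lambda>\<theta>\<in>?X. \<theta> y) \<longleftrightarrow> x \<otimes> inv y \<in> K" by (simp only: restrict_eq_iff)
  qed
  moreover have "(\<lambda>\<theta>\<in>?X. \<theta> x) \<in> ?X \<rightarrow>\<^sub>E {0..<int p}" if "x \<in> carrier G" for x
    using char_range[OF self _ that] by (simp add: restrict_PiE_iff)
  then have "finite ((\<lambda>x. \<lambda>\<theta>\<in>?X. \<theta> x) ` carrier G)"
    by (intro finite_subset[OF image_subsetI finite_PiE[OF fin, of "\<lambda>_. {0..<int p}"]]) auto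
  ultimately have "0 < index G (carrier G) K"
    using subgroup_ne[OF subgroup_self] by (simp add: card_gt_0_iff)
  then have "finite (rcosets K)" by (simp add: index_pos_iff[OF subgroup_ne[OF subgroup_self]] rcosets_eq_image)
  then obtain n where n: "pcs n \<subseteq> K"
    using csp sK clK unfolding congruence_subgroup_property_def closed_subgroup_def by blast
  interpret C: power_coordinates G T p "pcs n" "words r n" "\<lambda>w x. foldl \<phi> x w"
    by (rule pcs_power_coordinates)
  have "\<theta> x = 0" if "\<theta> \<in> ?X" "x \<in> pcs n" for \<theta> x
  proof -
    have "x \<in> K" using n that(2) by (rule subsetD)
    moreover have "x \<in> carrier G" using C.N_subset that(2) by (rule subsetD)
    ultimately show ?thesis using in_K that(1) by simp
  qed
  then show ?thesis by blast
qed

text \<open>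
  Combine \<open>card_chars_level_le\<close> and \<open>d_p_max_superadditive\<close>, both for \<open>N \<cong> G\<^sup>k\<close>, by means of \<open>superadditive_limit\<close>
  with \<open>q = k - 1\<close>. The index \<open>m = 0\<close> of the supremum gives the lower bound.
\<close>

lemma rank_growth_bounds:
  assumes finG: "finite (chars (carrier G))"
    and chars: "\<And>U. fin_sub U \<Longrightarrow> finite (chars U)" and levels: "\<And>m. finite (level m)" "\<And>m. level m \<noteq> {}"
    and N: "N = pcs n" "N \<lhd> G" "isos_to_power G T N k \<noteq> {}" "order (G Mod N) = p ^ l" "N \<subseteq> frattini_p p G T"
  shows "(real k - 1) * real (d_p p G T) / real l \<le> rank_growth p G T"
    and "rank_growth p G T
         \<le> (real k - 1) * real (d_p p G T) + real (max_subgroup_rank p (G Mod N))"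
    and "(\<lambda>m. real (d_p_max p G T m) / real m) \<longlonglongrightarrow> rank_growth p G T"
    and "bdd_above (range (\<lambda>m. real (d_p_max p G T m) / (real m + real l / (real k - 1))))"
    and "rank_growth p G T = (SUP m. real (d_p_max p G T m) / (real m + real l / (real k - 1)))"
proof -
  define d where "d = d_p p G T"
  have d: "card (chars (carrier G)) = p ^ d" unfolding d_def by (rule card_chars_carrier[OF finG])
  interpret W: power_coordinates G T p N "words r n" "\<lambda>w x. foldl \<phi> x w"
    unfolding N(1) by (rule pcs_power_coordinates)
  obtain f where f: "f \<in> isos_to_power G T N k" using N(3) by blast
  interpret C: power_coordinates G T p N "{..<k}" "\<lambda>i x. f x i"
    by (rule power_coordinates_of_iso[OF W.fin_sub_N f])
  have killed: "\<forall>\<theta>\<in>chars (carrier G). \<forall>x\<in>N. \<theta> x = 0"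
    using frattini_subset_kernel N(5) by blast
  then have ne: "N \<noteq> carrier G" by (rule proper_if_killed_by_chars)
  have l: "N \<in> level l"
    using N(4) W.fin_sub_N card_rcosets[of G N] by (simp add: level_def order_def FactGroup_def)
  have "l \<noteq> 0"
  proof
    assume "l = 0" then show False using l level_0 ne by simp
  qed
  then have l0: "0 < l" by simp
  have n0: "0 < n" using ne N(1) by (intro gr0I) simp
  have "d \<noteq> 0"
  proof
    assume "d = 0"
    then have "card (chars (carrier G)) = 1" using d by simp
    then obtain \<theta>0 where X: "chars (carrier G) = {\<theta>0}" by (auto simp: card_1_singleton_iff)
    have "(\<lambda>x\<in>carrier G. 0) \<in> chars (carrier G)" by (rule char_zero[OF subgroup_self closedin_carrier])
    then have "\<forall>\<theta>\<in>chars (carrier G). \<forall>x\<in>carrier G. \<theta> x = 0" unfolding X by auto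
    then have "carrier G \<noteq> carrier G" by (rule proper_if_killed_by_chars)
    then show False by simp
  qed
  \<comment> \<open>Counting the characters of \<open>N\<close> in both coordinate systems identifies \<open>k\<close>.\<close>
  have "p ^ (d * card {..<k}) = p ^ (d * card (words r n))"
    using C.card_chars_power[OF finG] W.card_chars_power[OF finG] by (simp add: d power_mult)
  then have "d * k = d * r ^ n" using p_gt_1 by (simp add: power_inject_exp card_words)
  then have "k = r ^ n" using \<open>d \<noteq> 0\<close> by simp
  moreover have "2 ^ 1 \<le> (2::nat) ^ n" using n0 by (intro power_increasing) auto
  moreover have "2 ^ n \<le> r ^ n" using r_ge_2 by (intro power_mono) auto
  ultimately have k2: "2 \<le> k" by simp
  then obtain q where q: "k = Suc q" "0 < q" by (cases k) auto
  let ?A = "max_subgroup_rank p (G Mod N) + q * d"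
  have bound: "finite (chars U) \<and> card (chars U) \<le> p ^ (?A * m + d)" if "U \<in> level m" for U m
  proof (rule C.card_chars_level_le[OF finG d killed _ _ that])
    show "card {\<theta> \<in> chars V. \<forall>x\<in>V \<inter> N. \<theta> x = 0} \<le> p ^ max_subgroup_rank p (G Mod N)" if "fin_sub V" for V
      by (rule vanishing_chars_le_max_subgroup_rank[OF W.fin_sub_N N(2) that])
    show "card {..<k} = Suc q" using q by simp
  qed
  let ?f = "d_p_max p G T"
  have lin: "?f m \<le> ?A * m + d" for m
  proof -
    have "finite (chars U)" if "U \<in> level m" for U using bound[OF that] by simp
    then obtain U where "U \<in> level m" "card (chars U) = p ^ ?f m"
      using d_p_max_attained[OF levels] by blast
    then have "p ^ ?f m \<le> p ^ (?A * m + d)" using bound by metis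
    then show ?thesis by (rule power_le_imp_le_exp[OF p_gt_1])
  qed
  have super: "q * ?f m + ?f s \<le> ?f (q * m + l + s)" for m s
  proof -
    \<comment> \<open>\<open>k - 1 = q\<close> of the factors contribute \<open>m\<close>, the last one \<open>s\<close>\<close>
    let ?e = "\<lambda>i. if i = q then s else m"
    have sum_e: "(\<Sum>i<k. h (?e i)) = q * h m + h s" for h :: "nat \<Rightarrow> nat" by (simp add: q(1))
    have "(\<Sum>i<k. ?f (?e i)) \<le> ?f (l + (\<Sum>i<k. ?e i))"
      by (rule C.d_p_max_superadditive[OF levels chars l])
    then show ?thesis using sum_e[of ?f] sum_e[of "\<lambda>x. x"] by (simp add: ac_simps)
  qed
  note lim = superadditive_limit[OF q(2) l0 super lin]
  define L where "L = (SUP m. real (?f m) / (real m + real l / real q))"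
  have q_eq: "real k - 1 = real q" by (simp add: q(1))
  have L: "rank_growth p G T = L"
    unfolding rank_growth_def L_def using lim(2) by (rule limI)
  show "bdd_above (range (\<lambda>m. real (?f m) / (real m + real l / (real k - 1))))"
    unfolding q_eq by (rule lim(1))
  show "rank_growth p G T = (SUP m. real (?f m) / (real m + real l / (real k - 1)))"
    unfolding q_eq L L_def ..
  show "(\<lambda>m. real (?f m) / real m) \<longlonglongrightarrow> rank_growth p G T"
    unfolding L L_def by (rule lim(2))
  show "rank_growth p G T \<le> (real k - 1) * real (d_p p G T) + real (max_subgroup_rank p (G Mod N))"
    unfolding q_eq L L_def using lim(4) by (simp add: d_def)
  have "?f 0 = d"
  proof -
    obtain U where "U \<in> level 0" "card (chars U) = p ^ ?f 0"
      using d_p_max_attained[OF levels, of 0] bound by blast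
    then have "p ^ ?f 0 = p ^ d" using level_0 d by simp
    then show ?thesis using p_gt_1 by (simp add: power_inject_exp)
  qed
  then show "(real k - 1) * real (d_p p G T) / real l \<le> rank_growth p G T"
    unfolding q_eq L L_def using lim(3) by (simp add: d_def)
qed

end

theorem theorem2:
  fixes p :: nat and G :: "('a, 'b) monoid_scheme" and T :: "'a topology"
    and r :: nat and G\<^sub>1 :: "'a set" and \<phi> :: "'a \<Rightarrow> nat \<Rightarrow> 'a"
  assumes "prime p"
    and "p_group p G \<and> T = discrete_topology (carrier G) \<or> pro_p_group p G T"
    and "top_finitely_generated G T"
    and "self_replicating_by G T r G\<^sub>1 \<phi>"
    and "congruence_subgroup_property G T r G\<^sub>1 \<phi>"
  shows "has_subgroup_growth_type G T (\<lambda>n. real n powr log (real p) (real n)) \<and>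
    (\<forall>N k l.
       (\<exists>n. N = principal_congruence_subgroup G r G\<^sub>1 \<phi> n) \<and> N \<lhd> G \<and>
       isos_to_power G T N k \<noteq> {} \<and> order (G Mod N) = p ^ l \<and> N \<subseteq> frattini_p p G T \<longrightarrow>
       (real k - 1) * real (d_p p G T) / real l \<le> rank_growth p G T \<and>
       rank_growth p G T
         \<le> (real k - 1) * real (d_p p G T) + real (max_subgroup_rank p (G Mod N)) \<and>
       (\<lambda>m. real (d_p_max p G T m) / real m) \<longlonglongrightarrow> rank_growth p G T \<and>
       bdd_above (range (\<lambda>m. real (d_p_max p G T m) / (real m + real l / (real k - 1)))) \<and>
       rank_growth p G T = (SUP m. real (d_p_max p G T m) / (real m + real l / (real k - 1))))"
proof -
  have "p_power_index G T p"
    using assms(2) p_power_index_if_p_group[OF assms(1)] p_power_index_if_pro_p[OF assms(1)] by blast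
  then interpret self_replicating G T p r G\<^sub>1 \<phi>
    using assms(4) by (intro self_replicating.intro self_replicating_axioms.intro)
  have finG: "finite (chars (carrier G))" by (rule card_chars_top_finitely_generated[OF assms(3)])
  have d: "card (chars (carrier G)) = p ^ d_p p G T" by (rule card_chars_carrier[OF finG])
  obtain n where n: "\<forall>\<theta>\<in>chars (carrier G). \<forall>x\<in>pcs n. \<theta> x = 0"
    using exists_pcs_killed_by_chars[OF finG assms(5)] by blast
  interpret C: power_coordinates G T p "pcs n" "words r n" "\<lambda>w x. foldl \<phi> x w"
    by (rule pcs_power_coordinates)
  have ne: "pcs n \<noteq> carrier G" using n by (rule proper_if_killed_by_chars)
  have "0 < r ^ n" using r_ge_2 by simp
  then obtain k where k: "card (words r n) = Suc k" unfolding card_words by (metis Suc_pred)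
  then have words_ne: "words r n \<noteq> {}" by auto
  let ?A = "index G (carrier G) (pcs n) + k * d_p p G T"
  have bound: "finite (chars U) \<and> card (chars U) \<le> p ^ (?A * m + d_p p G T)" if "U \<in> level m" for U m
    by (rule C.card_chars_level_le[OF finG d n vanishing_chars_le_index(2)[OF C.fin_sub_N] k that])
  have chars: "finite (chars U)" if "fin_sub U" for U
    using fin_sub_level[OF that] bound by blast
  have levels: "finite (level m)" "level m \<noteq> {}" for m
    using card_level_le[of "\<lambda>m. ?A * m + d_p p G T" m, OF bound] C.level_nonempty[OF ne words_ne] by auto
  note upper = subgroup_growth_upper[OF bound]
  have "has_subgroup_growth_type G T (\<lambda>n. real n powr log (real p) (real n))"
    unfolding has_subgroup_growth_type_def
  proof (intro conjI allI)
    show "finite (subgroups_index_le G T m)" for m by (rule upper(1))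
    show "\<exists>a>0. \<forall>m\<ge>1. real (card (subgroups_index_le G T m)) \<le> (real m powr log (real p) (real m)) powr a"
    proof (intro exI[of _ "real (?A + d_p p G T + 1)"] conjI allI impI upper(2))
      show "0 < real (?A + d_p p G T + 1)" unfolding of_nat_0_less_iff by simp
    qed simp
    show "\<exists>b>0. \<exists>\<^sub>\<infinity>m. (real m powr log (real p) (real m)) powr b \<le> real (card (subgroups_index_le G T m))"
      by (rule subgroup_growth_lower[OF upper(1)])
  qed
  moreover have "(real k - 1) * real (d_p p G T) / real l \<le> rank_growth p G T \<and>
       rank_growth p G T
         \<le> (real k - 1) * real (d_p p G T) + real (max_subgroup_rank p (G Mod N)) \<and>
       (\<lambda>m. real (d_p_max p G T m) / real m) \<longlonglongrightarrow> rank_growth p G T \<and>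
       bdd_above (range (\<lambda>m. real (d_p_max p G T m) / (real m + real l / (real k - 1)))) \<and>
       rank_growth p G T = (SUP m. real (d_p_max p G T m) / (real m + real l / (real k - 1)))"
    if N: "(\<exists>n. N = pcs n) \<and> N \<lhd> G \<and> isos_to_power G T N k \<noteq> {} \<and> order (G Mod N) = p ^ l \<and>
      N \<subseteq> frattini_p p G T" for N k l
  proof -
    obtain n where "N = pcs n" using N by (elim conjE exE)
    note bounds = rank_growth_bounds[OF finG chars levels this N[THEN conjunct2, THEN conjunct1]
        N[THEN conjunct2, THEN conjunct2, THEN conjunct1]
        N[THEN conjunct2, THEN conjunct2, THEN conjunct2, THEN conjunct1]
        N[THEN conjunct2, THEN conjunct2, THEN conjunct2, THEN conjunct2]]
    show ?thesis by (intro conjI bounds)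
  qed
  ultimately show ?thesis by (intro conjI[of "has_subgroup_growth_type _ _ _"] allI impI)
qed

end
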